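(* Let $p\geq1$, $\varphi\in\mathscr{C}_b(\mathbb{R}^{\binom p2})$, $\Phi=\Phi^{p,\varphi}$, and let $A>0$ be an upper bound on $\|\varphi\|_\infty$. Let $F(x)=4\exp\!\left(\frac{\log(1+x)-x}{e^2}\right)$ for $x\geq0$ (a strictly decreasing function from $[0,\infty)$ onto $(0,4]$), and for $\alpha\in(0,1)$ set $$t_\alpha=\frac{4Ap^2}{e}\,F^{-1}(\alpha).$$ Let $\mathscr{X}=(\mathcal{X},d,\mu)$ be a compact Riemannian manifold, and let $Z_n=n\,|\Phi(\mathscr{X}_n)-\Phi(\mathscr{X}_n')|$. Then for any $n\geq1$ and any significance level $\alpha\in(0,1)$, the statistic $Z_n$ and the threshold $t_\alpha$ yield a test of the hypothesis of symmetry $H_0$: "$\mathscr{X}$ is homogeneous" with level smaller than $\alpha$: $$\mathbb{P}_{H_0}[Z_n\geq t_\alpha]\leq\alpha,$$ that is, if $\mathscr{X}$ is homogeneous then $\mathbb{P}[Z_n\geq t_\alpha]\leq\alpha$.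
   Context: A compact Riemannian manifold $\mathcal{X}$ is viewed as a metric measure space $\mathscr{X}=(\mathcal{X},d,\mu)$, where $d$ is the geodesic distance (any two points being joined by a minimal geodesic) and $\mu$ is the probability measure proportional to the Riemannian volume. It is homogeneous if its isometry group acts transitively on $\mathcal{X}$ (every isometry preserves $\mu$); equivalently, $\mathscr{X}$ is up to measure-preserving isometry of the form $G/K$ with $G$ a compact group, $K$ a closed subgroup, a $G$-invariant distance and the push-forward of the Haar probability measure of $G$. $\Phi^{p,\varphi}(\mathcal{X},d,\mu)=\int_{\mathcal{X}^p}\varphi((d(x_a,x_b))_{1\leq a<b\leq p})\,\mu^{\otimes p}(dx_1\cdots dx_p)$. Let $x_1,\dots,x_n,x_1',\dots,x_n'$ be independent random points of $\mathcal{X}$ with law $\mu$, $\mathscr{X}_n=(\{x_1,\dots,x_n\},d,\frac1n\sum_i\delta_{x_i})$ and $\mathscr{X}_n'=(\{x_1',\dots,x_n'\},d,\frac1n\sum_i\delta_{x_i'})$, so $\Phi(\mathscr{X}_n)=\frac{1}{n^p}\sum_{i_1,\dots,i_p=1}^n\varphi((d(x_{i_a},x_{i_b}))_{1\leq a<b\leq p})$ and similarly for $\Phi(\mathscr{X}_n')$. Here $e=\exp(1)$. *)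

theory Defs
  imports "HOL-Probability.Probability" "HOL-Real_Asymp.Real_Asymp"
begin

primrec Ck_on ::
  "nat \<Rightarrow> 'e::real_normed_vector set \<Rightarrow> ('e \<Rightarrow> 'b::real_normed_vector) \<Rightarrow> bool" where
  "Ck_on 0 S f \<longleftrightarrow> continuous_on S f"
| "Ck_on (Suc k) S f \<longleftrightarrow>
     (\<forall>x\<in>S. f differentiable (at x)) \<and>
     (\<forall>v. Ck_on k S (\<lambda>x. frechet_derivative f (at x) v))"

definition smooth_on ::
  "'e::real_normed_vector set \<Rightarrow> ('e \<Rightarrow> 'b::real_normed_vector) \<Rightarrow> bool" where
  "smooth_on S f \<longleftrightarrow> (\<forall>k. Ck_on k S f)"

text \<open>A chart is a pair \<open>(U, \<psi>)\<close> of its domain and its coordinate map; the values of \<open>\<psi>\<close> outside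
  \<open>U\<close> are irrelevant. The manifold is the whole type \<open>'a\<close>, its dimension is \<open>CARD('n)\<close>.\<close>

type_synonym ('a, 'n) chart = "'a set \<times> ('a \<Rightarrow> real ^ 'n)"

definition is_chart :: "('a::topological_space, 'n::finite) chart \<Rightarrow> bool" where
  "is_chart = (\<lambda>(U, \<psi>). open U \<and> open (\<psi> ` U) \<and> homeomorphism U (\<psi> ` U) \<psi> (inv_into U \<psi>))"

definition transition ::
  "('a, 'n::finite) chart \<Rightarrow> ('a, 'n) chart \<Rightarrow> real ^ 'n \<Rightarrow> real ^ 'n" where
  "transition c c' = snd c' \<circ> inv_into (fst c) (snd c)"

definition smooth_atlas :: "('a::topological_space, 'n::finite) chart set \<Rightarrow> bool" where
  "smooth_atlas \<A> \<longleftrightarrow>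
     (\<forall>c\<in>\<A>. is_chart c) \<and> (\<Union>c\<in>\<A>. fst c) = UNIV \<and>
     (\<forall>c\<in>\<A>. \<forall>c'\<in>\<A>. smooth_on (snd c ` (fst c \<inter> fst c')) (transition c c'))"

text \<open>A Riemannian metric is given by its Gram matrix \<open>g c x\<close> in the coordinate frame of each
  chart \<open>c\<close> around \<open>x\<close>. The last condition is the transformation rule of a covariant 2-tensor,
  with \<open>J\<close> the Jacobian matrix of the change of coordinates.\<close>

definition riemannian_metric ::
  "('a::topological_space, 'n::finite) chart set \<Rightarrow>
   (('a, 'n) chart \<Rightarrow> 'a \<Rightarrow> real ^ 'n ^ 'n) \<Rightarrow> bool" where
  "riemannian_metric \<A> g \<longleftrightarrow>
     (\<forall>c\<in>\<A>. \<forall>x\<in>fst c.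
        transpose (g c x) = g c x \<and> (\<forall>v. v \<noteq> 0 \<longrightarrow> v \<bullet> (g c x *v v) > 0)) \<and>
     (\<forall>c\<in>\<A>. smooth_on (snd c ` fst c) (\<lambda>y. g c (inv_into (fst c) (snd c) y))) \<and>
     (\<forall>c\<in>\<A>. \<forall>c'\<in>\<A>. \<forall>x\<in>fst c \<inter> fst c'.
        let J = matrix (frechet_derivative (transition c c') (at (snd c x)))
        in g c x = transpose J ** g c' x ** J)"

text \<open>Connectedness makes any two points lie at finite distance; by the Hopf--Rinow theorem they
  are then joined by a minimal geodesic.\<close>

definition compact_riemannian_manifold ::
  "('a::{t2_space,second_countable_topology}, 'n::finite) chart set \<Rightarrow>
   (('a, 'n) chart \<Rightarrow> 'a \<Rightarrow> real ^ 'n ^ 'n) \<Rightarrow> bool" where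
  "compact_riemannian_manifold \<A> g \<longleftrightarrow>
     compact (UNIV :: 'a set) \<and> connected (UNIV :: 'a set) \<and>
     smooth_atlas \<A> \<and> riemannian_metric \<A> g"

definition C1_curve_on ::
  "('a, 'n::finite) chart set \<Rightarrow> real set \<Rightarrow> (real \<Rightarrow> 'a) \<Rightarrow> bool" where
  "C1_curve_on \<A> I \<gamma> \<longleftrightarrow>
     (\<forall>c\<in>\<A>. \<exists>D. continuous_on {t\<in>I. \<gamma> t \<in> fst c} D \<and>
        (\<forall>t\<in>I. \<gamma> t \<in> fst c \<longrightarrow>
           ((\<lambda>s. snd c (\<gamma> s)) has_vector_derivative D t) (at t within I)))"

definition piecewise_C1_curve ::
  "('a::topological_space, 'n::finite) chart set \<Rightarrow> (real \<Rightarrow> 'a) \<Rightarrow> bool" where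
  "piecewise_C1_curve \<A> \<gamma> \<longleftrightarrow>
     continuous_on {0..1} \<gamma> \<and>
     (\<exists>k. \<exists>\<tau> :: nat \<Rightarrow> real. \<tau> 0 = 0 \<and> \<tau> k = 1 \<and>
        (\<forall>i<k. \<tau> i < \<tau> (Suc i) \<and> C1_curve_on \<A> {\<tau> i..\<tau> (Suc i)} \<gamma>))"

text \<open>The speed does not depend on the chosen chart by the transformation rule for \<open>g\<close>; its values
  at the finitely many break points do not affect the length.\<close>

definition curve_speed ::
  "('a, 'n::finite) chart set \<Rightarrow> (('a, 'n) chart \<Rightarrow> 'a \<Rightarrow> real ^ 'n ^ 'n) \<Rightarrow>
   (real \<Rightarrow> 'a) \<Rightarrow> real \<Rightarrow> real" where
  "curve_speed \<A> g \<gamma> t =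
     (let c = (SOME c. c \<in> \<A> \<and> \<gamma> t \<in> fst c);
          v = vector_derivative (\<lambda>s. snd c (\<gamma> s)) (at t within {0..1})
      in sqrt (v \<bullet> (g c (\<gamma> t) *v v)))"

definition curve_length ::
  "('a, 'n::finite) chart set \<Rightarrow> (('a, 'n) chart \<Rightarrow> 'a \<Rightarrow> real ^ 'n ^ 'n) \<Rightarrow>
   (real \<Rightarrow> 'a) \<Rightarrow> real" where
  "curve_length \<A> g \<gamma> = integral {0..1} (curve_speed \<A> g \<gamma>)"

definition geodesic_dist ::
  "('a::topological_space, 'n::finite) chart set \<Rightarrow>
   (('a, 'n) chart \<Rightarrow> 'a \<Rightarrow> real ^ 'n ^ 'n) \<Rightarrow> 'a \<Rightarrow> 'a \<Rightarrow> real" where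
  "geodesic_dist \<A> g x y =
     Inf {curve_length \<A> g \<gamma> |\<gamma>. piecewise_C1_curve \<A> \<gamma> \<and> \<gamma> 0 = x \<and> \<gamma> 1 = y}"

text \<open>The Riemannian volume is the unique Borel measure with density \<open>sqrt (det g)\<close> with respect to
  the Lebesgue measure in every chart.\<close>

definition is_riemannian_volume ::
  "('a::topological_space, 'n::finite) chart set \<Rightarrow>
   (('a, 'n) chart \<Rightarrow> 'a \<Rightarrow> real ^ 'n ^ 'n) \<Rightarrow> 'a measure \<Rightarrow> bool" where
  "is_riemannian_volume \<A> g \<nu> \<longleftrightarrow>
     sets \<nu> = sets borel \<and>
     (\<forall>c\<in>\<A>. \<forall>B\<in>sets borel. B \<subseteq> fst c \<longrightarrow>
        emeasure \<nu> B =
          (\<integral>\<^sup>+y\<in>snd c ` B. ennreal (sqrt (det (g c (inv_into (fst c) (snd c) y)))) \<partial>lborel))"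

definition is_normalized_volume ::
  "('a::topological_space, 'n::finite) chart set \<Rightarrow>
   (('a, 'n) chart \<Rightarrow> 'a \<Rightarrow> real ^ 'n ^ 'n) \<Rightarrow> 'a measure \<Rightarrow> bool" where
  "is_normalized_volume \<A> g \<mu> \<longleftrightarrow>
     prob_space \<mu> \<and> (\<exists>\<nu> r. is_riemannian_volume \<A> g \<nu> \<and> \<mu> = scale_measure r \<nu>)"

text \<open>Isometries are the distance-preserving bijections; neither smoothness nor preservation of the
  volume is required.\<close>

definition isometry_of :: "('a \<Rightarrow> 'a \<Rightarrow> real) \<Rightarrow> ('a \<Rightarrow> 'a) \<Rightarrow> bool" where
  "isometry_of d f \<longleftrightarrow> bij f \<and> (\<forall>x y. d (f x) (f y) = d x y)"

definition homogeneous :: "('a \<Rightarrow> 'a \<Rightarrow> real) \<Rightarrow> bool" where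
  "homogeneous d \<longleftrightarrow> (\<forall>x y. \<exists>f. isometry_of d f \<and> f x = y)"

definition pairs :: "nat \<Rightarrow> (nat \<times> nat) set" where
  "pairs p = {(a, b). 1 \<le> a \<and> a < b \<and> b \<le> p}"

text \<open>The space of real vectors indexed by \<open>pairs p\<close> is rendered as \<open>pairs p \<rightarrow>\<^sub>E UNIV\<close>, the carrier of
  the product topology; values of \<open>\<phi>\<close> elsewhere are irrelevant.\<close>

definition sup_norm_le :: "nat \<Rightarrow> ((nat \<times> nat \<Rightarrow> real) \<Rightarrow> real) \<Rightarrow> real \<Rightarrow> bool" where
  "sup_norm_le p \<phi> A \<longleftrightarrow> (\<forall>v \<in> pairs p \<rightarrow>\<^sub>E UNIV. \<bar>\<phi> v\<bar> \<le> A)"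

definition cont_bdd :: "nat \<Rightarrow> ((nat \<times> nat \<Rightarrow> real) \<Rightarrow> real) \<Rightarrow> bool" where
  "cont_bdd p \<phi> \<longleftrightarrow>
     continuous_map (product_topology (\<lambda>_. euclidean) (pairs p)) euclidean \<phi> \<and>
     (\<exists>B. sup_norm_le p \<phi> B)"

definition dist_vec :: "nat \<Rightarrow> ('a \<Rightarrow> 'a \<Rightarrow> real) \<Rightarrow> (nat \<Rightarrow> 'a) \<Rightarrow> nat \<times> nat \<Rightarrow> real" where
  "dist_vec p d x = (\<lambda>(a, b)\<in>pairs p. d (x a) (x b))"

text \<open>The metric measure space is \<open>(space m, d, m)\<close>.\<close>

definition Phi ::
  "nat \<Rightarrow> ((nat \<times> nat \<Rightarrow> real) \<Rightarrow> real) \<Rightarrow> ('a \<Rightarrow> 'a \<Rightarrow> real) \<Rightarrow> 'a measure \<Rightarrow> real" where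
  "Phi p \<phi> d m = (\<integral>x. \<phi> (dist_vec p d x) \<partial>(\<Pi>\<^sub>M a\<in>{1..p}. m))"

text \<open>The underlying space is the set of sample points; points that occur repeatedly carry the
  corresponding multiple of \<open>1 / n\<close>.\<close>

definition empirical :: "nat \<Rightarrow> (nat \<Rightarrow> 'a) \<Rightarrow> 'a measure" where
  "empirical n x = distr (uniform_count_measure {1..n}) (count_space (x ` {1..n})) x"

lemma Phi_empirical:
  assumes "n \<ge> 1"
  shows "Phi p \<phi> d (empirical n x) =
    (\<Sum>i\<in>{1..p} \<rightarrow>\<^sub>E {1..n}. \<phi> (dist_vec p d (\<lambda>a. x (i a)))) / real n ^ p"
proof -
  let ?N = "{1..n}"
  let ?I = "{1..p}"
  let ?U = "uniform_count_measure ?N"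
  have ne: "?N \<noteq> {}" using assms by auto
  interpret U: prob_space ?U using ne by (intro prob_space_uniform_count_measure) auto
  have meas: "x \<in> measurable ?U (count_space (x ` ?N))"
    by (auto simp: measurable_def space_uniform_count_measure sets_uniform_count_measure)
  have E: "prob_space (empirical n x)"
    unfolding empirical_def by (rule U.prob_space_distr[OF meas])
  have sE: "sets (empirical n x) = sets (count_space (x ` ?N))" by (simp add: empirical_def)
  have meas': "x \<in> measurable ?U (empirical n x)"
    using meas measurable_cong_sets[OF refl sE] by blast
  have dE: "distr ?U (empirical n x) x = empirical n x"
    unfolding empirical_def by (intro distr_cong) auto
  have D: "distr (Pi\<^sub>M ?I (\<lambda>_. ?U)) (Pi\<^sub>M ?I (\<lambda>_. empirical n x)) (compose ?I x)
             = Pi\<^sub>M ?I (\<lambda>_. empirical n x)"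
    using distr_PiM_finite_prob_space'[of ?I "\<lambda>_. ?U" "\<lambda>_. empirical n x" x]
      U.prob_space_axioms E meas' dE by auto
  interpret PU: product_prob_space "\<lambda>_. ?U" ?I
    by (intro product_prob_spaceI U.prob_space_axioms)
  have PU_eq: "Pi\<^sub>M ?I (\<lambda>_. ?U) = uniform_count_measure (?I \<rightarrow>\<^sub>E ?N)"
  proof (rule measure_eqI_finite[where A = "?I \<rightarrow>\<^sub>E ?N"])
    have "sets (Pi\<^sub>M ?I (\<lambda>_. ?U)) = sets (Pi\<^sub>M ?I (\<lambda>_. count_space ?N))"
      by (intro sets_PiM_cong) (auto simp: sets_uniform_count_measure)
    also have "\<dots> = Pow (?I \<rightarrow>\<^sub>E ?N)" by (subst count_space_PiM_finite) auto
    finally show "sets (Pi\<^sub>M ?I (\<lambda>_. ?U)) = Pow (?I \<rightarrow>\<^sub>E ?N)" .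
    show "sets (uniform_count_measure (?I \<rightarrow>\<^sub>E ?N)) = Pow (?I \<rightarrow>\<^sub>E ?N)"
      by (simp add: sets_uniform_count_measure)
    show fin: "finite (?I \<rightarrow>\<^sub>E ?N)" by (intro finite_PiE) auto
    fix i assume i: "i \<in> ?I \<rightarrow>\<^sub>E ?N"
    have "{i} = (\<Pi>\<^sub>E a\<in>?I. {i a})" using i by (simp add: PiE_singleton PiE_iff)
    then have "emeasure (Pi\<^sub>M ?I (\<lambda>_. ?U)) {i} = (\<Prod>a\<in>?I. emeasure ?U {i a})"
      using i by (simp only:, subst PU.emeasure_PiM) (auto simp: sets_uniform_count_measure)
    also have "\<dots> = (\<Prod>a\<in>?I. ennreal (1 / real n))"
      using i assms by (intro prod.cong refl, subst emeasure_uniform_count_measure) auto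
    also have "\<dots> = ennreal (1 / real n ^ p)"
      using assms by (simp add: ennreal_power power_divide)
    also have "\<dots> = emeasure (uniform_count_measure (?I \<rightarrow>\<^sub>E ?N)) {i}"
      using i fin by (subst emeasure_uniform_count_measure) (auto simp: card_PiE)
    finally show "emeasure (Pi\<^sub>M ?I (\<lambda>_. ?U)) {i}
                    = emeasure (uniform_count_measure (?I \<rightarrow>\<^sub>E ?N)) {i}" .
  qed
  have dv: "dist_vec p d (compose ?I x i) = dist_vec p d (\<lambda>a. x (i a))" for i
    by (auto simp: dist_vec_def pairs_def compose_def fun_eq_iff)
  have sPE: "sets (Pi\<^sub>M ?I (\<lambda>_. empirical n x)) = Pow (?I \<rightarrow>\<^sub>E x ` ?N)"
  proof -
    have "sets (Pi\<^sub>M ?I (\<lambda>_. empirical n x)) = sets (Pi\<^sub>M ?I (\<lambda>_. count_space (x ` ?N)))"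
      by (intro sets_PiM_cong) (auto simp: sE)
    also have "\<dots> = Pow (?I \<rightarrow>\<^sub>E x ` ?N)"
      by (subst count_space_PiM_finite) (auto intro: countable_finite)
    finally show ?thesis .
  qed
  have spE: "space (Pi\<^sub>M ?I (\<lambda>_. empirical n x)) = ?I \<rightarrow>\<^sub>E x ` ?N"
    by (simp add: space_PiM empirical_def)
  have mc: "compose ?I x \<in> measurable (Pi\<^sub>M ?I (\<lambda>_. ?U)) (Pi\<^sub>M ?I (\<lambda>_. empirical n x))"
    unfolding compose_def
    by (intro measurable_restrict measurable_compose[OF _ meas'] measurable_component_singleton)
  have m\<phi>: "(\<lambda>y. \<phi> (dist_vec p d y)) \<in> borel_measurable (Pi\<^sub>M ?I (\<lambda>_. empirical n x))"
    by (auto simp: measurable_def sPE spE simp del: One_nat_def)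
  have "Phi p \<phi> d (empirical n x)
          = (\<integral>i. \<phi> (dist_vec p d (compose ?I x i)) \<partial>(Pi\<^sub>M ?I (\<lambda>_. ?U)))"
    unfolding Phi_def by (subst D[symmetric], subst integral_distr[OF mc m\<phi>]) simp
  also have "\<dots> = (\<Sum>i\<in>?I \<rightarrow>\<^sub>E ?N. \<phi> (dist_vec p d (\<lambda>a. x (i a))) / real n ^ p)"
    unfolding PU_eq dv
    by (subst integral_uniform_count_measure)
      (auto intro!: finite_PiE simp: card_PiE sum_divide_distrib)
  finally show ?thesis by (simp add: sum_divide_distrib)
qed

definition Z_stat ::
  "nat \<Rightarrow> nat \<Rightarrow> ((nat \<times> nat \<Rightarrow> real) \<Rightarrow> real) \<Rightarrow> ('a \<Rightarrow> 'a \<Rightarrow> real) \<Rightarrow>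
   (nat \<Rightarrow> 'a) \<Rightarrow> (nat \<Rightarrow> 'a) \<Rightarrow> real" where
  "Z_stat n p \<phi> d x x' = real n * \<bar>Phi p \<phi> d (empirical n x) - Phi p \<phi> d (empirical n x')\<bar>"

definition tail_F :: "real \<Rightarrow> real" where
  "tail_F x = 4 * exp ((ln (1 + x) - x) / (exp 1)\<^sup>2)"

lemma tail_F_strict_antimono: "0 \<le> x \<Longrightarrow> x < y \<Longrightarrow> tail_F y < tail_F x"
proof -
  assume x: "0 \<le> x" "x < y"
  have "ln ((1 + y) / (1 + x)) < (1 + y) / (1 + x) - 1"
    using x ln_le_minus_one[of "(1 + y) / (1 + x)"] ln_eq_minus_one[of "(1 + y) / (1 + x)"]
    by (force simp: field_simps)
  also have "\<dots> = (y - x) / (1 + x)" using x by (simp add: field_simps)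
  also have "\<dots> \<le> y - x" using x by (simp add: divide_le_eq mult_le_cancel_left1)
  finally have "ln (1 + y) - y < ln (1 + x) - x" using x by (simp add: ln_div)
  then show ?thesis by (simp add: tail_F_def divide_strict_right_mono)
qed

lemma bij_betw_tail_F: "bij_betw tail_F {0..} {0<..4}"
proof -
  have inj: "inj_on tail_F {0..}"
    by (rule linorder_inj_onI) (auto dest: tail_F_strict_antimono)
  have "tail_F ` {0..} \<subseteq> {0<..4}"
  proof
    fix y assume "y \<in> tail_F ` {0..}"
    then obtain x where x: "x \<ge> 0" "y = tail_F x" by auto
    then have "tail_F x \<le> tail_F 0"
      using tail_F_strict_antimono[of 0 x] by (cases "x = 0") auto
    then show "y \<in> {0<..4}" using x by (simp add: tail_F_def)
  qed
  moreover have "{0<..4} \<subseteq> tail_F ` {0..}"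
  proof
    fix y :: real assume y: "y \<in> {0<..4}"
    have "((\<lambda>x. tail_F x) \<longlongrightarrow> 0) at_top"
    proof -
      define c :: real where "c = (exp 1)\<^sup>2"
      have "c > 0" by (simp add: c_def)
      then show ?thesis unfolding tail_F_def c_def[symmetric] by real_asymp
    qed
    then have "eventually (\<lambda>x. tail_F x < y \<and> x \<ge> 0) at_top"
      using y by (intro eventually_conj order_tendstoD(2) eventually_ge_at_top) auto
    then obtain b where b: "tail_F b < y" "b \<ge> 0"
      by (metis (mono_tags, lifting) eventually_happens' trivial_limit_at_top_linorder)
    have "continuous_on {0..b} tail_F"
      unfolding tail_F_def by (intro continuous_intros) auto
    then have "\<exists>x. 0 \<le> x \<and> x \<le> b \<and> tail_F x = y"
      using b y by (intro IVT2') (auto simp: tail_F_def)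
    then show "y \<in> tail_F ` {0..}" by auto
  qed
  ultimately show ?thesis using inj by (auto simp: bij_betw_def)
qed

definition threshold :: "real \<Rightarrow> nat \<Rightarrow> real \<Rightarrow> real" where
  "threshold A p \<alpha> = 4 * A * (real p)\<^sup>2 / exp 1 * inv_into {0..} tail_F \<alpha>"

end

(*
  Averaging a function of the sample over all coordinates but one gives a constant: an isometry
  moves any value of the remaining coordinate to any other one, and it preserves both the statistic
  and the law mu. So f = n * Phi(X_n) has no first-order Hoeffding term, while its second differences
  are at most b = 4 A p^2 / n, because only about p^2 n^(p-2) of the n^p terms see two given sample
  points. Write f - E f as a sum of martingale increments. Each increment, with its own coordinate
  frozen, is centred in the others and has differences at most b, so McDiarmid's inequality makes it
  sub-Gaussian with variance of order n b^2. Compensating the martingale by the logarithms of the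
  conditional means of exp(increment^2), using exp u <= u + exp(u^2), yields
  E exp(theta (f - E f)) <= 5/4 as soon as theta n b <= 1/2. A Chernoff bound for the difference of
  two independent copies at theta = 1 / (4 e A p^2) gives the tail 4 exp(- theta t), which is below
  tail_F since ln (1 + x) >= 0.

  Isometries are only assumed to preserve the distance. In suitable linear coordinates near a point
  the geodesic distance is almost Euclidean and the volume almost Lebesgue, so the volume of a ball
  of radius r is asymptotic to the Euclidean one, uniformly in its centre by compactness. A finite
  Borel measure is determined by such uniform asymptotics, hence mu is invariant under isometries.
*)
theory Submission
  imports Defs "HOL-Probability.Hoeffding"
begin

section \<open>Conditional means as integrals over sets of coordinates\<close>

section \<open>Averages over coordinates\<close>

text \<open>A bounded-difference estimate applied directly to f sees only that one sample point
  changes f by a constant, and gives deviations of order sqrt n. Without its first-order term f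
  behaves like a quadratic form in the sample: the deviations are of order 1 and the tail is
  exponential rather than Gaussian, so the exponent \<theta> has to stay below a constant that does
  not depend on n. The obstacle is that the increments are small only typically: the worst case is
  of order n b, the typical size of order sqrt n * b, and a uniform bound would lose this factor
  again. The compensator is therefore random. At twice the exponent it is separated from the
  martingale by u v \<le> (u^2 + v^2) / 2, where u^2 has mean at most 1 and v^2 has mean at most
  3/2; this is the origin of 5/4. For v^2 Jensen's inequality leaves one increment at a time, at the
  price of a factor n in the exponent, which is affordable because n times the variance n b^2 is
  still bounded.\<close>

locale coordinate_average = prob_space M for M :: "'a measure" +
  assumes space_UNIV: "space M = UNIV"
begin

definition bdd_meas :: "(('i \<Rightarrow> 'a) \<Rightarrow> real) \<Rightarrow> bool" where
  "bdd_meas f \<longleftrightarrow> f \<in> borel_measurable (Pi\<^sub>M UNIV (\<lambda>_. M)) \<and> (\<exists>B. \<forall>x. \<bar>f x\<bar> \<le> B)"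

text \<open>The conditional mean given the coordinates outside \<open>J\<close>. As a pointwise
  integral it is defined at every \<open>x\<close>, so that freezing a coordinate is mere evaluation
  and no null sets have to be tracked.\<close>

definition avg :: "'i set \<Rightarrow> (('i \<Rightarrow> 'a) \<Rightarrow> real) \<Rightarrow> ('i \<Rightarrow> 'a) \<Rightarrow> real" where
  "avg J f x = (\<integral>z. f (override_on x z J) \<partial>Pi\<^sub>M J (\<lambda>_. M))"

lemma prob_PiM: "prob_space (Pi\<^sub>M J (\<lambda>_. M))"
  by (intro prob_space_PiM prob_space_axioms)

lemma product_sf: "product_sigma_finite (\<lambda>_. M)"
  by (simp add: product_sigma_finite_def sigma_finite_measure_axioms)

lemma space_PiM_UNIV: "space (Pi\<^sub>M UNIV (\<lambda>_. M)) = UNIV"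
  by (simp add: space_PiM space_UNIV)

lemma bdd_measI: "f \<in> borel_measurable (Pi\<^sub>M UNIV (\<lambda>_. M)) \<Longrightarrow> (\<And>x. \<bar>f x\<bar> \<le> B) \<Longrightarrow> bdd_meas f"
  by (auto simp: bdd_meas_def)

lemma bdd_meas_measurable: "bdd_meas f \<Longrightarrow> f \<in> borel_measurable (Pi\<^sub>M UNIV (\<lambda>_. M))"
  by (simp add: bdd_meas_def)

lemma bdd_meas_bound: assumes "bdd_meas f" obtains B where "B > 0" "\<And>x. \<bar>f x\<bar> \<le> B"
proof -
  obtain B where "\<And>x. \<bar>f x\<bar> \<le> B" using assms by (auto simp: bdd_meas_def)
  then have "\<bar>f x\<bar> \<le> \<bar>B\<bar> + 1" for x by (meson abs_ge_self add_increasing2 order_trans zero_le_one)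
  then show ?thesis using that[of "\<bar>B\<bar> + 1"] by simp
qed

lemma bdd_meas_const [simp]: "bdd_meas (\<lambda>_. c)"
  by (rule bdd_measI[of _ "\<bar>c\<bar>"]) auto

text \<open>The common source of the arithmetic rules that follow: the values of \<open>f\<close>
  and \<open>g\<close> stay in a compact rectangle, on which a continuous \<open>h\<close> is
  bounded.\<close>

lemma bdd_meas_cont2:
  assumes f: "bdd_meas f" and g: "bdd_meas g" and h: "continuous_on UNIV (\<lambda>(u, v). h u v :: real)"
  shows "bdd_meas (\<lambda>x. h (f x) (g x))"
proof -
  note [measurable] = f[THEN bdd_meas_measurable] g[THEN bdd_meas_measurable]
  obtain B C where B: "\<And>x. \<bar>f x\<bar> \<le> B" "\<And>x. \<bar>g x\<bar> \<le> C"
    using f g by (metis bdd_meas_bound)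
  have "compact ((\<lambda>(u, v). h u v) ` ({-B..B} \<times> {-C..C}))"
    by (intro compact_continuous_image continuous_on_subset[OF h] compact_Times compact_Icc) auto
  then have "bounded ((\<lambda>(u, v). h u v) ` ({-B..B} \<times> {-C..C}))" by (rule compact_imp_bounded)
  then obtain D where D: "\<forall>w \<in> (\<lambda>(u, v). h u v) ` ({-B..B} \<times> {-C..C}). norm w \<le> D"
    by (auto simp: bounded_iff)
  have "\<bar>h (f x) (g x)\<bar> \<le> D" for x
  proof -
    have "(f x, g x) \<in> {-B..B} \<times> {-C..C}" using B(1)[of x] B(2)[of x] by (simp add: abs_le_iff)
    then have "h (f x) (g x) \<in> (\<lambda>(u, v). h u v) ` ({-B..B} \<times> {-C..C})" by force
    then show ?thesis using D by (metis real_norm_def)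
  qed
  moreover have "(\<lambda>x. (\<lambda>(u, v). h u v) (f x, g x)) \<in> borel_measurable (Pi\<^sub>M UNIV (\<lambda>_. M))"
    by (rule borel_measurable_continuous_onI[OF h, THEN measurable_compose_rev]) measurable
  ultimately show ?thesis by (intro bdd_measI[of _ D]) auto
qed

lemma bdd_meas_add: "bdd_meas f \<Longrightarrow> bdd_meas g \<Longrightarrow> bdd_meas (\<lambda>x. f x + g x)"
  by (rule bdd_meas_cont2[of f g "\<lambda>u v. u + v"]) (auto intro!: continuous_intros simp: case_prod_beta)

lemma bdd_meas_diff: "bdd_meas f \<Longrightarrow> bdd_meas g \<Longrightarrow> bdd_meas (\<lambda>x. f x - g x)"
  by (rule bdd_meas_cont2[of f g "\<lambda>u v. u - v"]) (auto intro!: continuous_intros simp: case_prod_beta)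

lemma bdd_meas_mult: "bdd_meas f \<Longrightarrow> bdd_meas g \<Longrightarrow> bdd_meas (\<lambda>x. f x * g x)"
  by (rule bdd_meas_cont2[of f g "\<lambda>u v. u * v"]) (auto intro!: continuous_intros simp: case_prod_beta)

lemma bdd_meas_exp: "bdd_meas f \<Longrightarrow> bdd_meas (\<lambda>x. exp (f x))"
  by (rule bdd_meas_cont2[of f "\<lambda>_. 0" "\<lambda>u v. exp u"])
    (auto intro!: continuous_intros simp: case_prod_beta)

lemma bdd_meas_power: "bdd_meas f \<Longrightarrow> bdd_meas (\<lambda>x. f x ^ k)"
  by (rule bdd_meas_cont2[of f "\<lambda>_. 0" "\<lambda>u v. u ^ k"])
    (auto intro!: continuous_intros simp: case_prod_beta)

lemma bdd_meas_ln:
  assumes f: "bdd_meas f" and ge: "\<And>x. 1 \<le> f x" shows "bdd_meas (\<lambda>x. ln (f x))"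
proof -
  \<comment> \<open>Truncating the argument at 1 leaves the values unchanged and makes the logarithm
    continuous on the whole line.\<close>
  have "bdd_meas (\<lambda>x. ln (max 1 (f x)))"
    by (rule bdd_meas_cont2[of f "\<lambda>_. 0" "\<lambda>u v. ln (max 1 u)", OF f])
      (auto intro!: continuous_intros simp: case_prod_beta)
  moreover have "max 1 (f x) = f x" for x using ge[of x] by auto
  ultimately show ?thesis by simp
qed

lemma measurable_override_on [measurable]:
  "(\<lambda>(x, z). override_on x z J) \<in>
    measurable (Pi\<^sub>M UNIV (\<lambda>_. M) \<Otimes>\<^sub>M Pi\<^sub>M J (\<lambda>_. M)) (Pi\<^sub>M UNIV (\<lambda>_::'i. M))"
proof (rule measurable_PiM_single')
  fix i :: 'i
  show "(\<lambda>w. (case w of (x, z) \<Rightarrow> override_on x z J) i) \<in>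
      measurable (Pi\<^sub>M UNIV (\<lambda>_. M) \<Otimes>\<^sub>M Pi\<^sub>M J (\<lambda>_. M)) M"
    by (cases "i \<in> J") (simp_all add: case_prod_beta override_on_def)
qed (auto simp: space_UNIV)

lemma measurable_override [measurable]:
  "(\<lambda>z. override_on x z J) \<in> measurable (Pi\<^sub>M J (\<lambda>_. M)) (Pi\<^sub>M UNIV (\<lambda>_::'i. M))"
  using measurable_compose[OF measurable_Pair1' measurable_override_on, of x] space_PiM_UNIV
  by (auto simp: measurable_def space_PiM space_UNIV)

lemma bdd_meas_override:
  assumes "bdd_meas f" shows "(\<lambda>z. f (override_on x z J)) \<in> borel_measurable (Pi\<^sub>M J (\<lambda>_. M))"
  by (rule measurable_compose[OF measurable_override bdd_meas_measurable[OF assms]])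

lemma integrable_override:
  assumes "bdd_meas f" shows "integrable (Pi\<^sub>M J (\<lambda>_. M)) (\<lambda>z. f (override_on x z J))"
proof -
  interpret P: prob_space "Pi\<^sub>M J (\<lambda>_. M)" by (rule prob_PiM)
  obtain B where "\<And>x. \<bar>f x\<bar> \<le> B" using assms by (auto simp: bdd_meas_def)
  then show ?thesis by (intro P.integrable_const_bound[where B = B] bdd_meas_override assms) auto
qed

section \<open>Linearity and monotonicity of averages\<close>

lemma avg_const [simp]: "avg J (\<lambda>_. c) x = c"
  using prob_space.prob_space[OF prob_PiM[of J]] by (simp add: avg_def)

lemma avg_add: "bdd_meas f \<Longrightarrow> bdd_meas g \<Longrightarrow> avg J (\<lambda>y. f y + g y) x = avg J f x + avg J g x"
  unfolding avg_def by (intro Bochner_Integration.integral_add integrable_override)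

lemma avg_diff: "bdd_meas f \<Longrightarrow> bdd_meas g \<Longrightarrow> avg J (\<lambda>y. f y - g y) x = avg J f x - avg J g x"
  unfolding avg_def by (intro Bochner_Integration.integral_diff integrable_override)

lemma avg_cmult: "avg J (\<lambda>y. c * f y) x = c * avg J f x"
  unfolding avg_def by simp

lemma avg_mono:
  "bdd_meas f \<Longrightarrow> bdd_meas g \<Longrightarrow> (\<And>z. f (override_on x z J) \<le> g (override_on x z J)) \<Longrightarrow> avg J f x \<le> avg J g x"
  unfolding avg_def by (intro integral_mono integrable_override)

lemma avg_le_const:
  "bdd_meas f \<Longrightarrow> (\<And>z. f (override_on x z J) \<le> c) \<Longrightarrow> avg J f x \<le> c"
  using avg_mono[OF _ bdd_meas_const, of f x J c] by simp

lemma avg_ge_const: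
  "bdd_meas f \<Longrightarrow> (\<And>z. c \<le> f (override_on x z J)) \<Longrightarrow> c \<le> avg J f x"
  using avg_mono[OF bdd_meas_const, of f c x J] by simp

lemma bdd_meas_avg:
  assumes f: "bdd_meas f" shows "bdd_meas (avg J f)"
proof -
  interpret P: prob_space "Pi\<^sub>M J (\<lambda>_. M)" by (rule prob_PiM)
  obtain B where B: "\<And>x. \<bar>f x\<bar> \<le> B" using assms by (auto simp: bdd_meas_def)
  have "(\<lambda>w. f (case w of (x, z) \<Rightarrow> override_on x z J)) \<in>
      borel_measurable (Pi\<^sub>M UNIV (\<lambda>_. M) \<Otimes>\<^sub>M Pi\<^sub>M J (\<lambda>_. M))"
    by (rule measurable_compose[OF measurable_override_on bdd_meas_measurable[OF f]])
  then have "(\<lambda>(x, z). f (override_on x z J)) \<in>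
      borel_measurable (Pi\<^sub>M UNIV (\<lambda>_. M) \<Otimes>\<^sub>M Pi\<^sub>M J (\<lambda>_. M))"
    by (simp add: case_prod_beta)
  then have "avg J f \<in> borel_measurable (Pi\<^sub>M UNIV (\<lambda>_. M))"
    unfolding avg_def by (rule P.borel_measurable_lebesgue_integral)
  moreover have "\<bar>avg J f x\<bar> \<le> B" for x
    using avg_le_const[of f x J B] avg_ge_const[of f "-B" x J] f B
    by (smt (verit, best))
  ultimately show ?thesis by (rule bdd_measI)
qed

lemmas bdd_meas_intros = bdd_meas_const bdd_meas_add bdd_meas_diff bdd_meas_mult bdd_meas_exp
  bdd_meas_power bdd_meas_avg

text \<open>Plays the part of measurability with respect to the coordinates outside
  \<open>J\<close>: such a factor can be taken out of \<open>avg J\<close>.\<close>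

definition constant_in :: "'i set \<Rightarrow> (('i \<Rightarrow> 'a) \<Rightarrow> real) \<Rightarrow> bool" where
  "constant_in J f \<longleftrightarrow> (\<forall>x z. f (override_on x z J) = f x)"

lemma avg_mult_constant_in:
  "constant_in J g \<Longrightarrow> avg J (\<lambda>y. g y * f y) x = g x * avg J f x"
  by (simp add: avg_def constant_in_def)

lemma avg_constant_in: "constant_in J f \<Longrightarrow> avg J f x = f x"
  using avg_mult_constant_in[of J f "\<lambda>_. 1" x] by simp

lemma constant_in_avg: "K \<subseteq> J \<Longrightarrow> constant_in K (avg J f)"
proof -
  assume "K \<subseteq> J"
  then have "override_on (override_on x w K) z J = override_on x z J" for x w z :: "_ \<Rightarrow> 'a"
    by (auto simp: override_on_def fun_eq_iff)
  then show ?thesis by (simp add: constant_in_def avg_def)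
qed

lemma constant_in_avg': "constant_in K f \<Longrightarrow> constant_in K (avg J f)"
proof -
  assume f: "constant_in K f"
  have "f (override_on (override_on x w K) z J) = f (override_on x z J)" for x w z
  proof -
    have "override_on (override_on x w K) z J = override_on (override_on x z J) w (K - J)"
      by (auto simp: override_on_def fun_eq_iff)
    \<comment> \<open>Overwriting on \<open>K - J\<close> alone is the same as overwriting all of
      \<open>K\<close> by the resulting point, and to this the invariance in \<open>K\<close>
      applies.\<close>
    also have "\<dots> = override_on (override_on x z J) (override_on (override_on x z J) w (K - J)) K"
      by (auto simp: override_on_def fun_eq_iff)
    finally show ?thesis using f by (metis constant_in_def)
  qed
  then show ?thesis by (simp add: constant_in_def avg_def)
qed

text \<open>Fubini's theorem for a split of the index set.\<close>

lemma avg_Un: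
  assumes "J \<inter> K = {}" "finite J" "finite K" and f: "bdd_meas f"
  shows "avg (J \<union> K) f x = avg J (avg K f) x"
proof -
  interpret product_sigma_finite "\<lambda>_. M" by (rule product_sf)
  have "override_on x (merge J K (y, z)) (J \<union> K) = override_on (override_on x y J) z K" for y z
    using assms(1) by (auto simp: override_on_def fun_eq_iff merge_def)
  then show ?thesis unfolding avg_def
    by (subst product_integral_fold[OF assms(1-3) integrable_override[OF f]]) simp
qed

lemma avg_empty [simp]: "avg {} f x = f x"
  by (rule avg_constant_in) (simp add: constant_in_def)

text \<open>The tower property: after splitting \<open>J\<close> into \<open>J - K\<close> and
  \<open>K\<close>, the second average over \<open>K\<close> finds a function that is already
  constant there.\<close>

lemma avg_avg_subset:
  assumes "K \<subseteq> J" "finite J" and f: "bdd_meas f"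
  shows "avg J (avg K f) x = avg J f x"
proof -
  have fin: "finite K" using assms finite_subset by blast
  have J: "J = (J - K) \<union> K" using assms(1) by auto
  have "avg J (avg K f) x = avg (J - K) (avg K (avg K f)) x"
    by (subst J, rule avg_Un) (use assms fin in \<open>auto intro!: bdd_meas_avg\<close>)
  also have "avg K (avg K f) = avg K f" by (intro ext avg_constant_in constant_in_avg) auto
  also have "avg (J - K) (avg K f) x = avg J f x"
    by (subst (2) J, rule avg_Un[symmetric]) (use assms fin in \<open>auto intro!: bdd_meas_avg\<close>)
  finally show ?thesis .
qed

end

section \<open>Scalar inequalities and squares of sub-Gaussian variables\<close>

section \<open>Exponential moments of degenerate functions\<close>

text \<open>Integrated against a centred variable the linear term drops out, and only the mean of
  the exponential of the square is left.\<close>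

lemma exp_le_add_exp_square: "exp x \<le> x + exp (x\<^sup>2)" for x :: real
proof -
  have sq: "1 + x\<^sup>2 \<le> exp (x\<^sup>2)" by (rule exp_ge_add_one_self)
  consider "x < -1" | "-1 \<le> x" "x < 0" | "0 \<le> x" "x \<le> 1" | "x > 1" by linarith
  then show ?thesis
  proof cases
    case 1
    then have "(-x) * 1 \<le> (-x) * (-x)" by (intro mult_left_mono) auto
    then have "-x \<le> x\<^sup>2" by (simp add: power2_eq_square)
    moreover have "exp x \<le> 1" using 1 by simp
    ultimately show ?thesis using sq by linarith
  next
    case 2
    \<comment> \<open>Factoring \<open>1 - x ^ 3\<close> and using
      \<open>1 - x \<le> exp (-x)\<close> gives the quadratic bound for \<open>exp\<close> on the
      negative side.\<close>
    have "1 \<le> 1 - x ^ 3" using 2 by (simp add: power3_eq_cube mult_nonneg_nonpos mult_nonpos_nonpos)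
    also have "\<dots> = (1 + x + x\<^sup>2) * (1 - x)"
      by (simp add: algebra_simps power2_eq_square power3_eq_cube)
    also have "\<dots> \<le> (1 + x + x\<^sup>2) * exp (-x)"
      using 2 exp_ge_add_one_self[of "-x"] by (intro mult_left_mono) auto
    finally have "exp x \<le> 1 + x + x\<^sup>2" by (simp add: exp_minus field_simps)
    then show ?thesis using sq by linarith
  next
    case 3
    then show ?thesis using exp_bound[of x] sq by linarith
  next
    case 4
    then have "x * 1 \<le> x * x" by (intro mult_left_mono) auto
    then have "exp x \<le> exp (x\<^sup>2)" by (simp add: power2_eq_square)
    then show ?thesis using 4 by linarith
  qed
qed

text \<open>Jensen's inequality, obtained from the tangent of \<open>exp\<close> at the sum
  \<open>S\<close>. It trades the exponential of a sum of dependent terms for an average of separate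
  exponentials with \<open>n\<close> times the exponent.\<close>

lemma exp_sum_le_mean:
  fixes c :: "nat \<Rightarrow> real" assumes "n > 0"
  shows "exp (\<Sum>k<n. c k) \<le> (\<Sum>k<n. exp (real n * c k)) / n"
proof -
  define S where "S = (\<Sum>k<n. c k)"
  have "real n * exp S = (\<Sum>k<n. exp S * (1 + (real n * c k - S)))"
    unfolding sum_distrib_left[symmetric]
    by (simp add: sum.distrib sum_subtractf sum_distrib_left[symmetric] S_def[symmetric])
  also have "\<dots> \<le> (\<Sum>k<n. exp S * exp (real n * c k - S))"
    by (intro sum_mono mult_left_mono exp_ge_add_one_self) auto
  also have "\<dots> = (\<Sum>k<n. exp (real n * c k))" by (simp add: exp_add[symmetric])
  finally show ?thesis using assms by (simp add: S_def field_simps)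
qed

lemma nn_integral_normal_density:
  assumes "\<sigma> > 0" shows "(\<integral>\<^sup>+x. ennreal (normal_density m \<sigma> x) \<partial>lborel) = 1"
proof -
  interpret N: prob_space "density lborel (\<lambda>x. ennreal (normal_density m \<sigma> x))"
    by (rule prob_space_normal_density[OF assms])
  show ?thesis using N.emeasure_space_1 by (simp add: emeasure_density)
qed

text \<open>The square in the exponent is linearised by averaging over an independent standard Gaussian.\<close>

lemma nn_integral_exp_square_le:
  assumes "prob_space N" and [measurable]: "V \<in> borel_measurable N"
    and V: "\<And>t. (\<integral>\<^sup>+z. ennreal (exp (t * V z)) \<partial>N) \<le> ennreal (exp (t\<^sup>2 * v / 2))"
    and s: "0 \<le> s" "2 * s * v < 1"
  shows "(\<integral>\<^sup>+z. ennreal (exp (s * (V z)\<^sup>2)) \<partial>N) \<le> ennreal (1 / sqrt (1 - 2 * s * v))"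
proof -
  interpret N: prob_space N by fact
  interpret pair_sigma_finite N lborel by standard
  define a where "a = sqrt (2 * s)"
  have a2: "a\<^sup>2 = 2 * s" using s by (simp add: a_def)
  \<comment> \<open>Tilting the standard Gaussian by \<open>exp (s * v * g\<^sup>2)\<close> gives a
    multiple of the Gaussian with standard deviation \<open>\<tau>\<close>; the multiple is
    \<open>\<tau>\<close> itself and becomes the final bound.\<close>
  define \<tau> where "\<tau> = 1 / sqrt (1 - 2 * s * v)"
  have \<tau>: "\<tau> > 0" "\<tau>\<^sup>2 = 1 / (1 - 2 * s * v)" using s by (simp_all add: \<tau>_def power_divide)
  have gauss: "exp (a * u * g) * std_normal_density g = exp (s * u\<^sup>2) * normal_density (a * u) 1 g" for u g
  proof -
    have "a * u * g - g\<^sup>2 / 2 = s * u\<^sup>2 - (g - a * u)\<^sup>2 / 2"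
      using a2 by (simp add: power2_diff power_mult_distrib field_simps)
    then show ?thesis by (simp add: normal_density_def exp_add[symmetric] mult.left_commute)
  qed
  have gauss': "exp (s * v * g\<^sup>2) * std_normal_density g = \<tau> * normal_density 0 \<tau> g" for g
  proof -
    have "s * v * g\<^sup>2 - g\<^sup>2 / 2 = - (g\<^sup>2 / (2 * \<tau>\<^sup>2))"
      using s by (simp add: \<tau>(2) field_simps)
    then show ?thesis using \<tau>(1)
      by (simp add: normal_density_def exp_add[symmetric] real_sqrt_mult mult.left_commute)
  qed
  have "(\<integral>\<^sup>+z. ennreal (exp (s * (V z)\<^sup>2)) \<partial>N)
      = (\<integral>\<^sup>+z. ennreal (exp (s * (V z)\<^sup>2)) * (\<integral>\<^sup>+g. ennreal (normal_density (a * V z) 1 g) \<partial>lborel) \<partial>N)"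
    by (simp add: nn_integral_normal_density)
  also have "\<dots> = (\<integral>\<^sup>+z. (\<integral>\<^sup>+g. ennreal (exp (a * V z * g) * std_normal_density g) \<partial>lborel) \<partial>N)"
    by (subst nn_integral_cmult[symmetric]) (auto simp: gauss ennreal_mult)
  also have "\<dots> = (\<integral>\<^sup>+g. (\<integral>\<^sup>+z. ennreal (exp (a * V z * g) * std_normal_density g) \<partial>N) \<partial>lborel)"
    by (rule Fubini'[symmetric]) measurable
  also have "\<dots> = (\<integral>\<^sup>+g. ennreal (std_normal_density g) * (\<integral>\<^sup>+z. ennreal (exp ((a * g) * V z)) \<partial>N) \<partial>lborel)"
    by (intro nn_integral_cong, subst nn_integral_cmult[symmetric])
      (auto simp: ennreal_mult[symmetric] mult_ac)
  also have "\<dots> \<le> (\<integral>\<^sup>+g. ennreal (std_normal_density g) * ennreal (exp ((a * g)\<^sup>2 * v / 2)) \<partial>lborel)"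
    by (intro nn_integral_mono mult_left_mono V) auto
  also have "\<dots> = (\<integral>\<^sup>+g. ennreal \<tau> * ennreal (normal_density 0 \<tau> g) \<partial>lborel)"
    using \<tau>(1) gauss' by (intro nn_integral_cong)
      (simp add: ennreal_mult[symmetric] power_mult_distrib a2 mult_ac)
  also have "\<dots> = ennreal \<tau>"
    using \<tau>(1) by (simp add: nn_integral_cmult nn_integral_normal_density)
  finally show ?thesis by (simp add: \<tau>_def)
qed

section \<open>Sub-Gaussian bounds from bounded differences\<close>

context coordinate_average
begin

text \<open>Jensen's inequality for powers; Bernoulli's inequality supplies the tangent at the
  mean.\<close>

lemma avg_power_le:
  assumes f: "bdd_meas f" "\<And>x. 1 \<le> f x"
  shows "avg J f x ^ n \<le> avg J (\<lambda>y. f y ^ n) x"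
proof -
  define m where "m = avg J f x"
  have m: "m \<ge> 1" unfolding m_def using f by (intro avg_ge_const)
  have tangent: "m ^ n + (real n * m ^ n / m) * (v - m) \<le> v ^ n" if "v \<ge> 1" for v
  proof -
    have "1 + real n * (v / m - 1) \<le> (1 + (v / m - 1)) ^ n"
      using that m by (intro Bernoulli_inequality) (auto simp: field_simps)
    then have "m ^ n * (1 + real n * (v / m - 1)) \<le> m ^ n * (v / m) ^ n"
      using m by (intro mult_left_mono) auto
    moreover have "m ^ n * (v / m) ^ n = v ^ n" using m by (simp add: power_divide)
    moreover have "m ^ n * (1 + real n * (v / m - 1)) = m ^ n + (real n * m ^ n / m) * (v - m)"
      using m by (simp add: field_simps)
    ultimately show ?thesis by simp
  qed
  have b: "bdd_meas (\<lambda>y. real n * m ^ n / m * (f y - m))"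
    by (intro bdd_meas_intros f)
  have "avg J (\<lambda>y. m ^ n + (real n * m ^ n / m) * (f y - m)) x = m ^ n"
    unfolding avg_add[OF bdd_meas_const b] avg_cmult avg_diff[OF f(1) bdd_meas_const]
    by (simp add: m_def)
  moreover have "avg J (\<lambda>y. m ^ n + (real n * m ^ n / m) * (f y - m)) x \<le> avg J (\<lambda>y. f y ^ n) x"
    by (intro avg_mono tangent bdd_meas_add bdd_meas_const b bdd_meas_power f)
  ultimately show ?thesis by (simp add: m_def)
qed

definition diff_le :: "real \<Rightarrow> 'i \<Rightarrow> (('i \<Rightarrow> 'a) \<Rightarrow> real) \<Rightarrow> bool" where
  "diff_le c k f \<longleftrightarrow> (\<forall>x z. \<bar>f (override_on x z {k}) - f x\<bar> \<le> c)"

lemma diff_le_avg: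
  assumes f: "bdd_meas f" and d: "diff_le c k f"
  shows "diff_le c k (avg J f)"
  unfolding diff_le_def
proof (intro allI)
  fix x z
  have c: "0 \<le> c" using d by (auto simp: diff_le_def intro: order_trans[OF abs_ge_zero])
  show "\<bar>avg J f (override_on x z {k}) - avg J f x\<bar> \<le> c"
  proof (cases "k \<in> J")
    case True
    then show ?thesis using constant_in_avg[of "{k}" J f] c by (simp add: constant_in_def)
  next
    case False
    interpret P: prob_space "Pi\<^sub>M J (\<lambda>_. M)" by (rule prob_PiM)
    have eq: "override_on (override_on x z {k}) y J = override_on (override_on x y J) z {k}" for y
      using False by (auto simp: override_on_def fun_eq_iff)
    have D: "\<bar>f (override_on (override_on x z {k}) y J) - f (override_on x y J)\<bar> \<le> c" for y
      using d by (simp add: eq diff_le_def)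
    have I: "integrable (Pi\<^sub>M J (\<lambda>_. M)) (\<lambda>y. f (override_on (override_on x z {k}) y J) - f (override_on x y J))"
      by (intro Bochner_Integration.integrable_diff integrable_override f)
    have "avg J f (override_on x z {k}) - avg J f x
       = (\<integral>y. f (override_on (override_on x z {k}) y J) - f (override_on x y J) \<partial>Pi\<^sub>M J (\<lambda>_. M))"
      unfolding avg_def
      by (subst Bochner_Integration.integral_diff) (auto intro!: integrable_override f)
    moreover have "\<bar>\<dots>\<bar> \<le> c"
    proof (rule abs_leI)
      show "(\<integral>y. f (override_on (override_on x z {k}) y J) - f (override_on x y J) \<partial>Pi\<^sub>M J (\<lambda>_. M)) \<le> c"
        using D by (intro P.integral_le_const I AE_I2) (simp add: abs_le_iff)
      have "-c \<le> (\<integral>y. f (override_on (override_on x z {k}) y J) - f (override_on x y J) \<partial>Pi\<^sub>M J (\<lambda>_. M))"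
      proof (intro P.integral_ge_const I AE_I2)
        show "-c \<le> f (override_on (override_on x z {k}) y J) - f (override_on x y J)" for y
          using D[of y] by linarith
      qed
      then show "- (\<integral>y. f (override_on (override_on x z {k}) y J) - f (override_on x y J) \<partial>Pi\<^sub>M J (\<lambda>_. M)) \<le> c"
        by linarith
    qed
    ultimately show ?thesis by simp
  qed
qed

lemma avg_exp_deviation_single:
  assumes f: "bdd_meas f" and d: "diff_le c k f"
  shows "avg {k} (\<lambda>y. exp (t * (f y - avg {k} f y))) x \<le> exp (t\<^sup>2 * c\<^sup>2 / 8)"
proof -
  have pos: "avg {k} (\<lambda>y. exp (t * (f y - avg {k} f y))) x \<le> exp (t\<^sup>2 * c\<^sup>2 / 8)"
    if t: "t > 0" and f: "bdd_meas f" and d: "diff_le c k f" for t f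
  proof -
    interpret P: prob_space "Pi\<^sub>M {k} (\<lambda>_. M)" by (rule prob_PiM)
    define h where "h z = f (override_on x z {k})" for z
    have h: "h z \<le> h z' + c" for z z'
    proof -
      have "override_on (override_on x z' {k}) z {k} = override_on x z {k}"
        by (auto simp: override_on_def)
      then show ?thesis
        using d unfolding diff_le_def h_def by (metis abs_le_iff diff_le_eq add.commute)
    qed
    obtain B where B: "\<And>y. \<bar>f y\<bar> \<le> B" using f by (auto simp: bdd_meas_def)
    have bb: "bdd_below (range h)"
    proof (rule bdd_belowI)
      fix u assume "u \<in> range h"
      then obtain z where "u = h z" by auto
      then show "-B \<le> u" using B[of "override_on x z {k}"] by (simp add: h_def)
    qed
    \<comment> \<open>The section in coordinate \<open>k\<close> oscillates by at most
      \<open>c\<close>, so its infimum is the left end of an interval of length \<open>c\<close>, as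
      Hoeffding's lemma requires.\<close>
    define a where "a = Inf (range h)"
    have "a \<le> h z" for z unfolding a_def by (intro cInf_lower bb) auto
    moreover have "h z \<le> a + c" for z
    proof -
      have "h z - c \<le> a" unfolding a_def using h[of z] by (intro cInf_greatest) (auto simp: diff_le_eq)
      then show ?thesis by simp
    qed
    ultimately have ae: "AE z in Pi\<^sub>M {k} (\<lambda>_. M). h z \<in> {a..a + c}" by (intro AE_I2) simp
    have hm: "h \<in> borel_measurable (Pi\<^sub>M {k} (\<lambda>_. M))"
      using bdd_meas_override[OF f] unfolding h_def .
    have "interval_bounded_random_variable (Pi\<^sub>M {k} (\<lambda>_. M)) h a (a + c)"
      by unfold_locales (rule hm ae)+
    from interval_bounded_random_variable.Hoeffdings_lemma_nn_integral[OF this t]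
    have *: "(\<integral>\<^sup>+z. ennreal (exp (t * (h z - P.expectation h))) \<partial>Pi\<^sub>M {k} (\<lambda>_. M)) \<le> ennreal (exp (t\<^sup>2 * c\<^sup>2 / 8))"
      by simp
    have e: "P.expectation h = avg {k} f (override_on x z {k})" for z
    proof -
      have "avg {k} f (override_on x z {k}) = avg {k} f x"
        using constant_in_avg[of "{k}" "{k}" f] unfolding constant_in_def by blast
      then show ?thesis by (simp add: avg_def h_def[abs_def])
    qed
    have b: "bdd_meas (\<lambda>y. exp (t * (f y - avg {k} f y)))" by (intro bdd_meas_intros f)
    have "ennreal (avg {k} (\<lambda>y. exp (t * (f y - avg {k} f y))) x) =
       (\<integral>\<^sup>+z. ennreal (exp (t * (h z - P.expectation h))) \<partial>Pi\<^sub>M {k} (\<lambda>_. M))"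
      unfolding avg_def[of "{k}" _ x]
      by (subst nn_integral_eq_integral[symmetric, OF integrable_override[OF b]])
        (simp_all add: h_def[symmetric] e[symmetric])
    with * have "ennreal (avg {k} (\<lambda>y. exp (t * (f y - avg {k} f y))) x) \<le> ennreal (exp (t\<^sup>2 * c\<^sup>2 / 8))"
      by simp
    then show ?thesis by (subst (asm) ennreal_le_iff) auto
  qed
  consider "t > 0" | "t = 0" | "t < 0" by linarith
  then show ?thesis
  proof cases
    case 1 then show ?thesis by (rule pos[OF _ f d])
  next
    case 2 then show ?thesis by simp
  next
    case 3
    \<comment> \<open>Hoeffding's lemma is applied with a positive parameter; for negative
      \<open>t\<close> the sign moves into the function.\<close>
    have "bdd_meas (\<lambda>y. 0 - f y)" by (intro bdd_meas_intros f)
    then have m: "bdd_meas (\<lambda>y. - f y)" by simp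
    have "avg {k} (\<lambda>y. - f y) = (\<lambda>y. - avg {k} f y)" using avg_cmult[of "{k}" "-1" f] by auto
    moreover have "diff_le c k (\<lambda>y. - f y)" using d by (simp add: diff_le_def abs_minus_commute)
    ultimately show ?thesis using pos[of "-t" "\<lambda>y. - f y"] 3 m by (simp add: algebra_simps)
  qed
qed

text \<open>The moment form of McDiarmid's inequality. A further coordinate \<open>k\<close>
  contributes the deviation of \<open>avg J f\<close> in that coordinate, whose oscillation is still
  at most \<open>c\<close> because averaging does not enlarge oscillations.\<close>

lemma avg_exp_deviation:
  assumes "finite J" and f: "bdd_meas f" and d: "\<And>k. k \<in> J \<Longrightarrow> diff_le c k f"
  shows "avg J (\<lambda>y. exp (t * (f y - avg J f y))) x \<le> exp (t\<^sup>2 * (real (card J) * c\<^sup>2) / 8)"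
  using assms(1) d
proof (induction J arbitrary: x rule: finite_induct)
  case empty then show ?case by simp
next
  case (insert k J)
  have bJ: "bdd_meas (avg J f)" and bE: "bdd_meas (\<lambda>y. exp (t * (f y - avg J f y)))"
    and bD: "bdd_meas (\<lambda>y. exp (t * (avg J f y - avg {k} (avg J f) y)))"
    by (intro bdd_meas_intros f)+
  have U: "avg (insert k J) h x = avg {k} (avg J h) x" if "bdd_meas h" for h x
    using avg_Un[of "{k}" J h x] insert.hyps that by simp
  define D where "D y = exp (t * (avg J f y - avg {k} (avg J f) y))" for y
  have "constant_in J (avg J f)" "constant_in J (avg {k} (avg J f))"
    by (auto intro: constant_in_avg constant_in_avg')
  then have cD: "constant_in J D" by (simp add: constant_in_def D_def)
  \<comment> \<open>The deviation telescopes, and the new factor \<open>D\<close>, being constant in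
    \<open>J\<close>, leaves the inner average.\<close>
  have "(\<lambda>y. exp (t * (f y - avg (insert k J) f y))) = (\<lambda>y. D y * exp (t * (f y - avg J f y)))"
    by (simp add: U[OF f] D_def exp_add[symmetric] algebra_simps)
  moreover have bDE: "bdd_meas (\<lambda>y. D y * exp (t * (f y - avg J f y)))"
    unfolding D_def by (intro bdd_meas_mult bE bD)
  ultimately have "avg (insert k J) (\<lambda>y. exp (t * (f y - avg (insert k J) f y))) x
      = avg {k} (\<lambda>y. D y * avg J (\<lambda>y. exp (t * (f y - avg J f y))) y) x"
    using U[OF bDE] avg_mult_constant_in[OF cD, abs_def] by (simp add: fun_eq_iff[of "avg J _"] avg_def[of "{k}"])
  also have "\<dots> \<le> avg {k} (\<lambda>y. exp (t\<^sup>2 * (real (card J) * c\<^sup>2) / 8) * D y) x"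
  proof (rule avg_mono)
    show "bdd_meas (\<lambda>y. D y * avg J (\<lambda>y. exp (t * (f y - avg J f y))) y)"
      unfolding D_def by (intro bdd_meas_intros f)
    show "bdd_meas (\<lambda>y. exp (t\<^sup>2 * (real (card J) * c\<^sup>2) / 8) * D y)"
      unfolding D_def by (intro bdd_meas_intros f)
    show "D y * avg J (\<lambda>y. exp (t * (f y - avg J f y))) y \<le> exp (t\<^sup>2 * (real (card J) * c\<^sup>2) / 8) * D y" for y
      using insert.IH[of y] insert.prems by (simp add: D_def mult.commute)
  qed
  also have "\<dots> = exp (t\<^sup>2 * (real (card J) * c\<^sup>2) / 8) * avg {k} D x" by (rule avg_cmult)
  also have "\<dots> \<le> exp (t\<^sup>2 * (real (card J) * c\<^sup>2) / 8) * exp (t\<^sup>2 * c\<^sup>2 / 8)"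
    unfolding D_def using insert.prems
    by (intro mult_left_mono avg_exp_deviation_single bJ diff_le_avg f) auto
  also have "\<dots> = exp (t\<^sup>2 * (real (card (insert k J)) * c\<^sup>2) / 8)"
    using insert.hyps by (simp add: exp_add[symmetric] field_simps)
  finally show ?case .
qed

text \<open>Bounded differences give the variance proxy \<open>v = n * c\<^sup>2 / 4\<close>. The
  condition on \<open>s\<close> makes \<open>2 * s * v\<close> at most 1/2, so the bound for the
  square is at most sqrt 2, which is below 3/2.\<close>

lemma avg_exp_square_le:
  assumes J: "finite J" and f: "bdd_meas f" and d: "\<And>k. k \<in> J \<Longrightarrow> diff_le c k f"
    and 0: "\<And>y. avg J f y = 0"
    and n: "real (card J) \<le> n" and s: "0 \<le> s" "s * n * c\<^sup>2 \<le> 1"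
  shows "avg J (\<lambda>y. exp (s * (f y)\<^sup>2)) x \<le> 3 / 2"
proof -
  interpret P: prob_space "Pi\<^sub>M J (\<lambda>_. M)" by (rule prob_PiM)
  define v where "v = n * c\<^sup>2 / 4"
  have b: "bdd_meas (\<lambda>y. exp (s * (f y)\<^sup>2))"
    by (intro bdd_meas_intros f)
  have "(\<integral>\<^sup>+z. ennreal (exp (t * f (override_on x z J))) \<partial>Pi\<^sub>M J (\<lambda>_. M)) \<le> ennreal (exp (t\<^sup>2 * v / 2))" for t
  proof -
    have bt: "bdd_meas (\<lambda>y. exp (t * f y))" by (intro bdd_meas_intros f)
    have "(\<integral>\<^sup>+z. ennreal (exp (t * f (override_on x z J))) \<partial>Pi\<^sub>M J (\<lambda>_. M)) = ennreal (avg J (\<lambda>y. exp (t * f y)) x)"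
      unfolding avg_def by (rule nn_integral_eq_integral[OF integrable_override[OF bt]]) auto
    also have "avg J (\<lambda>y. exp (t * f y)) x \<le> exp (t\<^sup>2 * (real (card J) * c\<^sup>2) / 8)"
      using avg_exp_deviation[OF J f d, of t x] by (simp add: 0)
    also have "\<dots> \<le> exp (t\<^sup>2 * v / 2)"
      using n by (auto simp: v_def intro!: mult_left_mono mult_right_mono)
    finally show ?thesis by (simp add: ennreal_leI)
  qed
  moreover have sv: "2 * s * v \<le> 1 / 2" using s by (simp add: v_def mult_ac)
  ultimately have "(\<integral>\<^sup>+z. ennreal (exp (s * (f (override_on x z J))\<^sup>2)) \<partial>Pi\<^sub>M J (\<lambda>_. M))
      \<le> ennreal (1 / sqrt (1 - 2 * s * v))"
    using s bdd_meas_override[OF f, of x J] by (intro nn_integral_exp_square_le prob_PiM) auto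
  moreover have "(\<integral>\<^sup>+z. ennreal (exp (s * (f (override_on x z J))\<^sup>2)) \<partial>Pi\<^sub>M J (\<lambda>_. M))
      = ennreal (avg J (\<lambda>y. exp (s * (f y)\<^sup>2)) x)"
    unfolding avg_def by (rule nn_integral_eq_integral[OF integrable_override[OF b]]) auto
  ultimately have "avg J (\<lambda>y. exp (s * (f y)\<^sup>2)) x \<le> 1 / sqrt (1 - 2 * s * v)"
    using sv by (simp add: ennreal_le_iff)
  also have "2 / 3 \<le> sqrt (1 - 2 * s * v)"
    using sv by (intro real_le_rsqrt) (simp add: power2_eq_square)
  then have "1 / sqrt (1 - 2 * s * v) \<le> 3 / 2"
    using frac_le[of 1 1 "2 / 3" "sqrt (1 - 2 * s * v)"] by simp
  finally show ?thesis .
qed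

section \<open>Martingale increments and their exponential compensation\<close>

definition increment :: "(('i \<Rightarrow> 'a) \<Rightarrow> real) \<Rightarrow> 'i \<Rightarrow> 'i set \<Rightarrow> ('i \<Rightarrow> 'a) \<Rightarrow> real" where
  "increment f j R x = avg R f x - avg (insert j R) f x"

definition exp_sq_increment :: "(('i \<Rightarrow> 'a) \<Rightarrow> real) \<Rightarrow> 'i \<Rightarrow> 'i set \<Rightarrow> ('i \<Rightarrow> 'a) \<Rightarrow> real" where
  "exp_sq_increment f j R = avg {j} (\<lambda>x. exp ((increment f j R x)\<^sup>2))"

text \<open>The coordinates are revealed in the order of the list \<open>js\<close>, so that the coordinates after
  position \<open>k\<close> are averaged out in the \<open>k\<close>-th martingale increment.\<close>

definition compensator :: "(('i \<Rightarrow> 'a) \<Rightarrow> real) \<Rightarrow> 'i list \<Rightarrow> ('i \<Rightarrow> 'a) \<Rightarrow> real" where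
  "compensator f js x =
     (\<Sum>k<length js. ln (exp_sq_increment f (js ! k) (set (drop (Suc k) js)) x))"

lemma bdd_meas_increment: "bdd_meas f \<Longrightarrow> bdd_meas (increment f j R)"
  unfolding increment_def[abs_def] by (intro bdd_meas_intros)

lemma bdd_meas_exp_sq_increment: "bdd_meas f \<Longrightarrow> bdd_meas (exp_sq_increment f j R)"
  unfolding exp_sq_increment_def by (intro bdd_meas_intros bdd_meas_increment)

lemma exp_sq_increment_ge_1: "bdd_meas f \<Longrightarrow> 1 \<le> exp_sq_increment f j R x"
  unfolding exp_sq_increment_def by (intro avg_ge_const bdd_meas_intros bdd_meas_increment) simp_all

lemma compensator_Cons:
  "compensator f (j # js) x = ln (exp_sq_increment f j (set js) x) + compensator f js x"
  unfolding compensator_def list.size by (simp add: sum.lessThan_Suc_shift del: sum.lessThan_Suc)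

lemma bdd_meas_sum: "(\<And>k. k \<in> K \<Longrightarrow> bdd_meas (f k)) \<Longrightarrow> bdd_meas (\<lambda>x. \<Sum>k\<in>K. f k x)"
  by (induction K rule: infinite_finite_induct) (auto intro!: bdd_meas_add)

lemma avg_sum:
  "(\<And>k. k \<in> K \<Longrightarrow> bdd_meas (f k)) \<Longrightarrow> avg J (\<lambda>x. \<Sum>k\<in>K. f k x) x = (\<Sum>k\<in>K. avg J (f k) x)"
proof (induction K rule: infinite_finite_induct)
  case (insert k K)
  then show ?case by (simp add: avg_add bdd_meas_sum)
qed auto

lemma bdd_meas_compensator: "bdd_meas f \<Longrightarrow> bdd_meas (compensator f js)"
  unfolding compensator_def[abs_def]
  by (intro bdd_meas_sum bdd_meas_ln bdd_meas_exp_sq_increment exp_sq_increment_ge_1)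

lemma avg_increment: 
  assumes f: "bdd_meas f" and "finite R" "j \<notin> R"
  shows "avg {j} (increment f j R) x = 0"
proof -
  have "avg (insert j R) f = avg {j} (avg R f)"
    using avg_Un[of "{j}" R f] assms by (simp add: fun_eq_iff)
  moreover have "avg {j} (avg {j} (avg R f)) x = avg {j} (avg R f) x"
    by (intro avg_constant_in constant_in_avg) auto
  ultimately show ?thesis
    unfolding increment_def[abs_def] by (simp add: avg_diff bdd_meas_avg f)
qed

lemma avg_exp_increment:
  assumes f: "bdd_meas f" and "finite R" "j \<notin> R"
  shows "avg {j} (\<lambda>x. exp (increment f j R x)) x \<le> exp_sq_increment f j R x"
proof -
  have "avg {j} (\<lambda>x. exp (increment f j R x)) x
      \<le> avg {j} (\<lambda>x. increment f j R x + exp ((increment f j R x)\<^sup>2)) x"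
    by (intro avg_mono bdd_meas_intros bdd_meas_increment f exp_le_add_exp_square)
  also have "\<dots> = avg {j} (increment f j R) x + exp_sq_increment f j R x"
    unfolding exp_sq_increment_def
    by (intro avg_add bdd_meas_intros bdd_meas_increment f)
  finally show ?thesis by (simp add: avg_increment assms)
qed

text \<open>An exponential supermartingale: every factor is divided by a majorant of its conditional
  mean. The head of the list is revealed first, so its factor \<open>D\<close> is constant in the
  coordinates of the tail, and the induction hypothesis applies inside.\<close>

lemma avg_exp_compensated:
  assumes f: "bdd_meas f" and "distinct js"
  shows "avg (set js) (\<lambda>y. exp (f y - avg (set js) f y - compensator f js y)) x \<le> 1"
  using assms(2)
proof (induction js arbitrary: x)
  case Nil
  then show ?case by (simp add: compensator_def)
next
  case (Cons j js)
  define R where "R = set js"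
  have jR: "j \<notin> R" "finite R" using Cons.prems by (auto simp: R_def)
  have U: "avg (insert j R) h x = avg {j} (avg R h) x" if "bdd_meas h" for h x
    using avg_Un[of "{j}" R h x] jR that by simp
  define D where "D y = exp (increment f j R y - ln (exp_sq_increment f j R y))" for y
  define E where "E y = exp (f y - avg R f y - compensator f js y)" for y
  have bD: "bdd_meas D" unfolding D_def
    by (intro bdd_meas_intros bdd_meas_ln bdd_meas_increment bdd_meas_exp_sq_increment
        exp_sq_increment_ge_1 f)
  have bE: "bdd_meas E" unfolding E_def by (intro bdd_meas_intros bdd_meas_compensator f)
  have inc: "constant_in R (increment f j R)"
    using constant_in_avg[of R R f] constant_in_avg[of R "insert j R" f]
    by (auto simp: constant_in_def increment_def)
  then have "constant_in R (\<lambda>x. exp ((increment f j R x)\<^sup>2))" by (simp add: constant_in_def)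
  then have K: "constant_in R (exp_sq_increment f j R)"
    unfolding exp_sq_increment_def by (rule constant_in_avg')
  have cD: "constant_in R D" using inc K by (simp add: constant_in_def D_def)
  \<comment> \<open>The compensating factor does not depend on \<open>j\<close> either. It is
    predictable and comes out of the average over \<open>j\<close>.\<close>
  have cK: "constant_in {j} (exp_sq_increment f j R)"
    unfolding exp_sq_increment_def by (rule constant_in_avg) simp
  have "(\<lambda>y. exp (f y - avg (insert j R) f y - compensator f (j # js) y)) = (\<lambda>y. D y * E y)"
    unfolding compensator_Cons D_def E_def
    by (simp add: exp_add[symmetric] increment_def R_def algebra_simps)
  then have "avg (insert j R) (\<lambda>y. exp (f y - avg (insert j R) f y - compensator f (j # js) y)) x
      = avg {j} (avg R (\<lambda>y. D y * E y)) x"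
    using U[of "\<lambda>y. D y * E y" x] bD bE by (simp add: bdd_meas_mult)
  also have "avg R (\<lambda>y. D y * E y) = (\<lambda>y. D y * avg R E y)"
    by (intro ext avg_mult_constant_in cD)
  also have "avg {j} (\<lambda>y. D y * avg R E y) x \<le> avg {j} D x"
  proof (rule avg_mono)
    show "bdd_meas (\<lambda>y. D y * avg R E y)" by (intro bdd_meas_intros bD bE)
    show "D y * avg R E y \<le> D y" for y
      using Cons.IH[of y] Cons.prems by (simp add: D_def E_def[abs_def] R_def)
  qed (rule bD)
  also have "D = (\<lambda>y. (1 / exp_sq_increment f j R y) * exp (increment f j R y))"
    using exp_sq_increment_ge_1[OF f, of j R]
    by (intro ext) (simp add: D_def exp_diff order.strict_trans2[OF zero_less_one])
  also have "avg {j} \<dots> x = (1 / exp_sq_increment f j R x) * avg {j} (\<lambda>y. exp (increment f j R y)) x"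
    using cK by (intro avg_mult_constant_in) (simp add: constant_in_def)
  also have "\<dots> \<le> 1"
    using avg_exp_increment[OF f jR(2,1), of x] exp_sq_increment_ge_1[OF f, of j R x]
    by (simp add: divide_le_eq)
  finally show ?case by (simp add: R_def)
qed

section \<open>Mixed differences and the exponential bound for degenerate functions\<close>

definition second_diff :: "'i \<Rightarrow> 'i \<Rightarrow> (('i \<Rightarrow> 'a) \<Rightarrow> real) \<Rightarrow> ('i \<Rightarrow> 'a) \<Rightarrow> ('i \<Rightarrow> 'a) \<Rightarrow> ('i \<Rightarrow> 'a) \<Rightarrow> real" where
  "second_diff j k f x z w = f (override_on (override_on x z {k}) w {j}) - f (override_on x z {k})
     - f (override_on x w {j}) + f x"

lemma second_diff_cmult: "second_diff j k (\<lambda>y. a * f y) x z w = a * second_diff j k f x z w"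
  by (simp add: second_diff_def algebra_simps)

text \<open>Up to sign, the change of \<open>f - avg {j} f\<close> in coordinate \<open>k\<close> is
  the mean of a mixed second difference over a fresh value of coordinate \<open>j\<close>. The
  average over \<open>R\<close> preserves the bound, also when \<open>k\<close> lies in
  \<open>R\<close>.\<close>

lemma diff_le_increment:
  assumes f: "bdd_meas f" and R: "finite R" "j \<notin> R" and "k \<noteq> j"
    and dd: "\<And>x z w. \<bar>second_diff j k f x z w\<bar> \<le> b"
  shows "diff_le b k (increment f j R)"
proof -
  interpret P: prob_space "Pi\<^sub>M {j} (\<lambda>_. M)" by (rule prob_PiM)
  have "avg (insert j R) f = avg R (avg {j} f)"
    using avg_Un[of R "{j}" f] R f by (simp add: fun_eq_iff)
  then have eq: "increment f j R = avg R (\<lambda>x. f x - avg {j} f x)"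
    by (intro ext) (simp add: increment_def avg_diff f bdd_meas_avg)
  have "diff_le b k (\<lambda>x. f x - avg {j} f x)"
    unfolding diff_le_def
  proof (intro allI)
    fix x z
    let ?D = "\<lambda>w. f (override_on (override_on x z {k}) w {j}) - f (override_on x w {j})"
    have I: "integrable (Pi\<^sub>M {j} (\<lambda>_. M)) ?D"
      by (intro Bochner_Integration.integrable_diff integrable_override f)
    have "avg {j} f (override_on x z {k}) - avg {j} f x = (\<integral>w. ?D w \<partial>Pi\<^sub>M {j} (\<lambda>_. M))"
      unfolding avg_def
      by (subst Bochner_Integration.integral_diff) (auto intro!: integrable_override f)
    moreover have "(\<integral>w. ?D w \<partial>Pi\<^sub>M {j} (\<lambda>_. M)) \<le> f (override_on x z {k}) - f x + b"
      using dd[of x z, unfolded second_diff_def] by (intro P.integral_le_const I AE_I2) (smt (verit))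
    moreover have "f (override_on x z {k}) - f x - b \<le> (\<integral>w. ?D w \<partial>Pi\<^sub>M {j} (\<lambda>_. M))"
      using dd[of x z, unfolded second_diff_def] by (intro P.integral_ge_const I AE_I2) (smt (verit))
    ultimately show "\<bar>f (override_on x z {k}) - avg {j} f (override_on x z {k}) - (f x - avg {j} f x)\<bar> \<le> b"
      by linarith
  qed
  then show ?thesis unfolding eq by (intro diff_le_avg bdd_meas_intros f)
qed

text \<open>This is where degeneracy acts: averaging over everything except \<open>j\<close> turns
  the two terms of the increment into \<open>avg (J - {j}) f\<close> and \<open>avg J f\<close>,
  which coincide.\<close>

lemma avg_increment_degenerate:
  assumes f: "bdd_meas f" and J: "finite J" "j \<in> J" "R \<subseteq> J - {j}"
    and deg: "\<And>x. avg (J - {j}) f x = avg J f x"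
  shows "avg (J - {j}) (increment f j R) x = 0"
proof -
  have fin: "finite R" using J finite_subset by blast
  have "avg (insert j R) f = avg R (avg {j} f)"
    using avg_Un[of R "{j}" f] J fin f by (auto simp: fun_eq_iff)
  then have "avg (J - {j}) (avg (insert j R) f) x = avg (J - {j}) (avg {j} f) x"
    using J f by (simp add: avg_avg_subset bdd_meas_avg)
  also have "\<dots> = avg J f x"
    using avg_Un[of "J - {j}" "{j}" f x] J f by (simp add: insert_absorb)
  finally show ?thesis
    using J f deg[of x] unfolding increment_def[abs_def]
    by (simp add: avg_diff bdd_meas_avg avg_avg_subset)
qed

theorem avg_exp_degenerate:
  assumes f: "bdd_meas f" and J: "finite J" "J \<noteq> {}"
    and deg: "\<And>j x. j \<in> J \<Longrightarrow> avg (J - {j}) f x = avg J f x"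
    and dd: "\<And>j k x z w. j \<in> J \<Longrightarrow> k \<in> J \<Longrightarrow> k \<noteq> j \<Longrightarrow> \<bar>second_diff j k f x z w\<bar> \<le> b"
    and b: "real (card J) * b * \<theta> \<le> 1 / 2" "0 \<le> b" "0 \<le> \<theta>"
  shows "avg J (\<lambda>y. exp (\<theta> * (f y - avg J f y))) x \<le> 5 / 4"
proof -
  obtain js where js: "set js = J" "distinct js" using J(1) finite_distinct_list by blast
  define n where "n = length js"
  have n: "n = card J" "n > 0" using js J distinct_card[of js] by (auto simp: n_def card_gt_0_iff)
  \<comment> \<open>The factor 2 anticipates the last step, where the exponential is split into a
    product of two square roots.\<close>
  define h where "h y = 2 * \<theta> * f y" for y
  have bh: "bdd_meas h" unfolding h_def by (intro bdd_meas_intros f)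
  define W where "W = compensator h js"
  have bW: "bdd_meas W" unfolding W_def by (rule bdd_meas_compensator[OF bh])
  have avgh: "avg K h y = 2 * \<theta> * avg K f y" for K y unfolding h_def by (rule avg_cmult)
  define j where "j k = js ! k" for k
  define R where "R k = set (drop (Suc k) js)" for k
  have jR: "j k \<in> J" "R k \<subseteq> J - {j k}" if "k < n" for k
  proof -
    have "js = take k js @ js ! k # drop (Suc k) js" using that by (simp add: n_def id_take_nth_drop)
    then have "distinct (js ! k # drop (Suc k) js)" using js(2) by (metis distinct_append)
    then show "j k \<in> J" "R k \<subseteq> J - {j k}"
      using that js(1) by (auto simp: j_def R_def n_def dest: in_set_dropD)
  qed
  \<comment> \<open>This bounds the single terms left by Jensen's inequality: the
    \<open>n\<close>-th power moves inside the mean over \<open>j k\<close>, which leaves the mean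
    of the exponential of \<open>n\<close> times the squared increment.\<close>
  have step: "avg J (\<lambda>y. exp (real n * ln (exp_sq_increment h (j k) (R k) y))) x \<le> 3 / 2" if "k < n" for k
  proof -
    let ?G = "increment h (j k) (R k)"
    note jRk = jR[OF that]
    have finR: "finite (R k)" by (simp add: R_def)
    have bG: "bdd_meas ?G" by (rule bdd_meas_increment[OF bh])
    have bS: "bdd_meas (\<lambda>y. exp ((?G y)\<^sup>2))" by (intro bdd_meas_intros bG)
    have bN: "bdd_meas (\<lambda>y. exp (real n * (?G y)\<^sup>2))" by (intro bdd_meas_intros bG)
    have pow: "exp (real n * ln (exp_sq_increment h (j k) (R k) y)) = exp_sq_increment h (j k) (R k) y ^ n" for y
      using exp_sq_increment_ge_1[OF bh, of "j k" "R k" y] by (simp add: exp_of_nat_mult)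
    have "avg J (\<lambda>y. exp (real n * ln (exp_sq_increment h (j k) (R k) y))) x
        \<le> avg J (avg {j k} (\<lambda>y. exp (real n * (?G y)\<^sup>2))) x"
    proof (rule avg_mono)
      show "bdd_meas (\<lambda>y. exp (real n * ln (exp_sq_increment h (j k) (R k) y)))"
        unfolding pow by (intro bdd_meas_intros bdd_meas_exp_sq_increment bh)
      show "bdd_meas (avg {j k} (\<lambda>y. exp (real n * (?G y)\<^sup>2)))" by (intro bdd_meas_avg bN)
      show "exp (real n * ln (exp_sq_increment h (j k) (R k) y)) \<le> avg {j k} (\<lambda>y. exp (real n * (?G y)\<^sup>2)) y" for y
        using avg_power_le[OF bS, of "{j k}" y n]
        unfolding pow by (simp add: exp_sq_increment_def exp_of_nat_mult)
    qed
    also have "\<dots> = avg J (\<lambda>y. exp (real n * (?G y)\<^sup>2)) x"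
      using jRk J bN by (intro avg_avg_subset) auto
    \<comment> \<open>The roles change here. Coordinate \<open>j k\<close>, in which the increment
      is a martingale difference, is frozen, and the increment is treated as a function of the other
      coordinates, in which it is centred by degeneracy.\<close>
    also have "\<dots> = avg {j k} (avg (J - {j k}) (\<lambda>y. exp (real n * (?G y)\<^sup>2))) x"
      using avg_Un[of "{j k}" "J - {j k}" "\<lambda>y. exp (real n * (?G y)\<^sup>2)" x] jRk J bN
      by (simp add: insert_absorb)
    also have "\<dots> \<le> 3 / 2"
    proof (rule avg_le_const)
      show "bdd_meas (avg (J - {j k}) (\<lambda>y. exp (real n * (?G y)\<^sup>2)))" by (intro bdd_meas_avg bN)
      fix z
      show "avg (J - {j k}) (\<lambda>y. exp (real n * (?G y)\<^sup>2)) (override_on x z {j k}) \<le> 3 / 2"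
      proof (rule avg_exp_square_le[where c = "2 * \<theta> * b" and n = "real n", OF _ bG])
        show "diff_le (2 * \<theta> * b) i ?G" if i: "i \<in> J - {j k}" for i
        proof (rule diff_le_increment[OF bh finR])
          fix x z w
          show "\<bar>second_diff (j k) i h x z w\<bar> \<le> 2 * \<theta> * b"
            unfolding h_def second_diff_cmult abs_mult using i jRk b by (intro mult_mono dd) auto
        qed (use i jRk in auto)
        show "avg (J - {j k}) ?G y = 0" for y
          using jRk J deg by (intro avg_increment_degenerate bh) (auto simp: avgh)
        \<comment> \<open>With \<open>s = n\<close> and differences at most
          \<open>2 * \<theta> * b\<close>, the condition of the square bound reads (2 n b
          \<theta>)^2 \<le> 1, which is the assumption on \<open>\<theta>\<close>.\<close>
        have "(2 * (real (card J) * b * \<theta>))\<^sup>2 \<le> 1\<^sup>2" using b by (intro power_mono) auto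
        then show "real n * real n * (2 * \<theta> * b)\<^sup>2 \<le> 1"
          by (simp add: n power_mult_distrib power2_eq_square mult_ac)
        show "real (card (J - {j k})) \<le> real n" using J by (simp add: n card_mono)
      qed (use J in auto)
    qed
    finally show ?thesis .
  qed
  have bK: "bdd_meas (\<lambda>y. exp (real n * ln (exp_sq_increment h (j k) (R k) y)))" for k
    by (intro bdd_meas_intros bdd_meas_ln bdd_meas_exp_sq_increment bh exp_sq_increment_ge_1)
  have "avg J (\<lambda>y. exp (W y)) x
      \<le> avg J (\<lambda>y. (1 / n) * (\<Sum>k<n. exp (real n * ln (exp_sq_increment h (j k) (R k) y)))) x"
  proof (rule avg_mono)
    show "exp (W y) \<le> (1 / n) * (\<Sum>k<n. exp (real n * ln (exp_sq_increment h (j k) (R k) y)))" for y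
      using exp_sum_le_mean[OF n(2), of "\<lambda>k. ln (exp_sq_increment h (j k) (R k) y)"]
      by (simp add: W_def compensator_def j_def R_def n_def)
  qed (intro bdd_meas_intros bdd_meas_sum bK bW)+
  also have "\<dots> = (1 / n) * (\<Sum>k<n. avg J (\<lambda>y. exp (real n * ln (exp_sq_increment h (j k) (R k) y))) x)"
    unfolding avg_cmult by (subst avg_sum) (auto intro: bK)
  also have "\<dots> \<le> (1 / n) * (\<Sum>k<n. 3 / 2)"
    by (intro mult_left_mono sum_mono step) auto
  also have "\<dots> = 3 / 2" using n by simp
  finally have EW: "avg J (\<lambda>y. exp (W y)) x \<le> 3 / 2" .
  define V where "V y = exp (h y - avg J h y - W y)" for y
  have bV: "bdd_meas V" unfolding V_def by (intro bdd_meas_intros bh bW)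
  have EV: "avg J V x \<le> 1"
    using avg_exp_compensated[OF bh js(2), of x] by (simp add: V_def[abs_def] W_def js)
  \<comment> \<open>The arithmetic-geometric mean inequality separates the compensated exponential
    \<open>V\<close> from the exponential of the compensator \<open>W\<close>.\<close>
  have "avg J (\<lambda>y. exp (\<theta> * (f y - avg J f y))) x \<le> avg J (\<lambda>y. (1 / 2) * (V y + exp (W y))) x"
  proof (rule avg_mono)
    fix z define y where "y = override_on x z J"
    define u where "u = exp ((h y - avg J h y - W y) / 2)"
    define v where "v = exp (W y / 2)"
    have "V y = u\<^sup>2" "exp (W y) = v\<^sup>2" by (simp_all add: V_def u_def v_def exp_double[symmetric])
    moreover have "exp (\<theta> * (f y - avg J f y)) = u * v"
      unfolding u_def v_def exp_add[symmetric] by (simp add: avgh h_def[of y] field_simps)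
    ultimately show "exp (\<theta> * (f y - avg J f y)) \<le> (1 / 2) * (V y + exp (W y))"
      using sum_squares_bound[of u v] by simp
  qed (intro bdd_meas_intros f bV bW)+
  also have "\<dots> = (1 / 2) * (avg J V x + avg J (\<lambda>y. exp (W y)) x)"
    unfolding avg_cmult by (simp add: avg_add bV bdd_meas_exp bW)
  also have "\<dots> \<le> 5 / 4" using EV EW by simp
  finally show ?thesis .
qed

end

section \<open>Degeneracy of the rescaled statistic and the two-sample tail\<close>

section \<open>Statistics of a homogeneous sample\<close>

text \<open>Serves to extract each of the two samples, with its own index set, from the joint family
  indexed by a sum type.\<close>

lemma (in prob_space) indep_vars_reindex:
  assumes inj: "inj_on f I" and ind: "indep_vars M' X (f ` I)"
  shows "indep_vars (\<lambda>i. M' (f i)) (\<lambda>i. X (f i)) I"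
  unfolding indep_vars_def2
proof (intro conjI ballI indep_setsI)
  note ind' = ind[unfolded indep_vars_def2]
  fix i assume i: "i \<in> I"
  then show rv: "X (f i) \<in> measurable M (M' (f i))" using ind' by blast
  show "{X (f i) -` A \<inter> space M |A. A \<in> sets (M' (f i))} \<subseteq> events"
    using measurable_sets[OF rv] by blast
next
  fix A J assume J: "J \<noteq> {}" "J \<subseteq> I" "finite J"
    and A: "\<forall>j\<in>J. A j \<in> {X (f j) -` A \<inter> space M |A. A \<in> sets (M' (f j))}"
  have injJ: "inj_on f J" using inj J(2) inj_on_subset by blast
  define B where "B = A \<circ> inv_into J f"
  have B: "B (f j) = A j" if "j \<in> J" for j using that injJ by (simp add: B_def)
  have "prob (\<Inter>j\<in>f ` J. B j) = (\<Prod>j\<in>f ` J. prob (B j))"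
    using ind[unfolded indep_vars_def2] J A B by (intro indep_setsD[of _ "f ` I"]) auto
  then show "prob (\<Inter>j\<in>J. A j) = (\<Prod>j\<in>J. prob (A j))"
    using B by (simp add: prod.reindex[OF injJ])
qed

text \<open>A union bound over the ordered pairs of distinct positions at which \<open>i\<close>
  takes the values \<open>j\<close> and \<open>k\<close>. The factor \<open>(real n)\<^sup>2\<close>
  stands on the left because \<open>p - 2\<close> truncates for small \<open>p\<close>, where no
  such pair of positions exists.\<close>

lemma card_functions_through_two:
  assumes "n \<ge> 1" and j: "j \<in> {1..n}" and k: "k \<in> {1..n}" and ne: "j \<noteq> k"
  shows "real (card {i \<in> {1..p} \<rightarrow>\<^sub>E {1..n}. j \<in> i ` {1..p} \<and> k \<in> i ` {1..p}}) * (real n)\<^sup>2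
    \<le> (real p)\<^sup>2 * real n ^ p"
proof -
  let ?I = "{1..p}" and ?N = "{1..n}"
  define G where "G w = {i \<in> ?I \<rightarrow>\<^sub>E ?N. i (fst w) = j \<and> i (snd w) = k}" for w
  define S where "S = (SIGMA a:?I. ?I - {a})"
  have fin: "finite (?I \<rightarrow>\<^sub>E ?N)" by (intro finite_PiE) auto
  have cG: "real (card (G w)) * (real n)\<^sup>2 = real n ^ p" if w: "w \<in> S" for w
  proof -
    obtain a b where ab: "w = (a, b)" "a \<in> ?I" "b \<in> ?I - {a}" using w unfolding S_def by blast
    define B where "B c = (if c = a then {j} else if c = b then {k} else ?N)" for c
    have "G w = (\<Pi>\<^sub>E c\<in>?I. B c)"
    proof (intro set_eqI iffI)
      fix i assume "i \<in> G w"
      then show "i \<in> (\<Pi>\<^sub>E c\<in>?I. B c)" by (auto simp: G_def ab B_def PiE_iff)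
    next
      fix i assume i: "i \<in> (\<Pi>\<^sub>E c\<in>?I. B c)"
      then have "i a \<in> B a" "i b \<in> B b" "\<And>c. c \<in> ?I \<Longrightarrow> i c \<in> B c" "i \<in> extensional ?I"
        using ab by (auto simp: PiE_iff)
      moreover have BN: "B c \<subseteq> ?N" for c using j k by (auto simp: B_def)
      ultimately have "i \<in> ?I \<rightarrow>\<^sub>E ?N" unfolding PiE_iff by blast
      then show "i \<in> G w" using \<open>i a \<in> B a\<close> \<open>i b \<in> B b\<close> ab by (simp add: G_def B_def)
    qed
    then have "card (G w) = (\<Prod>c\<in>?I. card (B c))" by (simp add: card_PiE)
    also have "\<dots> = card (B a) * (card (B b) * (\<Prod>c\<in>?I - {a} - {b}. card (B c)))"
      using ab by (subst prod.remove[of _ a], simp, simp, subst prod.remove[of _ b]) auto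
    also have "(\<Prod>c\<in>?I - {a} - {b}. card (B c)) = (\<Prod>c\<in>?I - {a} - {b}. n)"
      by (intro prod.cong) (auto simp: B_def)
    also have "\<dots> = n ^ (p - 2)" using ab by (simp add: numeral_2_eq_2)
    finally have "card (G w) = n ^ (p - 2)" using ab by (simp add: B_def)
    moreover have "p = (p - 2) + 2" using ab by auto
    ultimately show ?thesis by (metis of_nat_power power_add)
  qed
  have sub: "{i \<in> ?I \<rightarrow>\<^sub>E ?N. j \<in> i ` ?I \<and> k \<in> i ` ?I} \<subseteq> (\<Union>w\<in>S. G w)"
  proof
    fix i assume i: "i \<in> {i \<in> ?I \<rightarrow>\<^sub>E ?N. j \<in> i ` ?I \<and> k \<in> i ` ?I}"
    then obtain a b where "a \<in> ?I" "b \<in> ?I" "i a = j" "i b = k" by auto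
    then have "(a, b) \<in> S" "i \<in> G (a, b)" using i ne by (auto simp: S_def G_def)
    then show "i \<in> (\<Union>w\<in>S. G w)" by blast
  qed
  have finS: "finite S" by (simp add: S_def)
  have finU: "finite (\<Union>w\<in>S. G w)"
    by (rule finite_subset[OF _ fin]) (auto simp: G_def)
  have "card {i \<in> ?I \<rightarrow>\<^sub>E ?N. j \<in> i ` ?I \<and> k \<in> i ` ?I} \<le> (\<Sum>w\<in>S. card (G w))"
    by (rule order_trans[OF card_mono[OF finU sub] card_UN_le[OF finS]])
  then have "real (card {i \<in> ?I \<rightarrow>\<^sub>E ?N. j \<in> i ` ?I \<and> k \<in> i ` ?I}) * (real n)\<^sup>2
      \<le> (\<Sum>w\<in>S. real (card (G w))) * (real n)\<^sup>2"
    by (intro mult_right_mono) (simp_all flip: of_nat_sum)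
  also have "\<dots> = real (card S) * real n ^ p" by (simp add: sum_distrib_right cG)
  also have "\<dots> \<le> (real p)\<^sup>2 * real n ^ p"
  proof (intro mult_right_mono)
    have "card S \<le> card (?I \<times> ?I)" by (intro card_mono) (auto simp: S_def)
    then show "real (card S) \<le> (real p)\<^sup>2" by (simp add: power2_eq_square flip: of_nat_mult)
  qed simp
  finally show ?thesis .
qed

text \<open>The interface between probability and geometry. The maps in \<open>homog\<close>
  preserve the measure as well as the distance; for isometries of a manifold the former has to be
  derived.\<close>

locale symmetric_sample = coordinate_average M for M :: "'a::second_countable_topology measure" +
  fixes d :: "'a \<Rightarrow> 'a \<Rightarrow> real" and \<phi> :: "(nat \<times> nat \<Rightarrow> real) \<Rightarrow> real" and p n :: nat and A :: real
  assumes sets_M: "sets M = sets borel"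
    and cont_d: "continuous_on UNIV (\<lambda>(x, y). d x y)"
    and homog: "\<And>x y. \<exists>T. T \<in> measurable M M \<and> distr M M T = M \<and> (\<forall>u v. d (T u) (T v) = d u v) \<and> T x = y"
    and \<phi>: "cont_bdd p \<phi>" "sup_norm_le p \<phi> A"
    and A: "A > 0" and n: "n \<ge> 1"
begin

definition stat :: "(nat \<Rightarrow> 'a) \<Rightarrow> real" where
  "stat x = real n * Phi p \<phi> d (empirical n x)"

lemma stat_eq: "stat x = (real n / real n ^ p) *
    (\<Sum>i\<in>{1..p} \<rightarrow>\<^sub>E {1..n}. \<phi> (dist_vec p d (\<lambda>a. x (i a))))"
  unfolding stat_def Phi_empirical[OF n] by simp

lemma \<phi>_bound: "\<bar>\<phi> (dist_vec p d x)\<bar> \<le> A"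
proof -
  have "dist_vec p d x \<in> pairs p \<rightarrow>\<^sub>E UNIV" by (auto simp: dist_vec_def)
  then show ?thesis using \<phi>(2) by (auto simp: sup_norm_le_def)
qed

lemma bdd_meas_\<phi>: "bdd_meas (\<lambda>x. \<phi> (dist_vec p d x))"
proof (rule bdd_measI[OF _ \<phi>_bound])
  have "continuous_on UNIV (\<lambda>x. d (x a) (x b))" for a b :: nat
  proof -
    have "continuous_on UNIV (\<lambda>x :: nat \<Rightarrow> 'a. (x a, x b))"
      by (intro continuous_on_Pair continuous_on_product_coordinates)
    from continuous_on_compose2[OF cont_d this] show ?thesis by simp
  qed
  then have "continuous_map euclidean (product_topology (\<lambda>_. euclidean) (pairs p)) (dist_vec p d)"
    unfolding continuous_map_componentwise by (auto simp: dist_vec_def)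
  then have "continuous_map euclidean euclidean (\<phi> \<circ> dist_vec p d)"
    using \<phi>(1) unfolding cont_bdd_def by (blast intro: continuous_map_compose)
  then have "(\<lambda>x. \<phi> (dist_vec p d x)) \<in> borel_measurable borel"
    by (intro borel_measurable_continuous_onI) (simp add: comp_def)
  \<comment> \<open>Second countability makes the Borel sets of the countable product agree with the
    product sigma-algebra, so continuity gives measurability.\<close>
  moreover have "sets (Pi\<^sub>M UNIV (\<lambda>_::nat. M)) = sets borel"
    using sets_PiM_cong[of UNIV UNIV "\<lambda>_::nat. M" "\<lambda>_. borel"] sets_M sets_PiM_equal_borel by simp
  ultimately show "(\<lambda>x. \<phi> (dist_vec p d x)) \<in> borel_measurable (Pi\<^sub>M UNIV (\<lambda>_. M))"
    using measurable_cong_sets by blast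
qed

lemma bdd_meas_stat: "bdd_meas stat"
proof -
  have "bdd_meas (\<lambda>x. \<phi> (dist_vec p d (\<lambda>a. x (i a))))" for i :: "nat \<Rightarrow> nat"
  proof (rule bdd_measI[OF _ \<phi>_bound])
    have "(\<lambda>x a. x (i a)) \<in> measurable (Pi\<^sub>M UNIV (\<lambda>_. M)) (Pi\<^sub>M UNIV (\<lambda>_::nat. M))"
      by (rule measurable_PiM_single') (auto simp: space_UNIV)
    from measurable_compose[OF this bdd_meas_measurable[OF bdd_meas_\<phi>]]
    show "(\<lambda>x. \<phi> (dist_vec p d (\<lambda>a. x (i a)))) \<in> borel_measurable (Pi\<^sub>M UNIV (\<lambda>_. M))" .
  qed
  then show ?thesis unfolding stat_eq[abs_def] by (intro bdd_meas_intros bdd_meas_sum)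
qed

lemma stat_cong: "(\<And>i. i \<in> {1..n} \<Longrightarrow> x i = y i) \<Longrightarrow> stat x = stat y"
  unfolding stat_eq
  by (intro arg_cong2[where f = "(*)"] sum.cong arg_cong[where f = \<phi>] refl)
    (auto simp: dist_vec_def pairs_def fun_eq_iff PiE_iff intro!: arg_cong2[where f = d])

lemma stat_isometry: "(\<And>u v. d (T u) (T v) = d u v) \<Longrightarrow> stat (\<lambda>i. T (x i)) = stat x"
  unfolding stat_eq dist_vec_def by simp

text \<open>The averaged points may be moved by \<open>T\<close> as well, since this does not change
  their law; then all points have been moved, and \<open>stat\<close> sees only distances.\<close>

lemma avg_stat_isometry:
  assumes T: "T \<in> measurable M M" "distr M M T = M" "\<And>u v. d (T u) (T v) = d u v" and K: "finite K"
  shows "avg K stat (\<lambda>i. T (x i)) = avg K stat x"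
proof -
  have D: "distr (Pi\<^sub>M K (\<lambda>_. M)) (Pi\<^sub>M K (\<lambda>_. M)) (compose K T) = Pi\<^sub>M K (\<lambda>_. M)"
    using distr_PiM_finite_prob_space'[of K "\<lambda>_. M" "\<lambda>_. M" T] K T(1,2) prob_space_axioms by simp
  have m: "compose K T \<in> measurable (Pi\<^sub>M K (\<lambda>_. M)) (Pi\<^sub>M K (\<lambda>_. M))"
    unfolding compose_def
    by (intro measurable_restrict measurable_compose[OF _ T(1)] measurable_component_singleton)
  have "avg K stat (\<lambda>i. T (x i)) = (\<integral>z. stat (override_on (\<lambda>i. T (x i)) (compose K T z) K) \<partial>Pi\<^sub>M K (\<lambda>_. M))"
    unfolding avg_def by (subst D[symmetric], rule integral_distr[OF m bdd_meas_override[OF bdd_meas_stat]])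
  moreover have "override_on (\<lambda>i. T (x i)) (compose K T z) K = (\<lambda>i. T (override_on x z K i))" for z
    by (auto simp: override_on_def compose_def)
  ultimately show ?thesis by (simp add: stat_isometry T(3) avg_def)
qed

lemma avg_stat_degenerate:
  assumes j: "j \<in> {1..n}"
  shows "avg ({1..n} - {j}) stat x = avg {1..n} stat x"
proof -
  define K where "K = {1..n} - {j}"
  have const: "avg K stat x = avg K stat y" for x y
  proof -
    obtain T where T: "T \<in> measurable M M" "distr M M T = M" "\<And>u v. d (T u) (T v) = d u v" "T (x j) = y j"
      using homog by blast
    \<comment> \<open>Of the coordinates that \<open>stat\<close> reads only \<open>j\<close> lies
      outside \<open>K\<close>, and there \<open>T\<close> has been chosen to match the two
      points.\<close>
    have "avg K stat y = avg K stat (\<lambda>i. T (x i))"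
      unfolding avg_def
      by (intro Bochner_Integration.integral_cong refl stat_cong) (use T(4) in \<open>auto simp: K_def override_on_def\<close>)
    then show ?thesis using avg_stat_isometry[OF T(1-3), of K x] by (simp add: K_def)
  qed
  have "avg {1..n} stat x = avg {j} (avg K stat) x"
    using avg_Un[of "{j}" K stat x] j bdd_meas_stat by (simp add: K_def insert_absorb)
  also have "avg K stat = (\<lambda>_. avg K stat x)" using const by blast
  finally show ?thesis by (simp add: K_def)
qed

text \<open>Summands that do not read both coordinates cancel in pairs; each of the others
  contributes at most \<open>4 * A\<close>, from four values of \<open>\<phi>\<close>.\<close>

lemma stat_second_difference:
  assumes j: "j \<in> {1..n}" and k: "k \<in> {1..n}" and ne: "k \<noteq> j"
  shows "\<bar>second_diff j k stat x z w\<bar> \<le> 4 * A * (real p)\<^sup>2 / real n"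
proof -
  let ?PI = "{1..p} \<rightarrow>\<^sub>E {1..n}"
  define u where "u y i = \<phi> (dist_vec p d (\<lambda>a. y (i a)))" for y :: "nat \<Rightarrow> 'a" and i :: "nat \<Rightarrow> nat"
  define D where "D i = u (override_on (override_on x z {k}) w {j}) i - u (override_on x z {k}) i
     - u (override_on x w {j}) i + u x i" for i
  define S where "S = {i \<in> ?PI. j \<in> i ` {1..p} \<and> k \<in> i ` {1..p}}"
  have fin: "finite ?PI" by (intro finite_PiE) auto
  have ucong: "u y i = u y' i" if "\<And>a. a \<in> {1..p} \<Longrightarrow> y (i a) = y' (i a)" for y y' i
    unfolding u_def using that by (intro arg_cong[where f = \<phi>]) (auto simp: dist_vec_def pairs_def fun_eq_iff)
  have D0: "D i = 0" if "i \<in> ?PI - S" for i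
  proof (cases "j \<in> i ` {1..p}")
    case False
    then have "u (override_on (override_on x z {k}) w {j}) i = u (override_on x z {k}) i"
      "u (override_on x w {j}) i = u x i"
      by (auto intro!: ucong simp: override_on_def)
    then show ?thesis by (simp add: D_def)
  next
    case True
    then have "k \<notin> i ` {1..p}" using that by (auto simp: S_def)
    then have "u (override_on (override_on x z {k}) w {j}) i = u (override_on x w {j}) i"
      "u (override_on x z {k}) i = u x i"
      by (auto intro!: ucong simp: override_on_def)
    then show ?thesis by (simp add: D_def)
  qed
  have D4: "\<bar>D i\<bar> \<le> 4 * A" for i
  proof -
    have "\<bar>u y i\<bar> \<le> A" for y by (simp add: u_def \<phi>_bound)
    from this[of "override_on (override_on x z {k}) w {j}"] this[of "override_on x z {k}"]
      this[of "override_on x w {j}"] this[of x]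
    show ?thesis unfolding D_def by linarith
  qed
  have "\<bar>\<Sum>i\<in>?PI. D i\<bar> = \<bar>\<Sum>i\<in>S. D i\<bar>"
    using D0 fin by (intro arg_cong[where f = abs] sum.mono_neutral_right) (auto simp: S_def)
  also have "\<dots> \<le> (\<Sum>i\<in>S. 4 * A)" by (intro order_trans[OF sum_abs] sum_mono D4)
  also have "\<dots> = real (card S) * (4 * A)" by simp
  finally have DS: "\<bar>\<Sum>i\<in>?PI. D i\<bar> \<le> real (card S) * (4 * A)" .
  have cS: "real (card S) * (real n)\<^sup>2 \<le> (real p)\<^sup>2 * real n ^ p"
    unfolding S_def using card_functions_through_two[OF n j k] ne by blast
  have n0: "real n > 0" using n by simp
  have "second_diff j k stat x z w = real n / real n ^ p * (\<Sum>i\<in>?PI. D i)"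
    unfolding second_diff_def stat_eq D_def u_def by (simp add: sum.distrib sum_subtractf algebra_simps)
  then have "\<bar>second_diff j k stat x z w\<bar> = real n / real n ^ p * \<bar>\<Sum>i\<in>?PI. D i\<bar>"
    by (simp add: abs_mult)
  also have "\<dots> \<le> real n / real n ^ p * (real (card S) * (4 * A))"
    by (intro mult_left_mono DS) auto
  also have "\<dots> = (real (card S) * (real n)\<^sup>2) * (4 * A) / (real n ^ p * real n)"
    using n0 by (simp add: field_simps power2_eq_square)
  also have "\<dots> \<le> ((real p)\<^sup>2 * real n ^ p) * (4 * A) / (real n ^ p * real n)"
    using A by (intro divide_right_mono mult_right_mono cS) auto
  also have "\<dots> = 4 * A * (real p)\<^sup>2 / real n" using n0 by (simp add: field_simps)
  finally show ?thesis .
qed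

text \<open>The number of coordinates times the second difference bound is
  \<open>4 * A * (real p)\<^sup>2\<close>, so the condition on \<open>\<theta>\<close> does not
  involve \<open>n\<close>. The sign \<open>s\<close> serves the two tails.\<close>

lemma avg_exp_stat:
  assumes s: "\<bar>s\<bar> = 1" and \<theta>: "0 \<le> \<theta>" "4 * A * (real p)\<^sup>2 * \<theta> \<le> 1 / 2"
  shows "avg {1..n} (\<lambda>y. exp (\<theta> * (s * (stat y - avg {1..n} stat y)))) x \<le> 5 / 4"
proof -
  let ?f = "\<lambda>y. s * stat y"
  have b: "bdd_meas ?f" by (intro bdd_meas_intros bdd_meas_stat)
  have "avg {1..n} (\<lambda>y. exp (\<theta> * (?f y - avg {1..n} ?f y))) x \<le> 5 / 4"
  proof (rule avg_exp_degenerate[OF b, where b = "4 * A * (real p)\<^sup>2 / real n"])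
    show "avg ({1..n} - {j}) ?f x = avg {1..n} ?f x" if "j \<in> {1..n}" for j x
      using avg_stat_degenerate[OF that] by (simp add: avg_cmult)
    show "\<bar>second_diff j k ?f x z w\<bar> \<le> 4 * A * (real p)\<^sup>2 / real n"
      if "j \<in> {1..n}" "k \<in> {1..n}" "k \<noteq> j" for j k x z w
      using stat_second_difference[OF that, of x z w] s by (simp add: second_diff_cmult abs_mult)
  qed (use n A \<theta> in \<open>auto simp: field_simps\<close>)
  then show ?thesis by (simp add: avg_cmult right_diff_distrib)
qed

lemma expectation_exp_stat:
  assumes P: "prob_space P" and ind: "prob_space.indep_vars P (\<lambda>_. borel) X {1..n}"
    and law: "\<And>i. i \<in> {1..n} \<Longrightarrow> distr P borel (X i) = M"
    and s: "\<bar>s\<bar> = 1" and \<theta>: "0 \<le> \<theta>" "4 * A * (real p)\<^sup>2 * \<theta> \<le> 1 / 2"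
  shows "(\<integral>\<omega>. exp (\<theta> * (s * (stat (\<lambda>i\<in>{1..n}. X i \<omega>) - avg {1..n} stat x))) \<partial>P) \<le> 5 / 4"
proof -
  interpret P: prob_space P by (rule P)
  have rv: "X i \<in> borel_measurable P" if "i \<in> {1..n}" for i
    using ind that by (simp add: P.indep_vars_def)
  have D: "distr P (Pi\<^sub>M {1..n} (\<lambda>_. borel)) (\<lambda>\<omega>. \<lambda>i\<in>{1..n}. X i \<omega>) = Pi\<^sub>M {1..n} (\<lambda>_. M)"
  proof -
    have "distr P (Pi\<^sub>M {1..n} (\<lambda>_. borel)) (\<lambda>\<omega>. \<lambda>i\<in>{1..n}. X i \<omega>) = (\<Pi>\<^sub>M i\<in>{1..n}. distr P borel (X i))"
      using ind n rv by (subst P.indep_vars_iff_distr_eq_PiM'[symmetric]) auto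
    also have "\<dots> = Pi\<^sub>M {1..n} (\<lambda>_. M)" using law by (intro PiM_cong) auto
    finally show ?thesis .
  qed
  \<comment> \<open>All coordinates that \<open>stat\<close> reads are averaged, so the point at
    which the mean is evaluated is only a placeholder.\<close>
  have c: "avg {1..n} stat y = avg {1..n} stat x" for y
    unfolding avg_def by (intro Bochner_Integration.integral_cong refl stat_cong) auto
  define G where "G y = exp (\<theta> * (s * (stat y - avg {1..n} stat y)))" for y
  have bG: "bdd_meas G" unfolding G_def by (intro bdd_meas_intros bdd_meas_stat)
  have Gov: "G (override_on x z {1..n}) = G z" for z
    using stat_cong[of "override_on x z {1..n}" z] unfolding G_def c[of z] c[of "override_on x z {1..n}"] by simp
  have Gm: "G \<in> borel_measurable (Pi\<^sub>M {1..n} (\<lambda>_. borel))"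
  proof -
    have eq: "sets (Pi\<^sub>M {1..n} (\<lambda>_. M)) = sets (Pi\<^sub>M {1..n} (\<lambda>_. borel))"
      by (intro sets_PiM_cong) (auto simp: sets_M)
    show ?thesis
      using bdd_meas_override[OF bG, of x "{1..n}"] unfolding Gov measurable_cong_sets[OF eq refl] .
  qed
  have "(\<integral>\<omega>. exp (\<theta> * (s * (stat (\<lambda>i\<in>{1..n}. X i \<omega>) - avg {1..n} stat x))) \<partial>P)
      = (\<integral>\<omega>. G (\<lambda>i\<in>{1..n}. X i \<omega>) \<partial>P)"
    unfolding G_def c[of "\<lambda>i\<in>{1..n}. X i _"] ..
  also have "\<dots> = (\<integral>z. G z \<partial>Pi\<^sub>M {1..n} (\<lambda>_. M))"
    unfolding D[symmetric] by (rule integral_distr[OF measurable_restrict[OF rv] Gm, symmetric])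
  also have "\<dots> = avg {1..n} G x" unfolding avg_def Gov ..
  also have "\<dots> \<le> 5 / 4" unfolding G_def by (rule avg_exp_stat[OF s \<theta>])
  finally show ?thesis .
qed

text \<open>Both samples are centred at the same constant, which cancels in their difference. By
  independence the exponential mean for each sign is at most (5/4)^2 \<le> 2, and the two signs
  together give the factor 4.\<close>

theorem tail_bound:
  assumes P: "prob_space P"
    and ind: "prob_space.indep_vars P (\<lambda>_. borel) (case_sum X X') ({1..n} <+> {1..n})"
    and law: "\<And>i. i \<in> {1..n} \<Longrightarrow> distr P borel (X i) = M"
    and law': "\<And>i. i \<in> {1..n} \<Longrightarrow> distr P borel (X' i) = M"
    and \<theta>: "0 \<le> \<theta>" "4 * A * (real p)\<^sup>2 * \<theta> \<le> 1 / 2"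
  shows "measure P {\<omega> \<in> space P. Z_stat n p \<phi> d (\<lambda>i. X i \<omega>) (\<lambda>i. X' i \<omega>) \<ge> t} \<le> 4 * exp (- (\<theta> * t))"
proof -
  interpret P: prob_space P by (rule P)
  let ?N = "{1..n}"
  have rv: "X i \<in> borel_measurable P" "X' i \<in> borel_measurable P" if "i \<in> ?N" for i
  proof -
    have "\<forall>j\<in>?N <+> ?N. case_sum X X' j \<in> borel_measurable P"
      using ind by (simp add: P.indep_vars_def)
    then show "X i \<in> borel_measurable P" "X' i \<in> borel_measurable P" using that by force+
  qed
  \<comment> \<open>The booleans index the two blocks of the sum type, so that the samples become an
    independent family with two members.\<close>
  define K where "K b = (if b then Inl ` ?N else Inr ` ?N)" for b
  have indX: "P.indep_vars (\<lambda>_. borel) X ?N"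
    using P.indep_vars_reindex[of Inl ?N "\<lambda>_. borel" "case_sum X X'"] P.indep_vars_subset[OF ind, of "Inl ` ?N"]
    by (auto simp: comp_def)
  have indX': "P.indep_vars (\<lambda>_. borel) X' ?N"
    using P.indep_vars_reindex[of Inr ?N "\<lambda>_. borel" "case_sum X X'"] P.indep_vars_subset[OF ind, of "Inr ` ?N"]
    by (auto simp: comp_def)
  fix x0 :: "nat \<Rightarrow> 'a"
  define c where "c = avg ?N stat x0"
  define Y where "Y \<omega> = stat (\<lambda>i\<in>?N. X i \<omega>)" for \<omega>
  define Y' where "Y' \<omega> = stat (\<lambda>i\<in>?N. X' i \<omega>)" for \<omega>
  have Z: "Z_stat n p \<phi> d (\<lambda>i. X i \<omega>) (\<lambda>i. X' i \<omega>) = \<bar>Y \<omega> - Y' \<omega>\<bar>" for \<omega>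
  proof -
    have "Y \<omega> = stat (\<lambda>i. X i \<omega>)" "Y' \<omega> = stat (\<lambda>i. X' i \<omega>)"
      unfolding Y_def Y'_def by (intro stat_cong; simp)+
    then show ?thesis
      by (simp add: Z_stat_def stat_def abs_mult flip: right_diff_distrib)
  qed
  have one: "integrable P (\<lambda>\<omega>. exp (\<theta> * (s * (Y \<omega> - Y' \<omega>))))
     \<and> (\<integral>\<omega>. exp (\<theta> * (s * (Y \<omega> - Y' \<omega>))) \<partial>P) \<le> 2" if s: "\<bar>s\<bar> = 1" for s
  proof -
    define H where "H b y = (if b then exp (\<theta> * (s * (stat (\<lambda>i\<in>?N. y (Inl i)) - c)))
        else exp (\<theta> * (- s * (stat (\<lambda>i\<in>?N. y (Inr i)) - c))))" for b :: bool and y :: "nat + nat \<Rightarrow> 'a"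
    have I1: "P.indep_vars (\<lambda>b. Pi\<^sub>M (K b) (\<lambda>_. borel)) (\<lambda>b \<omega>. restrict (\<lambda>i. case_sum X X' i \<omega>) (K b)) UNIV"
      by (rule P.indep_vars_restrict[OF ind]) (auto simp: K_def disjoint_family_on_def)
    have mg: "(\<lambda>z. exp (\<theta> * (s * (stat z - c)))) \<in> borel_measurable (Pi\<^sub>M ?N (\<lambda>_. borel))" for s
    proof -
      have b: "bdd_meas (\<lambda>z. exp (\<theta> * (s * (stat z - c))))" by (intro bdd_meas_intros bdd_meas_stat)
      have ov: "stat (override_on x0 z ?N) = stat z" for z by (intro stat_cong) simp
      have eq: "sets (Pi\<^sub>M ?N (\<lambda>_. M)) = sets (Pi\<^sub>M ?N (\<lambda>_. borel))"
        by (intro sets_PiM_cong) (auto simp: sets_M)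
      show ?thesis
        using bdd_meas_override[OF b, of x0 ?N] unfolding ov measurable_cong_sets[OF eq refl] .
    qed
    have HT: "(\<lambda>y. exp (\<theta> * (s * (stat (\<lambda>i\<in>?N. y (f i)) - c)))) \<in> borel_measurable (Pi\<^sub>M (f ` ?N) (\<lambda>_. borel))"
      for f :: "nat \<Rightarrow> nat + nat" and s
      by (rule measurable_compose[OF measurable_restrict mg]) (auto intro: measurable_component_singleton)
    have "P.indep_vars (\<lambda>_. borel) (\<lambda>b \<omega>. H b (restrict (\<lambda>i. case_sum X X' i \<omega>) (K b))) UNIV"
    proof (rule P.indep_vars_compose2[OF I1])
      show "H b \<in> borel_measurable (Pi\<^sub>M (K b) (\<lambda>_. borel))" for b
        using HT[of s Inl] HT[of "-s" Inr] unfolding H_def K_def by (cases b) auto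
    qed
    moreover have HK: "H b (restrict (\<lambda>i. case_sum X X' i \<omega>) (K b)) =
        (if b then exp (\<theta> * (s * (Y \<omega> - c))) else exp (\<theta> * (- s * (Y' \<omega> - c))))" for b \<omega>
      unfolding H_def K_def Y_def Y'_def by (auto intro!: arg_cong[where f = stat] simp: fun_eq_iff)
    ultimately have I2: "P.indep_vars (\<lambda>_. borel)
        (\<lambda>b \<omega>. if b then exp (\<theta> * (s * (Y \<omega> - c))) else exp (\<theta> * (- s * (Y' \<omega> - c)))) UNIV"
      by simp
    obtain B where B: "\<And>y. \<bar>stat y\<bar> \<le> B" using bdd_meas_bound[OF bdd_meas_stat] by blast
    have bexp: "\<bar>exp (\<theta> * (s * (stat y - c)))\<bar> \<le> exp (\<theta> * (B + \<bar>c\<bar>))" if "\<bar>s\<bar> = 1" for s y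
    proof -
      have "s * (stat y - c) \<le> \<bar>s\<bar> * \<bar>stat y - c\<bar>" by (simp flip: abs_mult)
      also have "\<dots> \<le> B + \<bar>c\<bar>" using B[of y] that by simp
      finally show ?thesis using \<theta> by (simp add: mult_left_mono)
    qed
    have mY: "(\<lambda>\<omega>. exp (\<theta> * (s * (Y \<omega> - c)))) \<in> borel_measurable P"
      "(\<lambda>\<omega>. exp (\<theta> * (s * (Y' \<omega> - c)))) \<in> borel_measurable P" for s
      unfolding Y_def Y'_def by (intro measurable_compose[OF measurable_restrict mg] rv; assumption)+
    have iY: "integrable P (\<lambda>\<omega>. exp (\<theta> * (s * (Y \<omega> - c))))"
       "integrable P (\<lambda>\<omega>. exp (\<theta> * (s * (Y' \<omega> - c))))" if "\<bar>s\<bar> = 1" for s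
    proof -
      show "integrable P (\<lambda>\<omega>. exp (\<theta> * (s * (Y \<omega> - c))))"
        by (rule P.integrable_const_bound[where B = "exp (\<theta> * (B + \<bar>c\<bar>))", OF _ mY(1)]) (use bexp[OF that] in \<open>simp add: Y_def\<close>)
      show "integrable P (\<lambda>\<omega>. exp (\<theta> * (s * (Y' \<omega> - c))))"
        by (rule P.integrable_const_bound[where B = "exp (\<theta> * (B + \<bar>c\<bar>))", OF _ mY(2)]) (use bexp[OF that] in \<open>simp add: Y'_def\<close>)
    qed
    have iI: "integrable P (\<lambda>\<omega>. if b then exp (\<theta> * (s * (Y \<omega> - c))) else exp (\<theta> * (- s * (Y' \<omega> - c))))" for b
      using iY(1)[of s] iY(2)[of "-s"] s by (cases b) auto
    have e: "exp (\<theta> * (s * (Y \<omega> - Y' \<omega>))) =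
        (\<Prod>b\<in>UNIV. if b then exp (\<theta> * (s * (Y \<omega> - c))) else exp (\<theta> * (- s * (Y' \<omega> - c))))" for \<omega>
      by (simp add: UNIV_bool exp_add[symmetric] algebra_simps)
    have "(\<integral>\<omega>. exp (\<theta> * (s * (Y \<omega> - Y' \<omega>))) \<partial>P) =
        (\<integral>\<omega>. exp (\<theta> * (s * (Y \<omega> - c))) \<partial>P) * (\<integral>\<omega>. exp (\<theta> * (- s * (Y' \<omega> - c))) \<partial>P)"
      unfolding e using P.indep_vars_lebesgue_integral[OF _ I2 iI] by (simp add: UNIV_bool mult.commute)
    also have "\<dots> \<le> (5 / 4) * (5 / 4)"
      unfolding Y_def Y'_def c_def
      by (intro mult_mono expectation_exp_stat[OF P indX law s \<theta>] expectation_exp_stat[OF P indX' law' _ \<theta>]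
          integral_nonneg_AE) (use s in auto)
    finally have "(\<integral>\<omega>. exp (\<theta> * (s * (Y \<omega> - Y' \<omega>))) \<partial>P) \<le> 2" by simp
    moreover have "integrable P (\<lambda>\<omega>. exp (\<theta> * (s * (Y \<omega> - Y' \<omega>))))"
      unfolding e using P.indep_vars_integrable[OF _ I2 iI] by simp
    ultimately show ?thesis by simp
  qed
  define Q where "Q s = {\<omega> \<in> space P. exp (\<theta> * (s * (Y \<omega> - Y' \<omega>))) \<ge> exp (\<theta> * t)}" for s
  have meas: "Q s \<in> sets P" if "\<bar>s\<bar> = 1" for s
  proof -
    note [measurable] = borel_measurable_integrable[OF conjunct1[OF one[OF that]]]
    show ?thesis unfolding Q_def by measurable
  qed
  have Q: "measure P (Q s) \<le> 2 * exp (- (\<theta> * t))" if "\<bar>s\<bar> = 1" for s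
  proof -
    have "measure P (Q s) \<le> (\<integral>\<omega>. exp (\<theta> * (s * (Y \<omega> - Y' \<omega>))) \<partial>P) / exp (\<theta> * t)"
      unfolding Q_def using one[OF that] by (intro integral_Markov_inequality_measure[where A = "{}"]) auto
    also have "\<dots> \<le> 2 / exp (\<theta> * t)" using one[OF that] by (intro divide_right_mono) auto
    finally show ?thesis by (simp add: exp_minus divide_inverse)
  qed
  have "{\<omega> \<in> space P. Z_stat n p \<phi> d (\<lambda>i. X i \<omega>) (\<lambda>i. X' i \<omega>) \<ge> t} \<subseteq> Q 1 \<union> Q (-1)"
  proof
    fix \<omega> assume "\<omega> \<in> {\<omega> \<in> space P. Z_stat n p \<phi> d (\<lambda>i. X i \<omega>) (\<lambda>i. X' i \<omega>) \<ge> t}"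
    then have "\<omega> \<in> space P" "t \<le> Y \<omega> - Y' \<omega> \<or> t \<le> - 1 * (Y \<omega> - Y' \<omega>)" by (auto simp: Z)
    then show "\<omega> \<in> Q 1 \<union> Q (-1)" using \<theta> by (auto simp: Q_def intro!: mult_left_mono)
  qed
  then have "measure P {\<omega> \<in> space P. Z_stat n p \<phi> d (\<lambda>i. X i \<omega>) (\<lambda>i. X' i \<omega>) \<ge> t} \<le> measure P (Q 1 \<union> Q (-1))"
    using meas by (intro P.finite_measure_mono) auto
  also have "\<dots> \<le> measure P (Q 1) + measure P (Q (-1))" using meas by (intro measure_Un_le) auto
  also have "\<dots> \<le> 4 * exp (- (\<theta> * t))" using Q[of 1] Q[of "-1"] by simp
  finally show ?thesis .
qed

end

section \<open>Tangent lengths, speed and regularity of curves\<close>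

section \<open>Curves and the geodesic distance\<close>

lemma breakpoint_mono:
  fixes \<tau> :: "nat \<Rightarrow> real"
  assumes "\<And>i. i < k \<Longrightarrow> \<tau> i < \<tau> (Suc i)" and "i \<le> j" "j \<le> k"
  shows "\<tau> i \<le> \<tau> j"
  using assms(2,3)
proof (induction j rule: dec_induct)
  case (step j)
  then show ?case using assms(1)[of j] by simp
qed simp

abbreviation inv_chart :: "('a, 'n::finite) chart \<Rightarrow> real ^ 'n \<Rightarrow> 'a" where
  "inv_chart c \<equiv> inv_into (fst c) (snd c)"

locale riemannian_manifold =
  fixes \<A> :: "('a::{t2_space,second_countable_topology}, 'n::finite) chart set"
    and g :: "('a, 'n) chart \<Rightarrow> 'a \<Rightarrow> real ^ 'n ^ 'n"
  assumes manifold: "compact_riemannian_manifold \<A> g"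
begin

lemma chart:
  assumes "c \<in> \<A>"
  shows "open (fst c)" "open (snd c ` fst c)" "inj_on (snd c) (fst c)"
    "continuous_on (fst c) (snd c)" "continuous_on (snd c ` fst c) (inv_chart c)"
proof -
  have "is_chart c" using assms manifold by (auto simp: compact_riemannian_manifold_def smooth_atlas_def)
  then have *: "open (fst c)" "open (snd c ` fst c)"
      "homeomorphism (fst c) (snd c ` fst c) (snd c) (inv_chart c)"
    by (auto simp: is_chart_def case_prod_beta)
  show "open (fst c)" "open (snd c ` fst c)" by fact+
  show "inj_on (snd c) (fst c)" "continuous_on (fst c) (snd c)"
    "continuous_on (snd c ` fst c) (inv_chart c)"
    using *(3) by (auto simp: homeomorphism_def intro: inj_on_inverseI)
qed

lemma chart_at: obtains c where "c \<in> \<A>" "x \<in> fst c"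
proof -
  have "(\<Union>c\<in>\<A>. fst c) = UNIV"
    using manifold unfolding compact_riemannian_manifold_def smooth_atlas_def by blast
  then show ?thesis using that by blast
qed

lemma transition_has_derivative:
  assumes "c \<in> \<A>" "c' \<in> \<A>" "x \<in> fst c" "x \<in> fst c'"
  shows "(transition c c' has_derivative frechet_derivative (transition c c') (at (snd c x))) (at (snd c x))"
proof -
  have "smooth_on (snd c ` (fst c \<inter> fst c')) (transition c c')"
    using assms manifold by (auto simp: compact_riemannian_manifold_def smooth_atlas_def)
  then have "Ck_on (Suc 0) (snd c ` (fst c \<inter> fst c')) (transition c c')"
    unfolding smooth_on_def by blast
  then show ?thesis using assms by (auto simp: frechet_derivative_works)
qed

lemma metric_continuous: "c \<in> \<A> \<Longrightarrow> continuous_on (fst c) (g c)"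
proof -
  assume c: "c \<in> \<A>"
  then have "smooth_on (snd c ` fst c) (\<lambda>y. g c (inv_chart c y))"
    using manifold by (auto simp: compact_riemannian_manifold_def riemannian_metric_def)
  then have "Ck_on 0 (snd c ` fst c) (\<lambda>y. g c (inv_chart c y))"
    unfolding smooth_on_def by blast
  then have "continuous_on (snd c ` fst c) (\<lambda>y. g c (inv_chart c y))" by simp
  from continuous_on_compose2[OF this chart(4)[OF c]]
  have "continuous_on (fst c) (\<lambda>x. g c (inv_chart c (snd c x)))" by simp
  then show ?thesis
    by (rule continuous_on_eq) (simp add: inv_into_f_f chart(3)[OF c])
qed

text \<open>The squared Riemannian length of the tangent vector with coordinates
  \<open>v\<close>.\<close>

definition quad :: "('a, 'n) chart \<Rightarrow> 'a \<Rightarrow> real ^ 'n \<Rightarrow> real" where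
  "quad c x v = v \<bullet> (g c x *v v)"

lemma quad_pos: "c \<in> \<A> \<Longrightarrow> x \<in> fst c \<Longrightarrow> v \<noteq> 0 \<Longrightarrow> quad c x v > 0"
  using manifold by (auto simp: quad_def compact_riemannian_manifold_def riemannian_metric_def)

lemma quad_nonneg: "c \<in> \<A> \<Longrightarrow> x \<in> fst c \<Longrightarrow> quad c x v \<ge> 0"
  using quad_pos[of c x v] by (cases "v = 0") (auto simp: quad_def)

text \<open>The transformation rule of the metric tensor, read as invariance of tangent lengths
  under a change of chart.\<close>

lemma quad_transition:
  assumes "c \<in> \<A>" "c' \<in> \<A>" "x \<in> fst c" "x \<in> fst c'"
  shows "quad c' x (frechet_derivative (transition c c') (at (snd c x)) v) = quad c x v"
proof -
  define F where "F = frechet_derivative (transition c c') (at (snd c x))"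
  have "linear F" using transition_has_derivative[OF assms] has_derivative_linear unfolding F_def by blast
  then have F: "F v = matrix F *v v" by (simp add: matrix_works)
  have "g c x = transpose (matrix F) ** g c' x ** matrix F"
    using assms manifold unfolding F_def Let_def compact_riemannian_manifold_def riemannian_metric_def
    by (metis IntI)
  then have "quad c x v = v \<bullet> (transpose (matrix F) *v (g c' x *v (matrix F *v v)))"
    by (simp add: quad_def matrix_vector_mul_assoc matrix_mul_assoc)
  also have "\<dots> = (matrix F *v v) \<bullet> (g c' x *v (matrix F *v v))"
    by (metis dot_lmul_matrix inner_commute transpose_matrix_vector)
  finally show ?thesis by (simp add: quad_def F flip: F_def)
qed

lemma continuous_on_quad:
  assumes "c \<in> \<A>" "continuous_on S \<gamma>" "\<gamma> ` S \<subseteq> fst c" "continuous_on S D"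
  shows "continuous_on S (\<lambda>t. quad c (\<gamma> t) (D t))"
proof -
  have "continuous_on S (\<lambda>t. g c (\<gamma> t))"
    using continuous_on_compose2[OF metric_continuous assms(2)] assms by blast
  then show ?thesis
    unfolding quad_def matrix_vector_mult_def
    by (auto intro!: continuous_intros continuous_on_inner assms(4) continuous_on_vec_lambda)
qed

text \<open>At a break point the derivative within \<open>{0..1}\<close> need not exist. Relative to
  a single smooth piece \<open>I\<close> the one-sided derivative does, and the speed is continuous
  up to the ends of the piece.\<close>

definition speed_in :: "real set \<Rightarrow> (real \<Rightarrow> 'a) \<Rightarrow> real \<Rightarrow> real" where
  "speed_in I \<gamma> t =
     (let c = (SOME c. c \<in> \<A> \<and> \<gamma> t \<in> fst c);
          v = vector_derivative (\<lambda>s. snd c (\<gamma> s)) (at t within I)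
      in sqrt (quad c (\<gamma> t) v))"

lemma curve_speed_eq: "curve_speed \<A> g \<gamma> = speed_in {0..1} \<gamma>"
  by (simp add: fun_eq_iff curve_speed_def speed_in_def quad_def)

lemma some_chart: "(SOME c. c \<in> \<A> \<and> x \<in> fst c) \<in> \<A> \<and> x \<in> fst (SOME c. c \<in> \<A> \<and> x \<in> fst c)"
  by (rule someI_ex) (metis chart_at)

lemma openin_chart_preimage:
  assumes "c \<in> \<A>" "continuous_on I \<gamma>"
  obtains V where "open V" "{t \<in> I. \<gamma> t \<in> fst c} = I \<inter> V"
proof -
  obtain V where "open V" "V \<inter> I = \<gamma> -` fst c \<inter> I"
    using assms(2) chart(1)[OF assms(1)] unfolding continuous_on_open_invariant by blast
  then show ?thesis by (intro that[of V]) auto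
qed

lemma derivative_change_chart:
  assumes c: "c \<in> \<A>" "c' \<in> \<A>" and \<gamma>: "continuous_on I \<gamma>" "t \<in> I" "\<gamma> t \<in> fst c" "\<gamma> t \<in> fst c'"
    and v: "((\<lambda>s. snd c (\<gamma> s)) has_vector_derivative v) (at t within I)"
  shows "((\<lambda>s. snd c' (\<gamma> s)) has_vector_derivative
           frechet_derivative (transition c c') (at (snd c (\<gamma> t))) v) (at t within I)"
proof -
  let ?F = "frechet_derivative (transition c c') (at (snd c (\<gamma> t)))"
  have d: "(transition c c' has_derivative ?F) (at (snd c (\<gamma> t)))"
    using transition_has_derivative[OF c \<gamma>(3,4)] .
  obtain V where V: "open V" "{t \<in> I. \<gamma> t \<in> fst c} = I \<inter> V"
    using openin_chart_preimage[OF c(1) \<gamma>(1)] .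
  then have "t \<in> V" using \<gamma> by blast
  then obtain e where e: "e > 0" "ball t e \<subseteq> V" using V(1) open_contains_ball by blast
  have "(transition c c' \<circ> (\<lambda>s. snd c (\<gamma> s)) has_derivative ?F \<circ> (\<lambda>h. h *\<^sub>R v)) (at t within I)"
    using v d has_derivative_at_withinI unfolding has_vector_derivative_def
    by (intro diff_chain_within) auto
  then have "(transition c c' \<circ> (\<lambda>s. snd c (\<gamma> s)) has_vector_derivative ?F v) (at t within I)"
    unfolding has_vector_derivative_def using linear_cmul[OF has_derivative_linear[OF d]]
    by (simp add: comp_def)
  then show ?thesis
  proof (rule has_vector_derivative_transform_within[OF _ e(1)])
    fix s assume "s \<in> I" "dist s t < e"
    then have "s \<in> I \<inter> V" using e(2) by (auto simp: dist_commute)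
    then have "\<gamma> s \<in> fst c" using V(2) by blast
    then show "(transition c c' \<circ> (\<lambda>s. snd c (\<gamma> s))) s = snd c' (\<gamma> s)"
      by (simp add: transition_def inv_into_f_f chart(3)[OF c(1)])
  qed (use \<gamma> in auto)
qed

lemma speed_in_eq:
  assumes I: "a < b" and \<gamma>: "continuous_on {a..b} \<gamma>" "t \<in> {a..b}" and c: "c \<in> \<A>" "\<gamma> t \<in> fst c"
    and v: "((\<lambda>s. snd c (\<gamma> s)) has_vector_derivative v) (at t within {a..b})"
  shows "speed_in {a..b} \<gamma> t = sqrt (quad c (\<gamma> t) v)"
proof -
  define c' where "c' = (SOME c. c \<in> \<A> \<and> \<gamma> t \<in> fst c)"
  have c': "c' \<in> \<A>" "\<gamma> t \<in> fst c'" using some_chart[of "\<gamma> t"] by (auto simp: c'_def)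
  let ?w = "frechet_derivative (transition c c') (at (snd c (\<gamma> t))) v"
  have "((\<lambda>s. snd c' (\<gamma> s)) has_vector_derivative ?w) (at t within {a..b})"
    by (rule derivative_change_chart) (use c c' \<gamma> v in auto)
  then have "vector_derivative (\<lambda>s. snd c' (\<gamma> s)) (at t within {a..b}) = ?w"
    using vector_derivative_within_cbox[of a b t] I \<gamma>(2) by simp
  then show ?thesis
    using quad_transition[OF c(1) c'(1) c(2) c'(2)] by (simp add: speed_in_def Let_def flip: c'_def)
qed

lemma continuous_on_speed_in:
  assumes I: "a < b" and \<gamma>: "continuous_on {a..b} \<gamma>" and C1: "C1_curve_on \<A> {a..b} \<gamma>"
  shows "continuous_on {a..b} (speed_in {a..b} \<gamma>)"
  unfolding continuous_on_eq_continuous_within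
proof
  fix t assume t: "t \<in> {a..b}"
  obtain c where c: "c \<in> \<A>" "\<gamma> t \<in> fst c" by (rule chart_at)
  define S where "S = {t \<in> {a..b}. \<gamma> t \<in> fst c}"
  obtain D where D: "continuous_on S D" "\<And>t. t \<in> S \<Longrightarrow>
      ((\<lambda>s. snd c (\<gamma> s)) has_vector_derivative D t) (at t within {a..b})"
  proof -
    from C1 c(1) obtain D where "continuous_on S D \<and> (\<forall>t\<in>{a..b}. \<gamma> t \<in> fst c \<longrightarrow>
      ((\<lambda>s. snd c (\<gamma> s)) has_vector_derivative D t) (at t within {a..b}))"
      unfolding C1_curve_on_def S_def by blast
    then show ?thesis by (intro that[of D]) (auto simp: S_def)
  qed
  have S: "continuous_on S \<gamma>" by (rule continuous_on_subset[OF \<gamma>]) (auto simp: S_def)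
  have "continuous_on S (\<lambda>t. sqrt (quad c (\<gamma> t) (D t)))"
    by (intro continuous_intros continuous_on_quad c(1) S D) (auto simp: S_def)
  then have "continuous_on S (speed_in {a..b} \<gamma>)"
    by (rule continuous_on_eq, intro speed_in_eq[symmetric] I \<gamma> c(1) D(2)) (auto simp: S_def)
  then have cont: "continuous (at t within S) (speed_in {a..b} \<gamma>)"
    using t c by (auto simp: continuous_on_eq_continuous_within S_def)
  obtain V where V: "open V" "S = {a..b} \<inter> V"
    using openin_chart_preimage[OF c(1) \<gamma>] unfolding S_def by metis
  \<comment> \<open>\<open>S\<close> is relatively open in the interval, so continuity within
    \<open>S\<close> is continuity within the interval.\<close>
  have "at t within S = at t within {a..b}"
    by (rule at_within_nhd[of t V]) (use V t c in \<open>auto simp: S_def\<close>)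
  then show "continuous (at t within {a..b}) (speed_in {a..b} \<gamma>)" using cont by simp
qed

lemma curve_speed_interior:
  assumes ab: "0 \<le> a" "b \<le> 1" and \<gamma>: "continuous_on {0..1} \<gamma>" and C1: "C1_curve_on \<A> {a..b} \<gamma>"
    and t: "a < t" "t < b" and c: "c \<in> \<A>" "\<gamma> t \<in> fst c"
  obtains v where "((\<lambda>s. snd c (\<gamma> s)) has_vector_derivative v) (at t)"
    "curve_speed \<A> g \<gamma> t = sqrt (quad c (\<gamma> t) v)" "speed_in {a..b} \<gamma> t = sqrt (quad c (\<gamma> t) v)"
proof -
  obtain D where D: "\<forall>t\<in>{a..b}. \<gamma> t \<in> fst c \<longrightarrow>
      ((\<lambda>s. snd c (\<gamma> s)) has_vector_derivative D t) (at t within {a..b})"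
    using C1 c(1) unfolding C1_curve_on_def by blast
  then have v: "((\<lambda>s. snd c (\<gamma> s)) has_vector_derivative D t) (at t within {a..b})" using t c by auto
  moreover have "at t within {a..b} = at t" by (rule at_within_interior) (use t in auto)
  ultimately have v': "((\<lambda>s. snd c (\<gamma> s)) has_vector_derivative D t) (at t)" by simp
  have "continuous_on {a..b} \<gamma>" by (rule continuous_on_subset[OF \<gamma>]) (use ab in auto)
  then have "speed_in {a..b} \<gamma> t = sqrt (quad c (\<gamma> t) (D t))"
    using speed_in_eq[OF _ _ _ c v] t by auto
  moreover have "curve_speed \<A> g \<gamma> t = sqrt (quad c (\<gamma> t) (D t))"
    unfolding curve_speed_eq using t ab
    by (intro speed_in_eq \<gamma> c has_vector_derivative_at_within[OF v']) auto
  ultimately show ?thesis using that v' by blast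
qed

text \<open>Collects what the later length estimates use of piecewise regularity: integrability, and
  a formula for the speed off a finite set in whichever chart is convenient.\<close>

lemma piecewise_C1_curve_regular:
  assumes \<gamma>: "piecewise_C1_curve \<A> \<gamma>"
  obtains S where "finite S" "curve_speed \<A> g \<gamma> integrable_on {0..1}"
    "\<And>t c. t \<in> {0<..<1} - S \<Longrightarrow> c \<in> \<A> \<Longrightarrow> \<gamma> t \<in> fst c \<Longrightarrow>
      \<exists>v. ((\<lambda>s. snd c (\<gamma> s)) has_vector_derivative v) (at t) \<and> curve_speed \<A> g \<gamma> t = sqrt (quad c (\<gamma> t) v)"
proof -
  obtain k \<tau> where cont: "continuous_on {0..1} \<gamma>" and \<tau>: "\<tau> 0 = 0" "\<tau> k = (1::real)"
    and C1: "\<And>i. i < k \<Longrightarrow> \<tau> i < \<tau> (Suc i)" "\<And>i. i < k \<Longrightarrow> C1_curve_on \<A> {\<tau> i..\<tau> (Suc i)} \<gamma>"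
    using \<gamma> unfolding piecewise_C1_curve_def by blast
  note mono = breakpoint_mono[of k \<tau>, OF C1(1)]
  have range: "0 \<le> \<tau> i" "\<tau> i \<le> 1" if "i \<le> k" for i using mono[of 0 i] mono[of i k] that \<tau> by auto
  have sub: "{\<tau> i..\<tau> (Suc i)} \<subseteq> {0..1}" if "i < k" for i
    using range[of i] range[of "Suc i"] that by auto
  have int: "curve_speed \<A> g \<gamma> integrable_on {0..\<tau> i}" if "i \<le> k" for i
    using that
  proof (induction i)
    case 0
    then show ?case using \<tau> integrable_on_refl[of _ "0::real"] by simp
  next
    case (Suc i)
    then have i: "i < k" by simp
    have "continuous_on {\<tau> i..\<tau> (Suc i)} \<gamma>" using continuous_on_subset[OF cont sub[OF i]] .
    then have "speed_in {\<tau> i..\<tau> (Suc i)} \<gamma> integrable_on {\<tau> i..\<tau> (Suc i)}"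
      by (intro integrable_continuous_real continuous_on_speed_in C1 i)
    \<comment> \<open>The two notions of speed can differ only at the ends of the piece, and two
      points do not affect integrability.\<close>
    then have "curve_speed \<A> g \<gamma> integrable_on {\<tau> i..\<tau> (Suc i)}"
    proof (rule integrable_spike_finite[of "{\<tau> i, \<tau> (Suc i)}", rotated 2])
      fix t assume "t \<in> {\<tau> i..\<tau> (Suc i)} - {\<tau> i, \<tau> (Suc i)}"
      then have t: "\<tau> i < t" "t < \<tau> (Suc i)" by auto
      obtain c where c: "c \<in> \<A>" "\<gamma> t \<in> fst c" by (rule chart_at)
      show "curve_speed \<A> g \<gamma> t = speed_in {\<tau> i..\<tau> (Suc i)} \<gamma> t"
        using range[of i] range[of "Suc i"] i
        by (rule_tac curve_speed_interior[OF _ _ cont C1(2)[OF i] t c]) auto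
    qed simp
    then show ?case
      using Suc.IH i range[of i] C1(1)[OF i]
      by (intro Henstock_Kurzweil_Integration.integrable_combine[of 0 "\<tau> i" "\<tau> (Suc i)"]) auto
  qed
  have pieces: "\<exists>i<k. \<tau> i < t \<and> t < \<tau> (Suc i)" if "t \<in> {0<..<1} - \<tau> ` {..k}" for t
  proof -
    \<comment> \<open>The first break point beyond \<open>t\<close> closes the piece containing
      \<open>t\<close>; its index is not 0 because \<open>\<tau> 0\<close> is 0.\<close>
    define i where "i = (LEAST i. t < \<tau> i)"
    have "t < \<tau> k" using that \<tau> by auto
    then have i: "t < \<tau> i" "i \<le> k" unfolding i_def by (auto intro: LeastI Least_le)
    have "i \<noteq> 0" using i(1) that \<tau> by (cases "i = 0") auto
    then obtain i' where i': "i = Suc i'" by (cases i) auto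
    have "\<not> t < \<tau> i'" using i' not_less_Least[of i' "\<lambda>i. t < \<tau> i"] by (simp add: i_def[symmetric])
    moreover have "t \<noteq> \<tau> i'" using that i' i(2) by auto
    ultimately show ?thesis using i i' by (intro exI[of _ i']) auto
  qed
  show ?thesis
  proof (rule that[of "\<tau> ` {..k}"])
    show "curve_speed \<A> g \<gamma> integrable_on {0..1}" using int[of k] \<tau> by simp
    fix t c assume t: "t \<in> {0<..<1} - \<tau> ` {..k}" and c: "c \<in> \<A>" "\<gamma> t \<in> fst c"
    obtain i where i: "i < k" "\<tau> i < t" "t < \<tau> (Suc i)" using pieces[OF t] by blast
    have "0 \<le> \<tau> i" "\<tau> (Suc i) \<le> 1" using range i(1) by auto
    from curve_speed_interior[OF this cont C1(2)[OF i(1)] i(2,3) c]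
    show "\<exists>v. ((\<lambda>s. snd c (\<gamma> s)) has_vector_derivative v) (at t) \<and> curve_speed \<A> g \<gamma> t = sqrt (quad c (\<gamma> t) v)"
      by metis
  qed simp
qed

lemma curve_speed_nonneg: "curve_speed \<A> g \<gamma> t \<ge> 0"
  unfolding curve_speed_eq speed_in_def Let_def using some_chart[of "\<gamma> t"] by (simp add: quad_nonneg)

text \<open>Here \<open>\<gamma>\<close> is arbitrary: a speed that is not integrable has integral 0
  by convention.\<close>

lemma curve_length_nonneg: "curve_length \<A> g \<gamma> \<ge> 0"
  unfolding curve_length_def
  by (cases "curve_speed \<A> g \<gamma> integrable_on {0..1}")
    (auto intro: Henstock_Kurzweil_Integration.integral_nonneg curve_speed_nonneg simp: not_integrable_integral)

section \<open>Reparametrisation, reversal, concatenation and chart segments\<close>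

lemma C1_curve_on_affine:
  assumes C1: "C1_curve_on \<A> I \<gamma>" and sub: "\<And>t. t \<in> J \<Longrightarrow> m * t + b \<in> I"
    and eq: "\<And>t. t \<in> J \<Longrightarrow> \<gamma>' t = \<gamma> (m * t + b)"
  shows "C1_curve_on \<A> J \<gamma>'"
  unfolding C1_curve_on_def
proof
  fix c assume c: "c \<in> \<A>"
  obtain D where D: "continuous_on {t \<in> I. \<gamma> t \<in> fst c} D" "\<And>t. t \<in> I \<Longrightarrow> \<gamma> t \<in> fst c \<Longrightarrow>
      ((\<lambda>s. snd c (\<gamma> s)) has_vector_derivative D t) (at t within I)"
    using C1 c unfolding C1_curve_on_def by blast
  have "continuous_on {t \<in> J. \<gamma>' t \<in> fst c} (\<lambda>t. m *\<^sub>R D (m * t + b))"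
    by (intro continuous_intros continuous_on_compose2[OF D(1)]) (auto simp: sub eq)
  moreover have "((\<lambda>s. snd c (\<gamma>' s)) has_vector_derivative m *\<^sub>R D (m * t + b)) (at t within J)"
    if t: "t \<in> J" "\<gamma>' t \<in> fst c" for t
  proof -
    have "((\<lambda>s. snd c (\<gamma> s)) has_vector_derivative D (m * t + b)) (at (m * t + b) within (\<lambda>t. m * t + b) ` J)"
      by (rule has_vector_derivative_within_subset[OF D(2)]) (use t sub eq in auto)
    moreover have "((\<lambda>t. m * t + b) has_vector_derivative m) (at t within J)"
      by (auto intro!: derivative_eq_intros)
    ultimately have "((\<lambda>s. snd c (\<gamma> s)) \<circ> (\<lambda>t. m * t + b) has_vector_derivative m *\<^sub>R D (m * t + b)) (at t within J)"
      by (intro vector_diff_chain_within)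
    then show ?thesis
      by (rule has_vector_derivative_transform[OF t(1), rotated]) (simp add: eq)
  qed
  ultimately show "\<exists>D. continuous_on {t \<in> J. \<gamma>' t \<in> fst c} D \<and> (\<forall>t\<in>J. \<gamma>' t \<in> fst c \<longrightarrow>
      ((\<lambda>s. snd c (\<gamma>' s)) has_vector_derivative D t) (at t within J))" by blast
qed

text \<open>The factor \<open>\<bar>m\<bar>\<close> in the speed cancels against the change of
  variables. Reversal uses \<open>m = -1\<close>, and both halves of a concatenation use
  \<open>m = 2\<close>.\<close>

lemma curve_speed_has_integral_affine:
  assumes \<gamma>: "piecewise_C1_curve \<A> \<gamma>" and \<gamma>1: "piecewise_C1_curve \<A> \<gamma>1"
    and ab: "0 \<le> a" "a < b" "b \<le> 1" and m: "m \<noteq> 0" "(\<lambda>t. m * t + q) ` {a..b} = {0..1}"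
    and eq: "\<And>t. t \<in> {a..b} \<Longrightarrow> \<gamma> t = \<gamma>1 (m * t + q)"
  shows "(curve_speed \<A> g \<gamma> has_integral curve_length \<A> g \<gamma>1) {a..b}"
proof -
  obtain S where S: "finite S" "\<And>t c. t \<in> {0<..<1} - S \<Longrightarrow> c \<in> \<A> \<Longrightarrow> \<gamma> t \<in> fst c \<Longrightarrow>
      \<exists>v. ((\<lambda>s. snd c (\<gamma> s)) has_vector_derivative v) (at t) \<and> curve_speed \<A> g \<gamma> t = sqrt (quad c (\<gamma> t) v)"
    by (rule piecewise_C1_curve_regular[OF \<gamma>]) blast
  obtain S1 where S1: "finite S1" "curve_speed \<A> g \<gamma>1 integrable_on {0..1}"
    "\<And>t c. t \<in> {0<..<1} - S1 \<Longrightarrow> c \<in> \<A> \<Longrightarrow> \<gamma>1 t \<in> fst c \<Longrightarrow>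
      \<exists>v. ((\<lambda>s. snd c (\<gamma>1 s)) has_vector_derivative v) (at t) \<and> curve_speed \<A> g \<gamma>1 t = sqrt (quad c (\<gamma>1 t) v)"
    by (rule piecewise_C1_curve_regular[OF \<gamma>1]) blast
  have "(curve_speed \<A> g \<gamma>1 has_integral curve_length \<A> g \<gamma>1) (cbox 0 1)"
    unfolding curve_length_def using S1(2) by (simp add: has_integral_integral)
  from has_integral_affinity[OF this m(1), of q]
  have "((\<lambda>t. curve_speed \<A> g \<gamma>1 (m * t + q)) has_integral curve_length \<A> g \<gamma>1 / \<bar>m\<bar>)
      ((\<lambda>x. (1 / m) * x - (1 / m) * q) ` {0..1})" by (simp add: divide_inverse mult.commute)
  moreover have "(\<lambda>x. (1 / m) * x - (1 / m) * q) ` {0..1} = {a..b}"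
    unfolding m(2)[symmetric] image_image using m(1) by (simp add: field_simps)
  ultimately have "((\<lambda>t. \<bar>m\<bar> * curve_speed \<A> g \<gamma>1 (m * t + q)) has_integral \<bar>m\<bar> * (curve_length \<A> g \<gamma>1 / \<bar>m\<bar>)) {a..b}"
    by (intro has_integral_mult_right) simp
  then have int: "((\<lambda>t. \<bar>m\<bar> * curve_speed \<A> g \<gamma>1 (m * t + q)) has_integral curve_length \<A> g \<gamma>1) {a..b}"
    using m(1) by simp
  \<comment> \<open>The exceptional times: those of \<open>\<gamma>\<close>, the preimages of those
    of \<open>\<gamma>1\<close> and of its end points, and the ends of the interval.\<close>
  define N where "N = S \<union> (\<lambda>t. (t - q) / m) ` (S1 \<union> {0, 1}) \<union> {a, b}"
  have "finite N" using S(1) S1(1) by (simp add: N_def)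
  then show ?thesis
  proof (rule has_integral_spike_finite[OF _ _ int])
    fix t assume t: "t \<in> {a..b} - N"
    define u where "u = m * t + q"
    have tu: "t = (u - q) / m" using m(1) by (simp add: u_def)
    have "u \<notin> S1 \<union> {0, 1}" using t tu unfolding N_def by blast
    moreover have "u \<in> {0..1}" using t m(2) unfolding u_def by blast
    ultimately have u: "u \<in> {0<..<1} - S1" by auto
    have tab: "t \<in> {a<..<b}" and tS: "t \<in> {0<..<1} - S" using t ab unfolding N_def by auto
    obtain c where c: "c \<in> \<A>" "\<gamma> t \<in> fst c" by (rule chart_at)
    have \<gamma>u: "\<gamma> t = \<gamma>1 u" using eq t by (simp add: u_def)
    obtain v where v: "((\<lambda>s. snd c (\<gamma> s)) has_vector_derivative v) (at t)" "curve_speed \<A> g \<gamma> t = sqrt (quad c (\<gamma> t) v)"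
      using S(2)[OF tS c] by blast
    obtain w where w: "((\<lambda>s. snd c (\<gamma>1 s)) has_vector_derivative w) (at u)" "curve_speed \<A> g \<gamma>1 u = sqrt (quad c (\<gamma>1 u) w)"
      using S1(3)[OF u c(1)] c(2) \<gamma>u by auto
    have "((\<lambda>t. m * t + q) has_vector_derivative m) (at t)"
      by (auto intro!: derivative_eq_intros)
    then have "((\<lambda>s. snd c (\<gamma>1 s)) \<circ> (\<lambda>t. m * t + q) has_vector_derivative m *\<^sub>R w) (at t)"
      using w(1) unfolding u_def by (intro vector_diff_chain_at)
    then have "((\<lambda>s. snd c (\<gamma> s)) has_vector_derivative m *\<^sub>R w) (at t)"
      by (rule has_vector_derivative_transform_within_open[of _ _ _ "{a<..<b}"]) (use tab eq in auto)
    then have "v = m *\<^sub>R w" using v(1) vector_derivative_unique_at by blast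
    then have "quad c (\<gamma> t) v = m\<^sup>2 * quad c (\<gamma>1 u) w"
      by (simp add: quad_def \<gamma>u matrix_vector_mult_scaleR power2_eq_square)
    then show "curve_speed \<A> g \<gamma> t = \<bar>m\<bar> * curve_speed \<A> g \<gamma>1 (m * t + q)"
      using v(2) w(2) by (simp add: real_sqrt_mult u_def)
  qed
qed

lemma piecewise_C1_curve_reverse:
  assumes \<gamma>: "piecewise_C1_curve \<A> \<gamma>"
  shows "piecewise_C1_curve \<A> (\<lambda>t. \<gamma> (1 - t))"
    and "curve_length \<A> g (\<lambda>t. \<gamma> (1 - t)) = curve_length \<A> g \<gamma>"
proof -
  obtain k \<tau> where cont: "continuous_on {0..1} \<gamma>" and \<tau>: "\<tau> 0 = 0" "\<tau> k = (1::real)"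
    and C1: "\<And>i. i < k \<Longrightarrow> \<tau> i < \<tau> (Suc i)" "\<And>i. i < k \<Longrightarrow> C1_curve_on \<A> {\<tau> i..\<tau> (Suc i)} \<gamma>"
    using \<gamma> unfolding piecewise_C1_curve_def by blast
  define \<sigma> where "\<sigma> i = 1 - \<tau> (k - i)" for i
  have "\<sigma> i < \<sigma> (Suc i) \<and> C1_curve_on \<A> {\<sigma> i..\<sigma> (Suc i)} (\<lambda>t. \<gamma> (1 - t))" if "i < k" for i
  proof -
    have e: "k - i = Suc (k - Suc i)" using that by simp
    have j: "k - Suc i < k" using that by simp
    show ?thesis
      unfolding \<sigma>_def e
      by (intro conjI C1_curve_on_affine[OF C1(2)[OF j], of _ "-1" 1]) (use C1(1)[OF j] in auto)
  qed
  moreover have "continuous_on {0..1} (\<lambda>t. \<gamma> (1 - t))"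
    by (intro continuous_on_compose2[OF cont] continuous_intros) auto
  ultimately show *: "piecewise_C1_curve \<A> (\<lambda>t. \<gamma> (1 - t))"
    unfolding piecewise_C1_curve_def using \<tau>
    by (intro conjI exI[of _ k] exI[of _ \<sigma>]) (auto simp: \<sigma>_def)
  have "(\<lambda>t::real. -1 * t + 1) ` {0..1} = {0..1}"
    using image_affinity_atLeastAtMost[of "-1::real" 1 0 1] by simp
  from curve_speed_has_integral_affine[OF * \<gamma> _ _ _ _ this]
  show "curve_length \<A> g (\<lambda>t. \<gamma> (1 - t)) = curve_length \<A> g \<gamma>"
    unfolding curve_length_def[of _ _ "\<lambda>t. \<gamma> (1 - t)"] by (intro integral_unique) auto
qed

lemma piecewise_C1_curve_join:
  assumes \<gamma>1: "piecewise_C1_curve \<A> \<gamma>1" and \<gamma>2: "piecewise_C1_curve \<A> \<gamma>2" and j: "\<gamma>1 1 = \<gamma>2 0"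
  shows "piecewise_C1_curve \<A> (\<gamma>1 +++ \<gamma>2)"
    and "curve_length \<A> g (\<gamma>1 +++ \<gamma>2) = curve_length \<A> g \<gamma>1 + curve_length \<A> g \<gamma>2"
proof -
  obtain k \<tau> where cont: "continuous_on {0..1} \<gamma>1" and \<tau>: "\<tau> 0 = 0" "\<tau> k = (1::real)"
    and C1: "\<And>i. i < k \<Longrightarrow> \<tau> i < \<tau> (Suc i)" "\<And>i. i < k \<Longrightarrow> C1_curve_on \<A> {\<tau> i..\<tau> (Suc i)} \<gamma>1"
    using \<gamma>1 unfolding piecewise_C1_curve_def by blast
  obtain l \<rho> where cont2: "continuous_on {0..1} \<gamma>2" and \<rho>: "\<rho> 0 = 0" "\<rho> l = (1::real)"
    and C2: "\<And>i. i < l \<Longrightarrow> \<rho> i < \<rho> (Suc i)" "\<And>i. i < l \<Longrightarrow> C1_curve_on \<A> {\<rho> i..\<rho> (Suc i)} \<gamma>2"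
    using \<gamma>2 unfolding piecewise_C1_curve_def by blast
  have e1: "(\<gamma>1 +++ \<gamma>2) t = \<gamma>1 (2 * t + 0)" if "t \<le> 1 / 2" for t using that by (simp add: joinpaths_def)
  have e2: "(\<gamma>1 +++ \<gamma>2) t = \<gamma>2 (2 * t + -1)" if "t \<ge> 1 / 2" for t
  proof (cases "t = 1 / 2")
    case True
    show ?thesis unfolding True using j by (simp add: joinpaths_def)
  qed (use that in \<open>simp add: joinpaths_def\<close>)
  \<comment> \<open>The break points of the first curve are compressed into the left half of the
    unit interval and those of the second into the right half; at index \<open>k\<close> both
    formulas give 1/2.\<close>
  define \<sigma> where "\<sigma> i = (if i \<le> k then \<tau> i / 2 else (1 + \<rho> (i - k)) / 2)" for i
  have \<sigma>2: "\<sigma> i = (1 + \<rho> (i - k)) / 2" if "i \<ge> k" for i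
    using that \<tau> \<rho> by (cases "i = k") (auto simp: \<sigma>_def)
  have "\<sigma> i < \<sigma> (Suc i) \<and> C1_curve_on \<A> {\<sigma> i..\<sigma> (Suc i)} (\<gamma>1 +++ \<gamma>2)" if "i < k + l" for i
  proof (cases "i < k")
    case True
    have "\<tau> (Suc i) \<le> 1" using breakpoint_mono[of k \<tau> "Suc i" k] C1(1) True \<tau> by auto
    then have "C1_curve_on \<A> {\<tau> i / 2..\<tau> (Suc i) / 2} (\<gamma>1 +++ \<gamma>2)"
      by (intro C1_curve_on_affine[OF C1(2)[OF True], of _ 2 0] e1) auto
    then show ?thesis using True C1(1)[OF True] by (simp add: \<sigma>_def)
  next
    case False
    define m where "m = i - k"
    have m: "m < l" using False that by (auto simp: m_def)
    have "0 \<le> \<rho> m" using breakpoint_mono[of l \<rho> 0 m] C2(1) m \<rho> by auto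
    then have "C1_curve_on \<A> {(1 + \<rho> m) / 2..(1 + \<rho> (Suc m)) / 2} (\<gamma>1 +++ \<gamma>2)"
      by (intro C1_curve_on_affine[OF C2(2)[OF m], of _ 2 "-1"] e2) auto
    then show ?thesis using False C2(1)[OF m] by (simp add: \<sigma>2 m_def Suc_diff_le)
  qed
  moreover have "continuous_on {0..1} (\<gamma>1 +++ \<gamma>2)"
    using path_join_imp[of \<gamma>1 \<gamma>2] cont cont2 j by (simp add: path_def pathfinish_def pathstart_def)
  moreover have "\<sigma> 0 = 0" "\<sigma> (k + l) = 1" using \<tau> \<rho> \<sigma>2[of "k + l"] by (simp_all add: \<sigma>_def)
  ultimately show *: "piecewise_C1_curve \<A> (\<gamma>1 +++ \<gamma>2)"
    unfolding piecewise_C1_curve_def by blast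
  have "(\<lambda>t::real. 2 * t + 0) ` {0..1/2} = {0..1}"
    using image_affinity_atLeastAtMost[of "2::real" 0 0 "1/2"] by simp
  from curve_speed_has_integral_affine[OF * \<gamma>1 _ _ _ _ this]
  have I1: "(curve_speed \<A> g (\<gamma>1 +++ \<gamma>2) has_integral curve_length \<A> g \<gamma>1) {0..1/2}"
    using e1 by auto
  have "(\<lambda>t::real. 2 * t + -1) ` {1/2..1} = {0..1}"
    using image_affinity_atLeastAtMost[of "2::real" "-1" "1/2" 1] by simp
  from curve_speed_has_integral_affine[OF * \<gamma>2 _ _ _ _ this]
  have I2: "(curve_speed \<A> g (\<gamma>1 +++ \<gamma>2) has_integral curve_length \<A> g \<gamma>2) {1/2..1}"
    using e2 by auto
  show "curve_length \<A> g (\<gamma>1 +++ \<gamma>2) = curve_length \<A> g \<gamma>1 + curve_length \<A> g \<gamma>2"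
    unfolding curve_length_def[of _ _ "\<gamma>1 +++ \<gamma>2"]
    by (intro integral_unique has_integral_combine[OF _ _ I1 I2]) auto
qed

text \<open>Straight segments in a chart serve twice: they join nearby points, and they bound the
  distance from above.\<close>

lemma segment_curve:
  fixes u w :: "real ^ 'n"
  assumes c: "c \<in> \<A>" and seg: "\<And>s. s \<in> {0..1} \<Longrightarrow> u + s *\<^sub>R (w - u) \<in> snd c ` fst c"
  defines "\<gamma> \<equiv> \<lambda>s. inv_chart c (u + s *\<^sub>R (w - u))"
  shows "piecewise_C1_curve \<A> \<gamma>"
    and "(\<And>s. s \<in> {0..1} \<Longrightarrow> quad c (\<gamma> s) (w - u) \<le> B\<^sup>2) \<Longrightarrow> 0 \<le> B \<Longrightarrow> curve_length \<A> g \<gamma> \<le> B"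
proof -
  have \<gamma>c: "\<gamma> s \<in> fst c" "snd c (\<gamma> s) = u + s *\<^sub>R (w - u)" if "s \<in> {0..1}" for s
    using seg[OF that] unfolding \<gamma>_def by (auto intro: inv_into_into f_inv_into_f)
  have cont: "continuous_on {0..1} \<gamma>"
    unfolding \<gamma>_def using seg
    by (intro continuous_on_compose2[OF chart(5)[OF c]] continuous_intros) auto
  have der: "((\<lambda>s. snd c (\<gamma> s)) has_vector_derivative (w - u)) (at t within {0..1})" if "t \<in> {0..1}" for t
  proof -
    have "((\<lambda>s. u + s *\<^sub>R (w - u)) has_vector_derivative (w - u)) (at t within {0..1})"
      by (auto intro!: derivative_eq_intros)
    then show ?thesis
      by (rule has_vector_derivative_transform[OF that, rotated]) (simp add: \<gamma>c)
  qed
  have "C1_curve_on \<A> {0..1} \<gamma>"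
    unfolding C1_curve_on_def
  proof
    fix c' assume c': "c' \<in> \<A>"
    \<comment> \<open>Seen in another chart the segment moves with the derivative of the transition
      map, whose continuity makes the curve continuously differentiable there.\<close>
    let ?D = "\<lambda>y. frechet_derivative (transition c c') (at y) (w - u)"
    have "smooth_on (snd c ` (fst c \<inter> fst c')) (transition c c')"
      using c c' manifold by (auto simp: compact_riemannian_manifold_def smooth_atlas_def)
    then have "Ck_on (Suc 0) (snd c ` (fst c \<inter> fst c')) (transition c c')"
      unfolding smooth_on_def by blast
    then have D: "continuous_on (snd c ` (fst c \<inter> fst c')) ?D" by simp
    have "continuous_on {t \<in> {0..1}. \<gamma> t \<in> fst c'} (\<lambda>t. ?D (snd c (\<gamma> t)))"
    proof (rule continuous_on_compose2[OF D])
      have "continuous_on {0..1} (\<lambda>t. snd c (\<gamma> t))"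
        by (rule continuous_on_compose2[OF chart(4)[OF c] cont]) (auto simp: \<gamma>c)
      then show "continuous_on {t \<in> {0..1}. \<gamma> t \<in> fst c'} (\<lambda>t. snd c (\<gamma> t))"
        by (rule continuous_on_subset) auto
      show "(\<lambda>t. snd c (\<gamma> t)) ` {t \<in> {0..1}. \<gamma> t \<in> fst c'} \<subseteq> snd c ` (fst c \<inter> fst c')"
        using \<gamma>c(1) by blast
    qed
    moreover have "((\<lambda>s. snd c' (\<gamma> s)) has_vector_derivative ?D (snd c (\<gamma> t))) (at t within {0..1})"
      if "t \<in> {0..1}" "\<gamma> t \<in> fst c'" for t
      by (rule derivative_change_chart[OF c c' cont that(1) \<gamma>c(1)[OF that(1)] that(2) der[OF that(1)]])
    ultimately show "\<exists>D. continuous_on {t \<in> {0..1}. \<gamma> t \<in> fst c'} D \<and> (\<forall>t\<in>{0..1}. \<gamma> t \<in> fst c' \<longrightarrow>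
        ((\<lambda>s. snd c' (\<gamma> s)) has_vector_derivative D t) (at t within {0..1}))" by blast
  qed
  then show *: "piecewise_C1_curve \<A> \<gamma>"
    unfolding piecewise_C1_curve_def using cont by (intro conjI exI[of _ 1] exI[of _ real]) auto
  assume B: "\<And>s. s \<in> {0..1} \<Longrightarrow> quad c (\<gamma> s) (w - u) \<le> B\<^sup>2" "0 \<le> B"
  have le: "curve_speed \<A> g \<gamma> t \<le> B" if "t \<in> {0..1}" for t
  proof -
    have "curve_speed \<A> g \<gamma> t = sqrt (quad c (\<gamma> t) (w - u))"
      unfolding curve_speed_eq
      by (rule speed_in_eq[OF _ cont that c \<gamma>c(1)[OF that] der[OF that]]) simp
    then show ?thesis using B(1)[OF that] B(2) by (simp add: real_sqrt_le_iff' real_le_lsqrt)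
  qed
  have "curve_speed \<A> g \<gamma> integrable_on {0..1}" using piecewise_C1_curve_regular[OF *] by blast
  then have "integral {0..1} (curve_speed \<A> g \<gamma>) \<le> integral {0..1} (\<lambda>_::real. B)"
    by (intro integral_le le) auto
  then show "curve_length \<A> g \<gamma> \<le> B" by (simp add: curve_length_def)
qed

section \<open>Connectedness by curves and the metric axioms\<close>

definition joined :: "'a \<Rightarrow> 'a \<Rightarrow> bool" where
  "joined x y \<longleftrightarrow> (\<exists>\<gamma>. piecewise_C1_curve \<A> \<gamma> \<and> \<gamma> 0 = x \<and> \<gamma> 1 = y)"

lemma joined_sym: "joined x y \<Longrightarrow> joined y x"
proof -
  assume "joined x y"
  then obtain \<gamma> where \<gamma>: "piecewise_C1_curve \<A> \<gamma>" "\<gamma> 0 = x" "\<gamma> 1 = y" by (auto simp: joined_def)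
  then show ?thesis using piecewise_C1_curve_reverse(1)[OF \<gamma>(1)] unfolding joined_def
    by (intro exI[of _ "\<lambda>t. \<gamma> (1 - t)"]) simp
qed

lemma joined_trans: "joined x y \<Longrightarrow> joined y z \<Longrightarrow> joined x z"
proof -
  assume "joined x y" "joined y z"
  then obtain \<gamma> \<delta> where \<gamma>: "piecewise_C1_curve \<A> \<gamma>" "\<gamma> 0 = x" "\<gamma> 1 = y"
    and \<delta>: "piecewise_C1_curve \<A> \<delta>" "\<delta> 0 = y" "\<delta> 1 = z" by (auto simp: joined_def)
  then show ?thesis using piecewise_C1_curve_join(1)[OF \<gamma>(1) \<delta>(1)] unfolding joined_def
    by (intro exI[of _ "\<gamma> +++ \<delta>"]) (simp add: joinpaths_def)
qed

lemma open_chart_vimage: "c \<in> \<A> \<Longrightarrow> open B \<Longrightarrow> open {z \<in> fst c. snd c z \<in> B}"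
  using continuous_open_preimage[OF chart(4) chart(1), of c B] by (simp add: vimage_def Int_def)

lemma locally_joined: "\<exists>N. open N \<and> y \<in> N \<and> (\<forall>z\<in>N. joined y z)"
proof -
  obtain c where c: "c \<in> \<A>" "y \<in> fst c" by (rule chart_at)
  obtain e where e: "e > 0" "ball (snd c y) e \<subseteq> snd c ` fst c"
    using chart(2)[OF c(1)] c(2) open_contains_ball by blast
  define N where "N = {z \<in> fst c. snd c z \<in> ball (snd c y) e}"
  have "joined y z" if z: "z \<in> N" for z
  proof -
    let ?\<gamma> = "\<lambda>s. inv_chart c (snd c y + s *\<^sub>R (snd c z - snd c y))"
    have "snd c y + s *\<^sub>R (snd c z - snd c y) \<in> snd c ` fst c" if "s \<in> {0..1}" for s
    proof -
      have "norm (s *\<^sub>R (snd c z - snd c y)) \<le> 1 * norm (snd c z - snd c y)"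
        unfolding norm_scaleR using that by (intro mult_right_mono) auto
      then have "snd c y + s *\<^sub>R (snd c z - snd c y) \<in> ball (snd c y) e"
        using z by (simp add: N_def dist_norm norm_minus_commute)
      then show ?thesis using e(2) by blast
    qed
    then have "piecewise_C1_curve \<A> ?\<gamma>" by (rule segment_curve(1)[OF c(1)])
    moreover have "?\<gamma> 0 = y" "?\<gamma> 1 = z"
      using z c chart(3)[OF c(1)] by (auto simp: N_def inv_into_f_f)
    ultimately show ?thesis unfolding joined_def by blast
  qed
  moreover have "open N" unfolding N_def by (rule open_chart_vimage[OF c(1)]) simp
  moreover have "y \<in> N" using c e by (simp add: N_def)
  ultimately show ?thesis by blast
qed

text \<open>Local joinability and transitivity make the set of points joined to \<open>x\<close>
  open with open complement. The infimum that defines the distance is thus never taken over the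
  empty set.\<close>

lemma joined: "joined x y"
proof -
  have "open {y. joined x y}"
    unfolding open_subopen[of "{y. joined x y}"]
  proof
    fix y assume y: "y \<in> {y. joined x y}"
    obtain N where "open N" "y \<in> N" "\<forall>z\<in>N. joined y z" using locally_joined by blast
    moreover from this y have "N \<subseteq> {y. joined x y}" by (auto intro: joined_trans)
    ultimately show "\<exists>T. open T \<and> y \<in> T \<and> T \<subseteq> {y. joined x y}" by blast
  qed
  moreover have "open (- {y. joined x y})"
    unfolding open_subopen[of "- {y. joined x y}"]
  proof
    fix y assume y: "y \<in> - {y. joined x y}"
    obtain N where "open N" "y \<in> N" "\<forall>z\<in>N. joined y z" using locally_joined by blast
    moreover from this y have "N \<subseteq> - {y. joined x y}"
      by (auto dest: joined_sym intro: joined_trans)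
    ultimately show "\<exists>T. open T \<and> y \<in> T \<and> T \<subseteq> - {y. joined x y}" by blast
  qed
  moreover have "connected (UNIV :: 'a set)" using manifold by (simp add: compact_riemannian_manifold_def)
  ultimately have "{y. joined x y} = {} \<or> {y. joined x y} = UNIV"
    unfolding connected_clopen openin_open_eq[OF open_UNIV] subtopology_UNIV closed_closedin[symmetric]
    by (metis closed_def open_openin subset_UNIV)
  moreover have "joined x x" using locally_joined by blast
  ultimately show ?thesis by blast
qed

abbreviation d :: "'a \<Rightarrow> 'a \<Rightarrow> real" where "d \<equiv> geodesic_dist \<A> g"

lemma dist_le_length: "piecewise_C1_curve \<A> \<gamma> \<Longrightarrow> d (\<gamma> 0) (\<gamma> 1) \<le> curve_length \<A> g \<gamma>"
  unfolding geodesic_dist_def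
  by (intro cInf_lower bdd_belowI[of _ 0]) (auto simp: curve_length_nonneg)

lemma dist_less_curve:
  assumes "d x y < r"
  obtains \<gamma> where "piecewise_C1_curve \<A> \<gamma>" "\<gamma> 0 = x" "\<gamma> 1 = y" "curve_length \<A> g \<gamma> < r"
proof -
  have "{curve_length \<A> g \<gamma> |\<gamma>. piecewise_C1_curve \<A> \<gamma> \<and> \<gamma> 0 = x \<and> \<gamma> 1 = y} \<noteq> {}"
    using joined[of x y] by (auto simp: joined_def)
  from cInf_lessD[OF this assms[unfolded geodesic_dist_def]] that show ?thesis by blast
qed

lemma gdist_nonneg: "0 \<le> d x y"
  using dist_less_curve[of x y 0] curve_length_nonneg by (meson not_less order.asym)

lemma gdist_sym: "d x y = d y x"
proof -
  have "d y x \<le> d x y" for x y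
  proof (rule field_le_epsilon)
    fix e :: real assume "e > 0"
    then obtain \<gamma> where \<gamma>: "piecewise_C1_curve \<A> \<gamma>" "\<gamma> 0 = x" "\<gamma> 1 = y" "curve_length \<A> g \<gamma> < d x y + e"
      using dist_less_curve[of x y "d x y + e"] by auto
    show "d y x \<le> d x y + e"
      using dist_le_length[OF piecewise_C1_curve_reverse(1)[OF \<gamma>(1)]] \<gamma>
      by (simp add: piecewise_C1_curve_reverse(2))
  qed
  then show ?thesis by (metis order.antisym)
qed

lemma gdist_triangle: "d x z \<le> d x y + d y z"
proof (rule field_le_epsilon)
  fix e :: real assume e: "e > 0"
  obtain \<gamma> where \<gamma>: "piecewise_C1_curve \<A> \<gamma>" "\<gamma> 0 = x" "\<gamma> 1 = y" "curve_length \<A> g \<gamma> < d x y + e / 2"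
    using dist_less_curve[of x y "d x y + e / 2"] e by auto
  obtain \<delta> where \<delta>: "piecewise_C1_curve \<A> \<delta>" "\<delta> 0 = y" "\<delta> 1 = z" "curve_length \<A> g \<delta> < d y z + e / 2"
    using dist_less_curve[of y z "d y z + e / 2"] e by auto
  have j: "\<gamma> 1 = \<delta> 0" using \<gamma> \<delta> by simp
  have "(\<gamma> +++ \<delta>) 0 = x" "(\<gamma> +++ \<delta>) 1 = z" using \<gamma> \<delta> by (simp_all add: joinpaths_def)
  then have "d x z \<le> curve_length \<A> g \<gamma> + curve_length \<A> g \<delta>"
    using dist_le_length[OF piecewise_C1_curve_join(1)[OF \<gamma>(1) \<delta>(1) j]]
    by (simp add: piecewise_C1_curve_join(2)[OF \<gamma>(1) \<delta>(1) j])
  then show "d x z \<le> d x y + d y z + e" using \<gamma>(4) \<delta>(4) by linarith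
qed

end

section \<open>The determinant as volume factor of a linear map\<close>

section \<open>Volume of linear images of balls\<close>

text \<open>Stated as a predicate on maps because it is established by induction over elementary
  linear maps, which needs closure under composition.\<close>

definition scales_by_det :: "(real ^ 'n \<Rightarrow> real ^ 'n) \<Rightarrow> bool" where
  "scales_by_det f \<longleftrightarrow> (\<forall>S\<in>lmeasurable. f ` S \<in> lmeasurable \<and>
     measure lebesgue (f ` S) = \<bar>det (matrix f)\<bar> * measure lebesgue S)"

lemma scales_by_det_compose:
  fixes f g :: "real ^ 'n \<Rightarrow> real ^ 'n"
  assumes "linear f" "linear g" "scales_by_det f" "scales_by_det g" shows "scales_by_det (f \<circ> g)"
  unfolding scales_by_det_def
proof
  fix S :: "(real ^ 'n) set" assume "S \<in> lmeasurable"
  then have g: "g ` S \<in> lmeasurable" "measure lebesgue (g ` S) = \<bar>det (matrix g)\<bar> * measure lebesgue S"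
    using assms(4) by (simp_all add: scales_by_det_def)
  have "f ` g ` S \<in> lmeasurable"
    "measure lebesgue (f ` g ` S) = \<bar>det (matrix f)\<bar> * measure lebesgue (g ` S)"
    using g(1) assms(3) unfolding scales_by_det_def by blast+
  then show "(f \<circ> g) ` S \<in> lmeasurable \<and>
      measure lebesgue ((f \<circ> g) ` S) = \<bar>det (matrix (f \<circ> g))\<bar> * measure lebesgue S"
    unfolding image_comp[symmetric] matrix_compose[OF assms(2,1)] det_mul abs_mult by (simp add: g(2))
qed

lemma scales_by_det_stretch: "scales_by_det (\<lambda>x :: real ^ 'n. \<chi> i. m i * x $ i)"
proof -
  have "matrix (\<lambda>x :: real ^ 'n. \<chi> i. m i * x $ i) $ i $ j = (if i = j then m i else 0)" for i j
    by (simp add: matrix_def axis_def)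
  then have "det (matrix (\<lambda>x :: real ^ 'n. \<chi> i. m i * x $ i)) = prod m UNIV"
    by (subst det_diagonal) auto
  then show ?thesis by (simp add: scales_by_det_def measurable_stretch measure_stretch)
qed

abbreviation shear :: "'n::finite \<Rightarrow> 'n \<Rightarrow> real ^ 'n \<Rightarrow> real ^ 'n" where
  "shear k l \<equiv> \<lambda>x. \<chi> i. if i = k then x $ k + x $ l else x $ i"

lemma linear_shear: "linear (shear k l)"
  by (rule linearI) (auto simp: vec_eq_iff algebra_simps)

lemma scales_by_det_shear:
  fixes k l :: "'n::finite"
  assumes "k \<noteq> l" shows "scales_by_det (shear k l)"
proof -
  have "matrix (shear k l) = (\<chi> i. if i = k then row k (mat 1) + row l (mat 1) else row i (mat 1))"
    by (auto simp: matrix_def row_def mat_def axis_def vec_eq_iff)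
  also have "det \<dots> = 1"
    by (subst det_row_span) (use assms in \<open>auto intro!: vec.span_base simp: det_I\<close>)
  finally have det: "det (matrix (shear k l)) = 1" .
  have box: "measure lebesgue (shear k l ` cbox a b) = 1 * measure lebesgue (cbox a b)" for a b
  proof (cases "cbox a b = {}")
    case False
    \<comment> \<open>The volume of a sheared box is used for boxes with nonnegative coordinate
      \<open>l\<close>; translating by \<open>w\<close> puts the lower face in that direction at
      0.\<close>
    define w where "w = (a $ l) *\<^sub>R (axis l 1 :: real ^ 'n)"
    have ne: "cbox (a - w) (b - w) \<noteq> {}" using False by (auto simp: interval_ne_empty_cart)
    have tr: "cbox a b = (+) w ` cbox (a - w) (b - w)"
      using cbox_translation[of w "a - w" "b - w"] by simp
    have "shear k l ` cbox a b = (+) (shear k l w) ` shear k l ` cbox (a - w) (b - w)"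
      unfolding tr image_image by (simp add: linear_add[OF linear_shear])
    then have "measure lebesgue (shear k l ` cbox a b) = measure lebesgue (shear k l ` cbox (a - w) (b - w))"
      by (simp only: measure_translation)
    also have "\<dots> = measure lebesgue (cbox (a - w) (b - w))"
      by (rule measure_shear_interval[OF assms ne]) (simp add: w_def)
    finally show ?thesis by (simp only: tr measure_translation mult_1)
  qed simp
  show ?thesis
    unfolding scales_by_det_def
  proof
    fix S :: "(real ^ 'n) set" assume "S \<in> lmeasurable"
    from measure_linear_sufficient[OF linear_shear this box]
    show "shear k l ` S \<in> lmeasurable \<and>
        measure lebesgue (shear k l ` S) = \<bar>det (matrix (shear k l))\<bar> * measure lebesgue S"
      unfolding det by linarith
  qed
qed

text \<open>The library's \<open>measure_linear_image\<close> is restricted to well-ordered index types. A swap of two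
  coordinates is obtained here from shears and sign changes.\<close>

lemma scales_by_det_linear:
  fixes f :: "real ^ 'n \<Rightarrow> real ^ 'n"
  assumes "linear f" shows "scales_by_det f"
proof -
  have str: "linear (\<lambda>x :: real ^ 'n. \<chi> i. m i * x $ i)" for m
    by (rule linearI) (auto simp: vec_eq_iff algebra_simps)
  show ?thesis
  proof (rule induct_linear_elementary[OF assms])
    fix f :: "real ^ 'n \<Rightarrow> real ^ 'n" and i assume f: "linear f" "\<And>x. f x $ i = 0"
    \<comment> \<open>A map missing a coordinate direction is not surjective, hence not injective:
      its images are negligible and its determinant vanishes.\<close>
    have ninj: "\<not> inj f"
    proof
      assume "inj f"
      then obtain x where "f x = axis i 1" using linear_injective_imp_surjective[OF f(1)] by (metis surjD)
      then show False using f(2)[of x] by simp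
    qed
    have "negligible (f ` S)" for S by (rule negligible_linear_singular_image[OF f(1) ninj])
    moreover have "det (matrix f) = 0" using det_nz_iff_inj[OF f(1)] ninj by blast
    ultimately show "scales_by_det f"
      by (simp add: scales_by_det_def negligible_imp_measurable negligible_imp_measure0)
  next
    fix k l :: 'n assume "k \<noteq> l"
    define D where "D j = (\<lambda>x :: real ^ 'n. \<chi> i. (if i = j then -1 else 1) * x $ i)" for j
    have lD: "linear (D j)" and sD: "scales_by_det (D j)" for j
      unfolding D_def by (rule str scales_by_det_stretch)+
    \<comment> \<open>On the coordinates k and l the pair (a, b) passes through (a + b, b), (-a - b,
      b), (-a - b, -a), (a + b, -a), (b, -a) and ends at (b, a).\<close>
    have "(\<lambda>x :: real ^ 'n. \<chi> i. x $ Transposition.transpose k l i) =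
        D l \<circ> (shear k l \<circ> (D k \<circ> (shear l k \<circ> (D k \<circ> shear k l))))"
      using \<open>k \<noteq> l\<close> by (auto simp: fun_eq_iff vec_eq_iff D_def Transposition.transpose_def)
    moreover have "scales_by_det \<dots>"
      using \<open>k \<noteq> l\<close> by (intro scales_by_det_compose linear_compose lD sD linear_shear scales_by_det_shear) auto
    ultimately show "scales_by_det (\<lambda>x :: real ^ 'n. \<chi> i. x $ Transposition.transpose k l i)" by simp
  next
    show "scales_by_det (f \<circ> g)" if "linear f" "linear g" "scales_by_det f" "scales_by_det g"
      for f g :: "real ^ 'n \<Rightarrow> real ^ 'n"
      using that by (rule scales_by_det_compose)
    show "scales_by_det (\<lambda>x :: real ^ 'n. \<chi> i. m i * x $ i)" for m by (rule scales_by_det_stretch)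
    show "scales_by_det (shear k l)" if "k \<noteq> l" for k l :: 'n by (rule scales_by_det_shear[OF that])
  qed
qed

lemma open_matrix_vimage:
  fixes M :: "real ^ 'n ^ 'n" shows "open S \<Longrightarrow> open ((*v) M -` S)"
  by (intro open_vimage linear_continuous_on matrix_vector_mul_bounded_linear)

lemma matrix_image_eq_vimage:
  fixes B L :: "real ^ 'n ^ 'n"
  assumes BL: "B ** L = mat 1" "L ** B = mat 1"
  shows "(*v) B ` S = (*v) L -` S"
proof (intro set_eqI iffI)
  fix z assume "z \<in> (*v) L -` S"
  then show "z \<in> (*v) B ` S"
    by (intro image_eqI[of _ _ "L *v z"]) (auto simp: matrix_vector_mul_assoc BL)
qed (auto simp: matrix_vector_mul_assoc BL)

lemma emeasure_lborel_linear_ball: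
  fixes B L :: "real ^ 'n ^ 'n"
  assumes BL: "B ** L = mat 1" "L ** B = mat 1" and s: "s \<ge> 0"
  shows "emeasure lborel ((*v) B ` ball a s) =
    ennreal (\<bar>det B\<bar> * (s ^ CARD('n) * unit_ball_vol (real CARD('n))))"
proof -
  have borel: "(*v) B ` ball a s \<in> sets borel"
    using open_matrix_vimage[of "ball a s" L] by (simp add: matrix_image_eq_vimage[OF BL])
  have ball: "ball a s \<in> lmeasurable" by simp
  have im: "(*v) B ` ball a s \<in> lmeasurable"
    "measure lebesgue ((*v) B ` ball a s) = \<bar>det B\<bar> * measure lebesgue (ball a s)"
    using scales_by_det_linear[of "(*v) B"] ball by (auto simp: scales_by_det_def)
  have "emeasure lborel ((*v) B ` ball a s) = emeasure lebesgue ((*v) B ` ball a s)"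
    using borel by simp
  also have "\<dots> = ennreal (measure lebesgue ((*v) B ` ball a s))"
    by (rule emeasure_eq_measure2[OF im(1)])
  also have "measure lebesgue (ball a s) = measure lborel (ball a s)" by simp
  then have "measure lebesgue ((*v) B ` ball a s) = \<bar>det B\<bar> * (s ^ CARD('n) * unit_ball_vol (real CARD('n)))"
    using im(2) content_ball[OF s, of a] by simp
  finally show ?thesis .
qed

section \<open>Frames that are nearly orthonormal on a neighbourhood\<close>

section \<open>Local comparison with Euclidean space\<close>

text \<open>Gram-Schmidt orthonormalisation for the inner product with matrix \<open>G\<close>: a
  family with fewer than \<open>CARD('n)\<close> members does not span, which leaves room for one
  more vector.\<close>

lemma orthonormal_family_exists:
  fixes G :: "real ^ 'n ^ 'n"
  assumes sym: "transpose G = G" and pos: "\<And>v. v \<noteq> 0 \<Longrightarrow> v \<bullet> (G *v v) > 0"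
    and k: "k \<le> CARD('n)"
  shows "\<exists>S. finite S \<and> card S = k \<and> (\<forall>u\<in>S. \<forall>v\<in>S. u \<bullet> (G *v v) = (if u = v then 1 else 0))"
  using k
proof (induction k)
  case 0
  show ?case by (intro exI[of _ "{}"]) simp
next
  case (Suc k)
  then obtain S where S: "finite S" "card S = k"
    "\<And>u v. u \<in> S \<Longrightarrow> v \<in> S \<Longrightarrow> u \<bullet> (G *v v) = (if u = v then 1 else 0)" by auto
  have comm: "u \<bullet> (G *v v) = v \<bullet> (G *v u)" for u v
    by (metis sym dot_lmul_matrix inner_commute transpose_matrix_vector)
  have "span S \<noteq> UNIV"
  proof
    assume "span S = UNIV"
    then have "dim (UNIV :: (real ^ 'n) set) \<le> card S" using S(1) by (intro span_card_ge_dim) auto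
    then show False using S(2) Suc.prems by (simp add: dim_UNIV)
  qed
  then obtain v where v: "v \<notin> span S" by blast
  define w where "w = v - (\<Sum>u\<in>S. (u \<bullet> (G *v v)) *\<^sub>R u)"
  have "w \<noteq> 0"
  proof
    assume "w = 0"
    then have "v = (\<Sum>u\<in>S. (u \<bullet> (G *v v)) *\<^sub>R u)" by (simp add: w_def)
    also have "\<dots> \<in> span S" by (intro span_sum span_scale span_base)
    finally show False using v by simp
  qed
  have orth: "u \<bullet> (G *v w) = 0" if u: "u \<in> S" for u
  proof -
    have "u \<bullet> (G *v w) = u \<bullet> (G *v v) - (\<Sum>u'\<in>S. (u' \<bullet> (G *v v)) * (u \<bullet> (G *v u')))"
      unfolding w_def comm[of u]
      by (simp add: inner_diff_left inner_sum_left)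
    also have "(\<Sum>u'\<in>S. (u' \<bullet> (G *v v)) * (u \<bullet> (G *v u'))) = (\<Sum>u'\<in>S. if u' = u then u \<bullet> (G *v v) else 0)"
      using S(3) u by (intro sum.cong) auto
    finally show ?thesis using u S(1) by simp
  qed
  define a where "a = sqrt (w \<bullet> (G *v w))"
  have a: "a > 0" "a\<^sup>2 = w \<bullet> (G *v w)" using pos[OF \<open>w \<noteq> 0\<close>] by (simp_all add: a_def)
  define e where "e = (1 / a) *\<^sub>R w"
  have e1: "e \<bullet> (G *v e) = 1"
    using a by (simp add: e_def matrix_vector_mult_scaleR power2_eq_square flip: a(2))
  have e0: "u \<bullet> (G *v e) = 0" "e \<bullet> (G *v u) = 0" if "u \<in> S" for u
    using orth[OF that] comm[of e u] by (simp_all add: e_def matrix_vector_mult_scaleR)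
  have "e \<notin> S" using e0 e1 by force
  then show ?case
    using S e0 e1 by (intro exI[of _ "insert e S"]) auto
qed

lemma orthonormal_frame_exists:
  fixes G :: "real ^ 'n ^ 'n"
  assumes sym: "transpose G = G" and pos: "\<And>v. v \<noteq> 0 \<Longrightarrow> v \<bullet> (G *v v) > 0"
  shows "\<exists>B L :: real ^ 'n ^ 'n. transpose B ** G ** B = mat 1 \<and> B ** L = mat 1 \<and> L ** B = mat 1"
proof -
  obtain S where S: "finite S" "card S = CARD('n)"
    "\<And>u v. u \<in> S \<Longrightarrow> v \<in> S \<Longrightarrow> u \<bullet> (G *v v) = (if u = v then 1 else 0)"
    using orthonormal_family_exists[OF sym pos order_refl] by blast
  obtain b :: "'n \<Rightarrow> real ^ 'n" where b: "bij_betw b UNIV S"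
    using finite_same_card_bij[of "UNIV :: 'n set" S] S by auto
  \<comment> \<open>The columns of \<open>B\<close> are the orthonormal vectors; the Gram identity
    then shows that \<open>transpose B ** G\<close> is the inverse of \<open>B\<close>.\<close>
  define B :: "real ^ 'n ^ 'n" where "B = (\<chi> i j. b j $ i)"
  have col: "B *v axis j 1 = b j" for j
    by (simp add: B_def matrix_vector_mult_basis column_def vec_eq_iff)
  have "(transpose B ** G ** B) $ i $ j = (mat 1 :: real ^ 'n ^ 'n) $ i $ j" for i j
  proof -
    have "(transpose B ** G ** B) $ i $ j = axis i 1 \<bullet> ((transpose B ** G ** B) *v axis j 1)"
      by (simp add: inner_axis_axis matrix_vector_mult_basis column_def inner_axis')
    also have "\<dots> = axis i 1 \<bullet> (transpose B *v (G *v b j))"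
      by (simp add: matrix_vector_mul_assoc[symmetric] col)
    also have "\<dots> = b i \<bullet> (G *v b j)"
      by (metis col dot_lmul_matrix inner_commute transpose_matrix_vector)
    also have "\<dots> = (if b i = b j then 1 else 0)"
      using b by (intro S(3)) (auto simp: bij_betw_def)
    also have "b i = b j \<longleftrightarrow> i = j" using b by (auto simp: bij_betw_def dest: injD)
    finally show ?thesis by (simp add: mat_def)
  qed
  then have I: "transpose B ** G ** B = mat 1" by (simp add: vec_eq_iff)
  then have "transpose B ** G ** B ** mat 1 = mat 1" by simp
  define L where "L = transpose B ** G"
  have "L ** B = mat 1" using I by (simp add: L_def)
  moreover from this have "B ** L = mat 1" using matrix_left_right_inverse by blast
  ultimately show ?thesis using I by blast
qed

text \<open>Turns closeness of a matrix to the identity into closeness of the quadratic forms; a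
  crude dimensional constant is enough.\<close>

lemma abs_inner_matrix_le:
  fixes E :: "real ^ 'n ^ 'n"
  shows "\<bar>w \<bullet> (E *v w)\<bar> \<le> real CARD('n) * norm E * (norm w)\<^sup>2"
proof -
  have "norm (E *v w) \<le> (\<Sum>i\<in>UNIV. \<bar>(E *v w) $ i\<bar>)" by (rule norm_le_l1_cart)
  also have "\<dots> \<le> (\<Sum>i\<in>(UNIV :: 'n set). norm E * norm w)"
  proof (rule sum_mono)
    fix i
    have "(E *v w) $ i = (E $ i) \<bullet> w" by (simp add: matrix_vector_mult_def inner_vec_def)
    then have "\<bar>(E *v w) $ i\<bar> \<le> norm (E $ i) * norm w" by (simp add: Cauchy_Schwarz_ineq2)
    also have "\<dots> \<le> norm E * norm w" by (intro mult_right_mono Finite_Cartesian_Product.norm_nth_le) simp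
    finally show "\<bar>(E *v w) $ i\<bar> \<le> norm E * norm w" .
  qed
  finally have "norm (E *v w) \<le> real CARD('n) * norm E * norm w" by simp
  then have "norm w * norm (E *v w) \<le> norm w * (real CARD('n) * norm E * norm w)"
    by (intro mult_left_mono) auto
  then show ?thesis using Cauchy_Schwarz_ineq2[of w "E *v w"] by (simp add: power2_eq_square mult_ac)
qed

lemma continuous_on_det [continuous_intros]:
  fixes M :: "'a::topological_space \<Rightarrow> real ^ 'n ^ 'n"
  assumes "continuous_on S M" shows "continuous_on S (\<lambda>x. det (M x))"
  unfolding det_def using assms
  by (intro continuous_intros)

lemma continuous_on_matrix_mult:
  fixes M :: "'a::topological_space \<Rightarrow> real ^ 'n ^ 'm"
  assumes "continuous_on S M" "continuous_on S N" shows "continuous_on S (\<lambda>x. M x ** N x)"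
  unfolding matrix_matrix_mult_def using assms
  by (intro continuous_on_vec_lambda continuous_intros)

text \<open>Linear coordinates \<open>L *v snd c x\<close> near \<open>x0\<close>, in which lengths
  and volume density agree with the Euclidean ones up to the factor \<open>\<eta>\<close>. They
  arise from a frame orthonormal at \<open>x0\<close>; the matrix \<open>B\<close> leads back to
  chart coordinates.\<close>

locale normal_frame = riemannian_manifold \<A> g
  for \<A> :: "('a::{t2_space,second_countable_topology}, 'n::finite) chart set"
    and g :: "('a, 'n) chart \<Rightarrow> 'a \<Rightarrow> real ^ 'n ^ 'n" +
  fixes c :: "('a, 'n) chart" and B L :: "real ^ 'n ^ 'n" and x0 :: 'a and \<eta> \<rho> :: real
  assumes c: "c \<in> \<A>" "x0 \<in> fst c" and \<eta>: "\<eta> > 1" and \<rho>: "\<rho> > 0"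
    and BL: "B ** L = mat 1" "L ** B = mat 1"
    and range: "\<And>z. z \<in> cball (L *v snd c x0) \<rho> \<Longrightarrow> B *v z \<in> snd c ` fst c"
    and quad_frame: "\<And>x v. x \<in> fst c \<Longrightarrow> L *v snd c x \<in> cball (L *v snd c x0) \<rho> \<Longrightarrow>
        norm (L *v v) / \<eta> \<le> sqrt (quad c x v) \<and> sqrt (quad c x v) \<le> \<eta> * norm (L *v v)"
    and det_frame: "\<And>x. x \<in> fst c \<Longrightarrow> L *v snd c x \<in> cball (L *v snd c x0) \<rho> \<Longrightarrow>
        1 / \<eta> \<le> sqrt (det (g c x)) * \<bar>det B\<bar> \<and> sqrt (det (g c x)) * \<bar>det B\<bar> \<le> \<eta>"

context riemannian_manifold
begin

lemma normal_frame_at: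
  assumes \<eta>: "\<eta> > 1"
  obtains c and B L :: "real ^ 'n ^ 'n" and \<rho> where "normal_frame \<A> g c B L x0 \<eta> \<rho>"
proof -
  obtain c where c: "c \<in> \<A>" "x0 \<in> fst c" by (rule chart_at)
  have G: "transpose (g c x0) = g c x0" "v \<noteq> 0 \<Longrightarrow> v \<bullet> (g c x0 *v v) > 0" for v
    using manifold c by (auto simp: compact_riemannian_manifold_def riemannian_metric_def)
  have "\<exists>B L :: real ^ 'n ^ 'n. transpose B ** g c x0 ** B = mat 1 \<and> B ** L = mat 1 \<and> L ** B = mat 1"
    by (rule orthonormal_frame_exists) (use G in auto)
  then obtain B L :: "real ^ 'n ^ 'n" where
    BL: "transpose B ** g c x0 ** B = mat 1" "B ** L = mat 1" "L ** B = mat 1"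
    by blast
  define M where "M x = transpose B ** g c x ** B" for x
  have contM: "continuous_on (fst c) M"
    unfolding M_def
    by (intro continuous_on_matrix_mult continuous_on_const metric_continuous c)
  define n where "n = real CARD('n)"
  have n: "n > 0" by (simp add: n_def)
  \<comment> \<open>\<open>n\<close> times the norm of a matrix bounds its quadratic form on unit
    vectors. The two entries of the minimum yield the factors \<open>\<eta>\<^sup>2\<close> above
    and \<open>1 / \<eta>\<^sup>2\<close> below.\<close>
  define \<delta> where "\<delta> = min (\<eta>\<^sup>2 - 1) (1 - 1 / \<eta>\<^sup>2) / n"
  have \<eta>2: "\<eta>\<^sup>2 > 1" using \<eta> by (simp add: one_less_power)
  have \<delta>: "\<delta> > 0" "n * \<delta> \<le> \<eta>\<^sup>2 - 1" "n * \<delta> \<le> 1 - 1 / \<eta>\<^sup>2"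
    using n \<eta> \<eta>2 by (simp_all add: \<delta>_def)
  define N where "N = {x \<in> fst c. norm (M x - mat 1) < \<delta> \<and> 1 / \<eta> < sqrt (det (M x)) \<and> sqrt (det (M x)) < \<eta>}"
  have "open N"
  proof -
    have "open (fst c \<inter> (\<lambda>x. (norm (M x - mat 1), sqrt (det (M x)))) -` ({..<\<delta>} \<times> {1/\<eta><..<\<eta>}))"
      by (intro continuous_open_preimage chart c open_Times continuous_intros contM)
    moreover have "N = fst c \<inter> (\<lambda>x. (norm (M x - mat 1), sqrt (det (M x)))) -` ({..<\<delta>} \<times> {1/\<eta><..<\<eta>})"
      by (auto simp: N_def)
    ultimately show ?thesis by simp
  qed
  have "x0 \<in> N" using c \<delta> \<eta> by (simp add: N_def M_def BL det_I)
  have "snd c ` N = snd c ` fst c \<inter> inv_chart c -` N"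
    using chart(3)[OF c(1)] by (auto simp: N_def inv_into_f_f intro!: image_eqI)
  then have "open (snd c ` N)"
    using continuous_open_preimage[OF chart(5,2)[OF c(1)] \<open>open N\<close>] by simp
  then have "open ((*v) B -` (snd c ` N))"
    by (rule open_matrix_vimage)
  moreover have "L *v snd c x0 \<in> (*v) B -` (snd c ` N)"
    using \<open>x0 \<in> N\<close> by (simp add: matrix_vector_mul_assoc BL)
  ultimately obtain \<rho> where \<rho>: "\<rho> > 0" "cball (L *v snd c x0) \<rho> \<subseteq> (*v) B -` (snd c ` N)"
    using open_contains_cball by blast
  have inN: "x \<in> N" if x: "x \<in> fst c" "L *v snd c x \<in> cball (L *v snd c x0) \<rho>" for x
  proof -
    have "B *v (L *v snd c x) \<in> snd c ` N" using x \<rho> by blast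
    then have "snd c x \<in> snd c ` N" by (simp add: matrix_vector_mul_assoc BL)
    then show ?thesis using x(1) chart(3)[OF c(1)] by (auto simp: N_def inj_on_def)
  qed
  show ?thesis
  proof (rule that[of c B L \<rho>], unfold_locales)
    show "B *v z \<in> snd c ` fst c" if "z \<in> cball (L *v snd c x0) \<rho>" for z
      using that \<rho>(2) by (auto simp: N_def)
  next
    fix x v assume x: "x \<in> fst c" "L *v snd c x \<in> cball (L *v snd c x0) \<rho>"
    define w where "w = L *v v"
    have v: "v = B *v w" by (simp add: w_def matrix_vector_mul_assoc BL)
    have "quad c x v = (B *v w) \<bullet> (g c x *v (B *v w))" by (simp add: quad_def v)
    also have "\<dots> = w \<bullet> (transpose B *v (g c x *v (B *v w)))"
      by (metis dot_lmul_matrix inner_commute transpose_matrix_vector)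
    also have "\<dots> = w \<bullet> (M x *v w)"
      by (simp add: M_def matrix_vector_mul_assoc matrix_mul_assoc)
    also have "\<dots> = (norm w)\<^sup>2 + w \<bullet> ((M x - mat 1) *v w)"
      by (simp add: matrix_vector_mult_diff_rdistrib inner_diff_right power2_norm_eq_inner)
    finally have q: "\<bar>quad c x v - (norm w)\<^sup>2\<bar> \<le> n * norm (M x - mat 1) * (norm w)\<^sup>2"
      using abs_inner_matrix_le[of w "M x - mat 1"] by (simp add: n_def)
    also have "\<dots> \<le> n * \<delta> * (norm w)\<^sup>2"
      using inN[OF x] n by (intro mult_right_mono mult_left_mono) (auto simp: N_def)
    finally have q: "\<bar>quad c x v - (norm w)\<^sup>2\<bar> \<le> n * \<delta> * (norm w)\<^sup>2" .
    moreover have "n * \<delta> * (norm w)\<^sup>2 \<le> (\<eta>\<^sup>2 - 1) * (norm w)\<^sup>2" "n * \<delta> * (norm w)\<^sup>2 \<le> (1 - 1 / \<eta>\<^sup>2) * (norm w)\<^sup>2"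
      by (intro mult_right_mono \<delta>; simp)+
    ultimately have "quad c x v \<le> \<eta>\<^sup>2 * (norm w)\<^sup>2" "(norm w)\<^sup>2 / \<eta>\<^sup>2 \<le> quad c x v"
      by (simp_all add: abs_le_iff algebra_simps)
    then have "quad c x v \<le> (\<eta> * norm w)\<^sup>2" "(norm w / \<eta>)\<^sup>2 \<le> quad c x v"
      by (simp_all add: power_mult_distrib power_divide)
    then show "norm (L *v v) / \<eta> \<le> sqrt (quad c x v) \<and> sqrt (quad c x v) \<le> \<eta> * norm (L *v v)"
      using \<eta> by (auto simp: w_def intro: real_le_rsqrt real_le_lsqrt)
  next
    fix x assume x: "x \<in> fst c" "L *v snd c x \<in> cball (L *v snd c x0) \<rho>"
    have "det (M x) = det (g c x) * (det B)\<^sup>2"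
      by (simp add: M_def det_mul det_transpose power2_eq_square)
    then have "sqrt (det (M x)) = sqrt (det (g c x)) * \<bar>det B\<bar>" by (simp add: real_sqrt_mult)
    then show "1 / \<eta> \<le> sqrt (det (g c x)) * \<bar>det B\<bar> \<and> sqrt (det (g c x)) * \<bar>det B\<bar> \<le> \<eta>"
      using inN[OF x] by (simp add: N_def)
  qed (fact c \<eta> BL \<rho>)+
qed

text \<open>The fundamental theorem of calculus along the curve, with the derivative dominated by
  the speed. The time \<open>T\<close> is there because the curve may later leave the region where
  the metric is controlled.\<close>

lemma frame_length_bound:
  assumes c: "c \<in> \<A>" and \<eta>: "\<eta> > 0" and \<gamma>: "piecewise_C1_curve \<A> \<gamma>"
    and T: "0 \<le> T" "T \<le> 1" and sub: "\<And>t. t \<in> {0..T} \<Longrightarrow> \<gamma> t \<in> fst c"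
    and low: "\<And>t v. t \<in> {0..T} \<Longrightarrow> norm (L *v v) \<le> \<eta> * sqrt (quad c (\<gamma> t) v)"
  shows "norm (L *v snd c (\<gamma> T) - L *v snd c (\<gamma> 0)) \<le> \<eta> * curve_length \<A> g \<gamma>"
proof -
  obtain S where S: "finite S" "curve_speed \<A> g \<gamma> integrable_on {0..1}"
    "\<And>t c. t \<in> {0<..<1} - S \<Longrightarrow> c \<in> \<A> \<Longrightarrow> \<gamma> t \<in> fst c \<Longrightarrow>
      \<exists>v. ((\<lambda>s. snd c (\<gamma> s)) has_vector_derivative v) (at t) \<and> curve_speed \<A> g \<gamma> t = sqrt (quad c (\<gamma> t) v)"
    by (rule piecewise_C1_curve_regular[OF \<gamma>]) blast
  define f where "f t = L *v snd c (\<gamma> t)" for t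
  have D: "\<exists>w. (f has_vector_derivative w) (at t) \<and> norm w \<le> \<eta> * curve_speed \<A> g \<gamma> t"
    if t: "t \<in> {0<..<T} - S" for t
  proof -
    have t': "t \<in> {0<..<1} - S" "t \<in> {0..T}" using t T by auto
    obtain v where v: "((\<lambda>s. snd c (\<gamma> s)) has_vector_derivative v) (at t)"
        "curve_speed \<A> g \<gamma> t = sqrt (quad c (\<gamma> t) v)"
      using S(3)[OF t'(1) c sub[OF t'(2)]] by blast
    have "(f has_vector_derivative L *v v) (at t)"
      unfolding f_def
      by (rule bounded_linear.has_vector_derivative[OF matrix_vector_mul_bounded_linear v(1)])
    then show ?thesis using low[OF t'(2), of v] v(2) by auto
  qed
  \<comment> \<open>The value 0 at the bad times lets the norm bound hold at every
    \<open>t\<close>.\<close>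
  define f' where "f' t = (if t \<in> {0<..<T} - S then vector_derivative f (at t) else 0)" for t
  have f': "(f has_vector_derivative f' t) (at t)" if "t \<in> {0<..<T} - S" for t
    using D[OF that] that by (auto simp: f'_def vector_derivative_at)
  have n: "norm (f' t) \<le> \<eta> * curve_speed \<A> g \<gamma> t" for t
  proof (cases "t \<in> {0<..<T} - S")
    case True
    then show ?thesis using D[OF True] by (auto simp: f'_def vector_derivative_at)
  next
    case False
    then have "f' t = 0" unfolding f'_def by (rule if_not_P)
    then show ?thesis using \<eta> curve_speed_nonneg[of \<gamma> t] by simp
  qed
  have "continuous_on {0..T} \<gamma>"
    using \<gamma> T by (auto simp: piecewise_C1_curve_def intro: continuous_on_subset)
  then have "continuous_on {0..T} (\<lambda>t. snd c (\<gamma> t))"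
    by (intro continuous_on_compose2[OF chart(4)[OF c]]) (use sub in auto)
  then have cont: "continuous_on {0..T} f"
    unfolding f_def
    by (intro bounded_linear.continuous_on[OF matrix_vector_mul_bounded_linear])
  have I: "(f' has_integral (f T - f 0)) {0..T}"
    by (rule fundamental_theorem_of_calculus_interior_strong[OF S(1) T(1) f' cont])
  have "curve_speed \<A> g \<gamma> integrable_on {0..T}"
    using T by (intro integrable_on_subinterval[OF S(2)]) auto
  then have i: "(\<lambda>t. \<eta> * curve_speed \<A> g \<gamma> t) integrable_on {0..T}"
    using integrable_cmul[of "curve_speed \<A> g \<gamma>" "{0..T}" \<eta>] by simp
  have "norm (f T - f 0) \<le> integral {0..T} (\<lambda>t. \<eta> * curve_speed \<A> g \<gamma> t)"
    using integral_norm_bound_integral[OF has_integral_integrable[OF I] i n] integral_unique[OF I] by simp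
  also have "\<dots> = \<eta> * integral {0..T} (curve_speed \<A> g \<gamma>)" by simp
  also have "\<dots> \<le> \<eta> * curve_length \<A> g \<gamma>"
    unfolding curve_length_def using T S(2) \<eta>
    by (intro mult_left_mono integral_subset_le integrable_on_subinterval[OF S(2)])
      (auto intro: curve_speed_nonneg)
  finally show ?thesis by (simp add: f_def)
qed

end

section \<open>The distance compared with frame coordinates\<close>

context normal_frame
begin

definition \<kappa> :: "'a \<Rightarrow> real ^ 'n" where "\<kappa> x = L *v snd c x"

lemma B_\<kappa>: "B *v \<kappa> x = snd c x" by (simp add: \<kappa>_def matrix_vector_mul_assoc BL)

lemma \<kappa>_onto: assumes "z \<in> cball (\<kappa> x0) \<rho>"
  shows "inv_chart c (B *v z) \<in> fst c" "\<kappa> (inv_chart c (B *v z)) = z"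
    "snd c (inv_chart c (B *v z)) = B *v z"
proof -
  have z: "B *v z \<in> snd c ` fst c" using range assms by (simp add: \<kappa>_def)
  show "inv_chart c (B *v z) \<in> fst c" using z by (rule inv_into_into)
  show "snd c (inv_chart c (B *v z)) = B *v z" by (rule f_inv_into_f[OF z])
  then show "\<kappa> (inv_chart c (B *v z)) = z"
    by (simp add: \<kappa>_def matrix_vector_mul_assoc BL)
qed

text \<open>The segment between the two points in frame coordinates stays in the convex ball, where
  the metric is at most \<open>\<eta>\<close> times the Euclidean one.\<close>

lemma dist_le_frame:
  assumes x: "x \<in> fst c" "\<kappa> x \<in> cball (\<kappa> x0) \<rho>" and y: "y \<in> fst c" "\<kappa> y \<in> cball (\<kappa> x0) \<rho>"
  shows "d x y \<le> \<eta> * norm (\<kappa> y - \<kappa> x)"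
proof -
  let ?w = "\<lambda>s. snd c x + s *\<^sub>R (snd c y - snd c x)"
  let ?\<gamma> = "\<lambda>s. inv_chart c (?w s)"
  have lin: "?w s = B *v (\<kappa> x + s *\<^sub>R (\<kappa> y - \<kappa> x))" for s
    by (simp add: matrix_vector_right_distrib matrix_vector_mult_scaleR matrix_vector_mult_diff_distrib B_\<kappa>)
  have seg: "\<kappa> x + s *\<^sub>R (\<kappa> y - \<kappa> x) \<in> cball (\<kappa> x0) \<rho>" if "s \<in> {0..1}" for s
  proof -
    have "\<kappa> x + s *\<^sub>R (\<kappa> y - \<kappa> x) = (1 - s) *\<^sub>R \<kappa> x + s *\<^sub>R \<kappa> y" by (simp add: algebra_simps)
    then show ?thesis using convexD_alt[OF convex_cball x(2) y(2), of s] that by simp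
  qed
  have w: "?w s \<in> snd c ` fst c" if "s \<in> {0..1}" for s
    unfolding lin using range seg[OF that] by (simp add: \<kappa>_def)
  have q: "quad c (?\<gamma> s) (snd c y - snd c x) \<le> (\<eta> * norm (\<kappa> y - \<kappa> x))\<^sup>2" if s: "s \<in> {0..1}" for s
  proof -
    note o = \<kappa>_onto[OF seg[OF s]]
    have "?\<gamma> s \<in> fst c" "\<kappa> (?\<gamma> s) \<in> cball (\<kappa> x0) \<rho>" unfolding lin using o seg[OF s] by auto
    then have "sqrt (quad c (?\<gamma> s) (snd c y - snd c x)) \<le> \<eta> * norm (L *v (snd c y - snd c x))"
      using quad_frame[of "?\<gamma> s"] by (simp add: \<kappa>_def)
    also have "L *v (snd c y - snd c x) = \<kappa> y - \<kappa> x" by (simp add: \<kappa>_def matrix_vector_mult_diff_distrib)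
    finally show ?thesis by (rule sqrt_le_D)
  qed
  have "d (?\<gamma> 0) (?\<gamma> 1) \<le> curve_length \<A> g ?\<gamma>"
    by (rule dist_le_length[OF segment_curve(1)[OF c(1) w]])
  also have "\<dots> \<le> \<eta> * norm (\<kappa> y - \<kappa> x)"
    by (rule segment_curve(2)[OF c(1) w q]) (use \<eta> in auto)
  finally show ?thesis using x(1) y(1) chart(3)[OF c(1)] by (simp add: inv_into_f_f)
qed

text \<open>Closed in the whole manifold and not merely in the chart: it is the continuous image of
  a compact ball in a Hausdorff space. Hence the limit of a curve running inside it cannot escape
  from the chart.\<close>

lemma closed_frame_ball: "closed {x \<in> fst c. \<kappa> x \<in> cball (\<kappa> x0) \<rho>}"
proof -
  have "{x \<in> fst c. \<kappa> x \<in> cball (\<kappa> x0) \<rho>} = (\<lambda>z. inv_chart c (B *v z)) ` cball (\<kappa> x0) \<rho>"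
  proof (intro set_eqI iffI)
    fix x assume x: "x \<in> {x \<in> fst c. \<kappa> x \<in> cball (\<kappa> x0) \<rho>}"
    then have "x = inv_chart c (B *v \<kappa> x)" using chart(3)[OF c(1)] by (simp add: B_\<kappa> inv_into_f_f)
    then show "x \<in> (\<lambda>z. inv_chart c (B *v z)) ` cball (\<kappa> x0) \<rho>" using x by blast
  next
    fix x assume "x \<in> (\<lambda>z. inv_chart c (B *v z)) ` cball (\<kappa> x0) \<rho>"
    then show "x \<in> {x \<in> fst c. \<kappa> x \<in> cball (\<kappa> x0) \<rho>}" using \<kappa>_onto by auto
  qed
  moreover have "continuous_on (cball (\<kappa> x0) \<rho>) (\<lambda>z. inv_chart c (B *v z))"
  proof (rule continuous_on_compose2[OF chart(5)[OF c(1)]])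
    show "continuous_on (cball (\<kappa> x0) \<rho>) ((*v) B)"
      by (intro linear_continuous_on matrix_vector_mul_bounded_linear)
    show "(*v) B ` cball (\<kappa> x0) \<rho> \<subseteq> snd c ` fst c"
      unfolding \<kappa>_def by (rule image_subsetI) (rule range)
  qed
  ultimately show ?thesis by (metis compact_cball compact_continuous_image compact_imp_closed)
qed

lemma open_frame_vimage: "open V \<Longrightarrow> open {x \<in> fst c. \<kappa> x \<in> V}"
proof -
  assume "open V"
  then have "open ((*v) L -` V)"
    by (rule open_matrix_vimage)
  from open_chart_vimage[OF c(1) this] show ?thesis by (simp add: \<kappa>_def)
qed

text \<open>A curve that leaves the frame ball has covered at least half its radius before its exit time.\<close>

lemma dist_less_frame:
  assumes x: "x \<in> fst c" "\<kappa> x \<in> ball (\<kappa> x0) (\<rho> / 2)" and r: "d x y < r" "\<eta> * r \<le> \<rho> / 2"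
  shows "y \<in> fst c" "norm (\<kappa> y - \<kappa> x) < \<eta> * r" "\<kappa> y \<in> ball (\<kappa> x0) \<rho>"
proof -
  obtain \<gamma> where \<gamma>: "piecewise_C1_curve \<A> \<gamma>" "\<gamma> 0 = x" "\<gamma> 1 = y" "curve_length \<A> g \<gamma> < r"
    using dist_less_curve[OF r(1)] by blast
  define K where "K = {z \<in> fst c. \<kappa> z \<in> cball (\<kappa> x0) \<rho>}"
  define W where "W = {z \<in> fst c. \<kappa> z \<in> ball (\<kappa> x0) \<rho>}"
  have cont: "continuous_on {0..1} \<gamma>" using \<gamma>(1) by (simp add: piecewise_C1_curve_def)
  have bound: "norm (\<kappa> (\<gamma> T) - \<kappa> x) < \<eta> * r" if T: "0 \<le> T" "T \<le> 1" "\<And>t. t \<in> {0..T} \<Longrightarrow> \<gamma> t \<in> K" for T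
  proof -
    have "norm (L *v snd c (\<gamma> T) - L *v snd c (\<gamma> 0)) \<le> \<eta> * curve_length \<A> g \<gamma>"
    proof (rule frame_length_bound[OF c(1) _ \<gamma>(1) T(1,2)])
      fix t v assume "t \<in> {0..T}"
      then have "norm (L *v v) / \<eta> \<le> sqrt (quad c (\<gamma> t) v)"
        using T(3)[of t] quad_frame[of "\<gamma> t" v] by (auto simp: K_def \<kappa>_def)
      then show "norm (L *v v) \<le> \<eta> * sqrt (quad c (\<gamma> t) v)" using \<eta> by (simp add: field_simps)
    qed (use T \<eta> in \<open>auto simp: K_def\<close>)
    also have "\<dots> < \<eta> * r" using \<gamma>(4) \<eta> by simp
    finally show ?thesis by (simp add: \<kappa>_def \<gamma>(2))
  qed
  have stay: "norm (\<kappa> z - \<kappa> x0) < \<rho>" if "norm (\<kappa> z - \<kappa> x) < \<eta> * r" for z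
  proof -
    have "norm (\<kappa> z - \<kappa> x0) \<le> norm (\<kappa> z - \<kappa> x) + norm (\<kappa> x - \<kappa> x0)"
      using norm_triangle_ineq[of "\<kappa> z - \<kappa> x" "\<kappa> x - \<kappa> x0"] by simp
    also have "\<dots> < \<eta> * r + \<rho> / 2" using that x by (simp add: dist_norm norm_minus_commute)
    finally show ?thesis using r by simp
  qed
  have inW: "\<gamma> t \<in> W" if t: "t \<in> {0..1}" for t
  proof (rule ccontr)
    assume neg: "\<gamma> t \<notin> W"
    \<comment> \<open>The infimum of these times is the exit time of the curve from the open frame
      ball; it is attained because \<open>E\<close> is closed.\<close>
    define E where "E = {t \<in> {0..1}. \<gamma> t \<in> - W}"
    have "open W" unfolding W_def by (rule open_frame_vimage) simp
    then have "closed ({0..1} \<inter> \<gamma> -` (- W))"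
      by (intro continuous_closed_preimage[OF cont]) (auto simp: closed_Compl)
    moreover have "{0..1} \<inter> \<gamma> -` (- W) = E" by (auto simp: E_def)
    ultimately have "closed E" by simp
    moreover have "E \<noteq> {}" using neg t by (auto simp: E_def)
    moreover have "bdd_below E" by (rule bdd_belowI[of _ 0]) (auto simp: E_def)
    ultimately have "Inf E \<in> E" by (rule closed_contains_Inf[rotated 2])
    define T where "T = Inf E"
    have T: "T \<in> {0..1}" "\<gamma> T \<notin> W" using \<open>Inf E \<in> E\<close> by (auto simp: E_def T_def)
    have before: "\<gamma> s \<in> W" if "0 \<le> s" "s < T" for s
    proof (rule ccontr)
      assume "\<gamma> s \<notin> W"
      then have "s \<in> E" using that T by (auto simp: E_def)
      then have "T \<le> s" unfolding T_def using \<open>bdd_below E\<close> by (rule cInf_lower)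
      then show False using that by simp
    qed
    have "x \<in> W" using x \<rho> by (simp add: W_def)
    then have "T \<noteq> 0" using T \<gamma>(2) by auto
    then have T0: "T > 0" using T by simp
    have "closed {s \<in> {0..T}. \<gamma> s \<in> K}"
    proof -
      have "continuous_on {0..T} \<gamma>" using continuous_on_subset[OF cont] T by auto
      then show ?thesis
        using continuous_closed_preimage[of "{0..T}" \<gamma> K] closed_frame_ball
        by (simp add: K_def vimage_def Int_def)
    qed
    \<comment> \<open>Before \<open>T\<close> the curve lies in the closed frame ball, hence by
      closedness also at \<open>T\<close>. The length bound is then available up to \<open>T\<close>
      and places \<open>\<gamma> T\<close> strictly inside, a contradiction.\<close>
    moreover have "{0..<T} \<subseteq> {s \<in> {0..T}. \<gamma> s \<in> K}" 
    proof
      fix s assume s: "s \<in> {0..<T}"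
      moreover have "W \<subseteq> K" by (auto simp: W_def K_def)
      ultimately show "s \<in> {s \<in> {0..T}. \<gamma> s \<in> K}" using before[of s] by auto
    qed
    ultimately have "closure {0..<T} \<subseteq> {s \<in> {0..T}. \<gamma> s \<in> K}" by (rule closure_minimal[rotated])
    then have K: "\<And>s. s \<in> {0..T} \<Longrightarrow> \<gamma> s \<in> K" using T0 by auto
    then have "norm (\<kappa> (\<gamma> T) - \<kappa> x) < \<eta> * r" using T by (intro bound) auto
    then have "\<gamma> T \<in> W"
      using stay[of "\<gamma> T"] K[of T] T0 by (auto simp: W_def K_def dist_norm norm_minus_commute)
    then show False using T by simp
  qed
  then have "y \<in> W" using \<gamma>(3) by force
  then show "y \<in> fst c" "\<kappa> y \<in> ball (\<kappa> x0) \<rho>" by (auto simp: W_def)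
  have "\<gamma> s \<in> K" if "s \<in> {0..1}" for s using inW[OF that] by (auto simp: W_def K_def)
  then show "norm (\<kappa> y - \<kappa> x) < \<eta> * r" using bound[of 1] \<gamma>(3) by auto
qed

end

section \<open>Finite measures with the same uniform ball estimates\<close>

section \<open>Isometries preserve the volume\<close>

definition ball_measure_in :: "'a measure \<Rightarrow> ('a \<Rightarrow> 'a \<Rightarrow> real) \<Rightarrow> real \<Rightarrow> real \<Rightarrow> real \<Rightarrow> 'a \<Rightarrow> bool" where
  "ball_measure_in m d r h H x \<longleftrightarrow>
     ennreal h \<le> emeasure m {y. d x y < r} \<and> emeasure m {y. d x y < r} \<le> ennreal H"

text \<open>Double counting of pairs at distance below r. For C with distance at least r to the
  complement of U, h m(C) is at most the product mass of the pairs starting in C; these end in U,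
  and the pairs ending in U have mass at most (1 + e) h m'(U). The common h, the same for all
  centres and both measures, cancels.\<close>

lemma finite_measure_eq_of_uniform_balls:
  fixes m m' :: "'a::second_countable_topology measure" and d :: "'a \<Rightarrow> 'a \<Rightarrow> real"
  assumes sets: "sets m = sets borel" "sets m' = sets borel"
    and fin: "finite_measure m" "finite_measure m'"
    and d: "continuous_on UNIV (\<lambda>(x, y). d x y)" "\<And>x y. d x y = d y x" "\<And>x. d x x = 0"
    and base: "\<And>x U. open U \<Longrightarrow> x \<in> U \<Longrightarrow> \<exists>r>0. \<forall>y. d x y < r \<longrightarrow> y \<in> U"
    and unif: "\<And>e. 0 < e \<Longrightarrow> \<exists>r0>0. \<forall>r. 0 < r \<and> r < r0 \<longrightarrow> (\<exists>h>0. \<forall>x.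
        ball_measure_in m d r h ((1 + e) * h) x \<and> ball_measure_in m' d r h ((1 + e) * h) x)"
  shows "m = m'"
proof -
  have le: "emeasure m U \<le> emeasure m' U"
    if sets: "sets m = sets borel" "sets m' = sets borel"
      and fin: "finite_measure m" "finite_measure m'"
      and unif: "\<And>e. 0 < e \<Longrightarrow> \<exists>r0>0. \<forall>r. 0 < r \<and> r < r0 \<longrightarrow> (\<exists>h>0. \<forall>x.
        ball_measure_in m d r h ((1 + e) * h) x \<and> ball_measure_in m' d r h ((1 + e) * h) x)"
      and U: "open U" for m m' :: "'a measure" and U
  proof -
    interpret m: finite_measure m by fact
    interpret m': finite_measure m' by fact
    interpret pair_sigma_finite m m' by standard
    \<comment> \<open>Closed sets increasing to \<open>U\<close>, whose distance to the complement
      of \<open>U\<close> is bounded below.\<close>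
    define C where "C k = {x. \<forall>y. y \<notin> U \<longrightarrow> 1 / real (Suc k) \<le> d x y}" for k
    have contx: "continuous_on UNIV (\<lambda>x. d x y)" for y
    proof -
      have "continuous_on UNIV (\<lambda>x. (x, y))" by (intro continuous_intros)
      from continuous_on_compose2[OF d(1) this] show ?thesis by simp
    qed
    have "closed (C k)" for k
    proof -
      have "C k = (\<Inter>y\<in>- U. {x. 1 / real (Suc k) \<le> d x y})" by (auto simp: C_def)
      then show ?thesis
        by (auto intro!: closed_INT closed_Collect_le continuous_intros contx)
    qed
    then have Cm: "C k \<in> sets m" for k using sets by simp
    have Cinc: "incseq C"
    proof (rule incseq_SucI, rule subsetI)
      fix k x assume x: "x \<in> C k"
      have "1 / real (Suc (Suc k)) \<le> 1 / real (Suc k)" by (intro divide_left_mono) auto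
      then show "x \<in> C (Suc k)" using x unfolding C_def by (blast intro: order_trans)
    qed
    have CU: "(\<Union>k. C k) = U"
    proof (intro set_eqI iffI)
      fix x assume "x \<in> (\<Union>k. C k)"
      then obtain k where "x \<in> C k" by blast
      then show "x \<in> U" using d(3)[of x] by (force simp: C_def)
    next
      fix x assume "x \<in> U"
      then obtain r where r: "r > 0" "\<And>y. d x y < r \<Longrightarrow> y \<in> U" using base[OF U] by blast
      obtain k where "1 / real (Suc k) < r" using nat_approx_posE[OF r(1)] by blast
      then have "x \<in> C k" using r(2) unfolding C_def by (force simp: not_less[symmetric])
      then show "x \<in> (\<Union>k. C k)" by blast
    qed
    have Um: "U \<in> sets m'" "U \<in> sets m" using U sets by auto
    have openP: "open {w. d (fst w) (snd w) < r}" for r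
      using open_Collect_less[OF d(1) continuous_on_const[of UNIV r]] by (simp add: case_prod_beta)
    have sP: "sets (m \<Otimes>\<^sub>M m') = sets borel"
      unfolding sets_pair_measure_cong[OF sets] borel_prod ..
    have ball: "{y. d x y < r} \<in> sets borel" for x r
    proof -
      have "{y. d x y < r} = {y. d y x < r}" using d(2) by simp
      then show ?thesis using open_Collect_less[OF contx[of x] continuous_on_const[of UNIV r]] by auto
    qed
    have step: "emeasure m (C k) \<le> ennreal (1 + e) * emeasure m' U" if e: "e > 0" for k e
    proof -
      obtain r0 where r0: "r0 > 0" "\<And>r. 0 < r \<Longrightarrow> r < r0 \<Longrightarrow> \<exists>h>0. \<forall>x.
          ball_measure_in m d r h ((1 + e) * h) x \<and> ball_measure_in m' d r h ((1 + e) * h) x"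
        using unif[OF e] by blast
      \<comment> \<open>The second entry guarantees that points within \<open>r\<close> of
        \<open>C k\<close> still belong to \<open>U\<close>.\<close>
      define r where "r = min (r0 / 2) (1 / real (Suc k))"
      have r: "0 < r" "r < r0" "r \<le> 1 / real (Suc k)" using r0(1) by (auto simp: r_def)
      obtain h where h: "0 < h" "\<And>x. emeasure m {y. d x y < r} \<le> ennreal ((1 + e) * h)"
        "\<And>x. ennreal h \<le> emeasure m' {y. d x y < r}" 
        using r0(2)[OF r(1,2)] unfolding ball_measure_in_def by blast
      define P where "P = {w. d (fst w) (snd w) < r}"
      have Pm: "P \<in> sets (m \<Otimes>\<^sub>M m')" unfolding P_def sP using openP by simp
      have "ennreal h * emeasure m (C k) = (\<integral>\<^sup>+x. ennreal h * indicator (C k) x \<partial>m)"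
        using Cm by (simp add: nn_integral_cmult_indicator)
      also have "\<dots> \<le> (\<integral>\<^sup>+x. emeasure m' {y. d x y < r} * indicator (C k) x \<partial>m)"
        by (intro nn_integral_mono mult_right_mono h) auto
      also have "\<dots> = (\<integral>\<^sup>+x. (\<integral>\<^sup>+y. indicator (C k) x * indicator P (x, y) \<partial>m') \<partial>m)"
      proof (intro nn_integral_cong)
        fix x
        have "(\<integral>\<^sup>+y. indicator (C k) x * indicator P (x, y) \<partial>m') =
            (\<integral>\<^sup>+y. indicator (C k) x * indicator {y. d x y < r} y \<partial>m')"
          by (intro nn_integral_cong) (auto simp: P_def indicator_def)
        also have "\<dots> = emeasure m' {y. d x y < r} * indicator (C k) x"
          using ball sets by (simp add: nn_integral_cmult_indicator mult.commute)
        finally show "emeasure m' {y. d x y < r} * indicator (C k) x =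
           (\<integral>\<^sup>+y. indicator (C k) x * indicator P (x, y) \<partial>m')" by simp
      qed
      also have "\<dots> \<le> (\<integral>\<^sup>+x. (\<integral>\<^sup>+y. indicator U y * indicator P (x, y) \<partial>m') \<partial>m)"
      proof (intro nn_integral_mono)
        fix x y
        show "(indicator (C k) x * indicator P (x, y) :: ennreal) \<le> indicator U y * indicator P (x, y)"
          using r(3) by (force simp: indicator_def C_def P_def)
      qed
      also have "\<dots> = (\<integral>\<^sup>+y. (\<integral>\<^sup>+x. indicator U y * indicator P (x, y) \<partial>m) \<partial>m')"
      proof (rule Fubini'[symmetric])
        have "(\<lambda>w. indicator U (snd w) * indicator P w :: ennreal) \<in> borel_measurable (m \<Otimes>\<^sub>M m')"
          by (intro borel_measurable_times_ennreal measurable_compose[OF measurable_snd borel_measurable_indicator]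
              borel_measurable_indicator Pm Um)
        moreover have "(\<lambda>w. indicator U (snd w) * indicator P w :: ennreal) =
            (\<lambda>(x, y). indicator U y * indicator P (x, y))" by auto
        ultimately show "(\<lambda>(x, y). indicator U y * indicator P (x, y) :: ennreal) \<in> borel_measurable (m \<Otimes>\<^sub>M m')"
          by simp
      qed
      also have "\<dots> = (\<integral>\<^sup>+y. emeasure m {x. d y x < r} * indicator U y \<partial>m')"
      proof (intro nn_integral_cong)
        fix y
        have "(\<integral>\<^sup>+x. indicator U y * indicator P (x, y) \<partial>m) =
            (\<integral>\<^sup>+x. indicator U y * indicator {x. d y x < r} x \<partial>m)"
          by (intro nn_integral_cong) (auto simp: P_def indicator_def d(2)[of y])
        also have "\<dots> = emeasure m {x. d y x < r} * indicator U y"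
          using ball sets by (simp add: nn_integral_cmult_indicator mult.commute)
        finally show "(\<integral>\<^sup>+x. indicator U y * indicator P (x, y) \<partial>m) = emeasure m {x. d y x < r} * indicator U y" .
      qed
      also have "\<dots> \<le> (\<integral>\<^sup>+y. ennreal ((1 + e) * h) * indicator U y \<partial>m')"
        by (intro nn_integral_mono mult_right_mono h) auto
      also have "\<dots> = ennreal ((1 + e) * h) * emeasure m' U"
        by (rule nn_integral_cmult_indicator[OF Um(1)])
      also have "\<dots> = ennreal h * (ennreal (1 + e) * emeasure m' U)"
        using e h(1) by (subst ennreal_mult) (auto simp: mult_ac)
      finally show ?thesis using h(1) by (subst (asm) ennreal_mult_le_mult_iff) auto
    qed
    have "emeasure m (C k) \<le> emeasure m' U" for k
    proof (rule ennreal_le_epsilon)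
      fix e :: real assume "e > 0"
      define a where "a = measure m' U"
      have a: "emeasure m' U = ennreal a" "a \<ge> 0" by (simp_all add: a_def m'.emeasure_eq_measure)
      \<comment> \<open>Adding 1 keeps the denominator positive when \<open>U\<close> is a null
        set.\<close>
      define e' where "e' = e / (a + 1)"
      have e': "e' > 0" "e' * a \<le> e" using \<open>e > 0\<close> a(2) by (simp_all add: e'_def field_simps)
      have "emeasure m (C k) \<le> ennreal ((1 + e') * a)"
        using step[OF e'(1), of k] e'(1) a by (simp add: ennreal_mult)
      also have "\<dots> \<le> ennreal (a + e)" using e' by (intro ennreal_leI) (simp add: algebra_simps)
      finally show "emeasure m (C k) \<le> emeasure m' U + ennreal e"
        using a \<open>e > 0\<close> by simp
    qed
    then have "(SUP k. emeasure m (C k)) \<le> emeasure m' U" by (intro SUP_least)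
    moreover have "(SUP k. emeasure m (C k)) = emeasure m U"
      using SUP_emeasure_incseq[of C m] Cm Cinc CU by auto
    ultimately show ?thesis by simp
  qed
  have eq: "emeasure m U = emeasure m' U" if "open U" for U
  proof (rule antisym)
    show "emeasure m U \<le> emeasure m' U" by (rule le[OF sets fin unif that])
    show "emeasure m' U \<le> emeasure m U"
      by (rule le[OF sets(2,1) fin(2,1) _ that], subst conj_commute) (rule unif)
  qed
  interpret m: finite_measure m by fact
  show ?thesis
  proof (rule measure_eqI_generator_eq[where E = "{S. open S}" and \<Omega> = UNIV and A = "\<lambda>_. UNIV"])
    show "Int_stable {S :: 'a set. open S}" by (auto simp: Int_stable_def)
    show "sets m = sigma_sets UNIV {S. open S}" "sets m' = sigma_sets UNIV {S. open S}"
      using sets by (simp_all add: borel_def)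
    show "emeasure m UNIV \<noteq> \<infinity>" using m.emeasure_finite by simp
  qed (use eq in auto)
qed

section \<open>The distance induces the manifold topology\<close>

context riemannian_manifold
begin

lemma gdist_self: "d x x = 0"
proof -
  obtain c B L \<rho> where "normal_frame \<A> g c B L x (2::real) \<rho>" by (rule normal_frame_at[of 2 x]) auto
  then interpret normal_frame \<A> g c B L x 2 \<rho> .
  have "d x x \<le> 0" using dist_le_frame[of x x] c \<rho> by simp
  then show ?thesis using gdist_nonneg[of x x] by simp
qed

lemma dist_small_nhd: assumes e: "e > 0" shows "eventually (\<lambda>y. d x y < e) (nhds x)"
proof -
  \<comment> \<open>The frame factor 2 is an arbitrary number above 1; for the topology no sharp
    constant matters.\<close>
  obtain c B L \<rho> where "normal_frame \<A> g c B L x (2::real) \<rho>" by (rule normal_frame_at[of 2 x]) auto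
  then interpret normal_frame \<A> g c B L x 2 \<rho> .
  define s where "s = min \<rho> (e / 2)"
  have s: "s > 0" "s \<le> \<rho>" "2 * s \<le> e" using \<rho> e by (auto simp: s_def)
  define N where "N = {y \<in> fst c. \<kappa> y \<in> ball (\<kappa> x) s}"
  have "open N" unfolding N_def by (rule open_frame_vimage) simp
  moreover have "x \<in> N" using c s by (simp add: N_def)
  moreover have "d x y < e" if "y \<in> N" for y
  proof -
    have "d x y \<le> 2 * norm (\<kappa> y - \<kappa> x)"
      using that s c \<rho> by (intro dist_le_frame) (auto simp: N_def)
    also have "\<dots> < 2 * s" using that by (simp add: N_def dist_norm norm_minus_commute)
    finally show ?thesis using s by simp
  qed
  ultimately show ?thesis by (auto simp: eventually_nhds)
qed

lemma continuous_on_dist: "continuous_on UNIV (\<lambda>(x, y). d x y)"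
  unfolding continuous_on_def
proof
  fix w :: "'a \<times> 'a"
  obtain x y where w: "w = (x, y)" by (cases w)
  show "((\<lambda>(x, y). d x y) \<longlongrightarrow> (case w of (x, y) \<Rightarrow> d x y)) (at w within UNIV)"
  proof (rule tendstoI)
    fix e :: real assume e: "e > 0"
    have "filterlim fst (nhds x) (at w within UNIV)" "filterlim snd (nhds y) (at w within UNIV)"
      unfolding w using tendsto_fst[OF tendsto_ident_at] tendsto_snd[OF tendsto_ident_at] by (metis fst_conv, metis snd_conv)
    then have "eventually (\<lambda>v. d x (fst v) < e / 2) (at w within UNIV)"
      "eventually (\<lambda>v. d y (snd v) < e / 2) (at w within UNIV)"
      using dist_small_nhd[of "e / 2" x] dist_small_nhd[of "e / 2" y] e by (auto simp: filterlim_iff)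
    then show "eventually (\<lambda>v. dist (case v of (x, y) \<Rightarrow> d x y) (case w of (x, y) \<Rightarrow> d x y) < e) (at w within UNIV)"
    proof eventually_elim
      case (elim v)
      have "d (fst v) (snd v) \<le> d x (fst v) + d x y + d y (snd v)"
        using gdist_triangle[of "fst v" "snd v" x] gdist_triangle[of x "snd v" y] gdist_sym[of x "fst v"] by simp
      moreover have "d x y \<le> d x (fst v) + d (fst v) (snd v) + d y (snd v)"
        using gdist_triangle[of x y "fst v"] gdist_triangle[of "fst v" y "snd v"] gdist_sym[of y "snd v"] by simp
      ultimately show ?case using elim by (simp add: w case_prod_beta dist_real_def abs_less_iff)
    qed
  qed
qed

lemma open_dist_ball: "open {y. d x y < r}"
proof -
  have "continuous_on UNIV (\<lambda>y. (x, y))" by (intro continuous_intros)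
  from continuous_on_compose2[OF continuous_on_dist this]
  have "continuous_on UNIV (\<lambda>y. d x y)" by simp
  then show ?thesis using open_Collect_less[of "\<lambda>y. d x y" "\<lambda>_. r"] by simp
qed

text \<open>The converse of \<open>dist_small_nhd\<close>: distance balls form a neighbourhood base,
  which makes a map preserving the distance continuous.\<close>

lemma dist_ball_in_open:
  assumes V: "open V" "x \<in> V" shows "\<exists>r>0. \<forall>y. d x y < r \<longrightarrow> y \<in> V"
proof -
  obtain c B L \<rho> where "normal_frame \<A> g c B L x (2::real) \<rho>" by (rule normal_frame_at[of 2 x]) auto
  then interpret normal_frame \<A> g c B L x 2 \<rho> .
  have "snd c ` (fst c \<inter> V) = snd c ` fst c \<inter> inv_chart c -` V"
    using chart(3)[OF c(1)] by (auto simp: inv_into_f_f intro!: image_eqI)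
  then have "open (snd c ` (fst c \<inter> V))"
    using continuous_open_preimage[OF chart(5,2)[OF c(1)] V(1)] by simp
  then have "open ((*v) B -` (snd c ` (fst c \<inter> V)))"
    by (rule open_matrix_vimage)
  moreover have "\<kappa> x \<in> (*v) B -` (snd c ` (fst c \<inter> V))" using c V(2) by (simp add: B_\<kappa>)
  ultimately obtain e where e: "e > 0" "ball (\<kappa> x) e \<subseteq> (*v) B -` (snd c ` (fst c \<inter> V))"
    using open_contains_ball by blast
  \<comment> \<open>With frame factor 2, points at distance below \<open>r\<close> differ by less
    than \<open>2 * r\<close> in frame coordinates, provided that \<open>2 * r\<close> does not
    exceed half the frame radius.\<close>
  define r where "r = min (e / 2) (\<rho> / 4)"
  have r: "r > 0" "2 * r \<le> e" "2 * r \<le> \<rho> / 2" using e \<rho> by (auto simp: r_def)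
  have "y \<in> V" if y: "d x y < r" for y
  proof -
    have "y \<in> fst c" "norm (\<kappa> y - \<kappa> x) < 2 * r"
      using dist_less_frame[OF c(2) _ y r(3)] \<rho> by auto
    then have "\<kappa> y \<in> ball (\<kappa> x) e" using r by (simp add: dist_norm norm_minus_commute)
    then have "B *v \<kappa> y \<in> snd c ` (fst c \<inter> V)" using e(2) by blast
    then have "snd c y \<in> snd c ` (fst c \<inter> V)" by (simp add: B_\<kappa>)
    then show ?thesis using \<open>y \<in> fst c\<close> chart(3)[OF c(1)] by (auto simp: inj_on_def)
  qed
  then show ?thesis using r(1) by blast
qed

lemma isometry_continuous:
  assumes T: "isometry_of d T" shows "continuous_on UNIV T"
  unfolding continuous_on_open_vimage[OF open_UNIV]
proof (intro allI impI)
  fix V :: "'a set" assume V: "open V"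
  have "\<exists>N. open N \<and> x \<in> N \<and> N \<subseteq> T -` V" if x: "x \<in> T -` V" for x
  proof -
    obtain r where r: "r > 0" "\<And>y. d (T x) y < r \<Longrightarrow> y \<in> V" using dist_ball_in_open[OF V, of "T x"] x by auto
    obtain N where "open N" "x \<in> N" "\<And>y. y \<in> N \<Longrightarrow> d x y < r"
      using dist_small_nhd[OF r(1), of x] by (auto simp: eventually_nhds)
    moreover from this have "N \<subseteq> T -` V" using r(2) T by (auto simp: isometry_of_def)
    ultimately show ?thesis by blast
  qed
  then have "open (T -` V)" by (subst open_subopen) blast
  then show "open (T -` V \<inter> UNIV)" by simp
qed

end

section \<open>Volume of small geodesic balls\<close>

context normal_frame
begin

text \<open>The map \<open>B\<close> from frame to chart coordinates multiplies Lebesgue measure by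
  \<open>\<bar>det B\<bar>\<close>, and the Riemannian density carries the inverse of this factor up
  to \<open>\<eta>\<close>.\<close>

lemma frame_ball_volume:
  assumes vol: "is_riemannian_volume \<A> g \<nu>"
    and x: "x \<in> fst c" "\<kappa> x \<in> ball (\<kappa> x0) (\<rho> / 2)" and s: "0 \<le> s" "s \<le> \<rho> / 2"
  shows "ennreal (s ^ CARD('n) * unit_ball_vol (real CARD('n)) / \<eta>) \<le> emeasure \<nu> {y \<in> fst c. \<kappa> y \<in> ball (\<kappa> x) s}"
    and "emeasure \<nu> {y \<in> fst c. \<kappa> y \<in> ball (\<kappa> x) s} \<le> ennreal (\<eta> * (s ^ CARD('n) * unit_ball_vol (real CARD('n))))"
proof -
  define E where "E = {y \<in> fst c. \<kappa> y \<in> ball (\<kappa> x) s}"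
  define f where "f z = sqrt (det (g c (inv_chart c z)))" for z
  define Q where "Q = (*v) B ` ball (\<kappa> x) s"
  have sub: "ball (\<kappa> x) s \<subseteq> cball (\<kappa> x0) \<rho>"
  proof
    fix z assume "z \<in> ball (\<kappa> x) s"
    then have "dist (\<kappa> x0) z < \<rho> / 2 + s"
      using x(2) dist_triangle[of "\<kappa> x0" z "\<kappa> x"] by simp
    then show "z \<in> cball (\<kappa> x0) \<rho>" using s by simp
  qed
  have detB: "\<bar>det B\<bar> > 0" using BL(1) det_mul[of B L] by (auto simp: det_I)
  have EQ: "snd c ` E = Q"
  proof (intro set_eqI iffI)
    fix z assume "z \<in> snd c ` E"
    then obtain y where y: "y \<in> fst c" "\<kappa> y \<in> ball (\<kappa> x) s" "z = snd c y" by (auto simp: E_def)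
    then have "z = B *v \<kappa> y" by (simp add: B_\<kappa>)
    then show "z \<in> Q" using y(2) by (simp add: Q_def)
  next
    fix z assume "z \<in> Q"
    then obtain w where w: "w \<in> ball (\<kappa> x) s" "z = B *v w" by (auto simp: Q_def)
    note o = \<kappa>_onto[OF subsetD[OF sub w(1)]]
    then have "inv_chart c (B *v w) \<in> E" using w by (simp add: E_def)
    then show "z \<in> snd c ` E" using o(3) w(2) by (metis imageI)
  qed
  have "open E" unfolding E_def by (rule open_frame_vimage) simp
  then have \<nu>E: "emeasure \<nu> E = (\<integral>\<^sup>+z\<in>Q. ennreal (f z) \<partial>lborel)"
    using vol c(1) by (auto simp: is_riemannian_volume_def E_def f_def EQ[symmetric])
  have f: "1 / (\<eta> * \<bar>det B\<bar>) \<le> f z" "f z \<le> \<eta> / \<bar>det B\<bar>" if zQ: "z \<in> Q" for z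
  proof -
    obtain w where w: "w \<in> ball (\<kappa> x) s" "z = B *v w" using zQ by (auto simp: Q_def)
    have wc: "w \<in> cball (\<kappa> x0) \<rho>" using sub w(1) by blast
    note o = \<kappa>_onto[OF wc]
    have "1 / \<eta> \<le> f z * \<bar>det B\<bar>" "f z * \<bar>det B\<bar> \<le> \<eta>"
      using det_frame[of "inv_chart c (B *v w)"] o(1,2) wc
      by (simp_all add: f_def w(2) \<kappa>_def)
    then show "1 / (\<eta> * \<bar>det B\<bar>) \<le> f z" "f z \<le> \<eta> / \<bar>det B\<bar>"
      using detB \<eta> by (simp_all add: field_simps)
  qed
  have em: "emeasure lborel Q = ennreal (\<bar>det B\<bar> * (s ^ CARD('n) * unit_ball_vol (real CARD('n))))"
    unfolding Q_def by (rule emeasure_lborel_linear_ball[OF BL s(1)])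
  have "open Q" unfolding Q_def matrix_image_eq_vimage[OF BL] by (rule open_matrix_vimage) simp
  then have Qm: "Q \<in> sets lborel" by simp
  have "ennreal (s ^ CARD('n) * unit_ball_vol (real CARD('n)) / \<eta>) = ennreal (1 / (\<eta> * \<bar>det B\<bar>)) * emeasure lborel Q"
    unfolding em using detB \<eta> s by (subst ennreal_mult[symmetric]) (auto simp: field_simps)
  also have "\<dots> = (\<integral>\<^sup>+z. ennreal (1 / (\<eta> * \<bar>det B\<bar>)) * indicator Q z \<partial>lborel)"
    using Qm by (simp only: nn_integral_cmult_indicator)
  also have "\<dots> \<le> (\<integral>\<^sup>+z\<in>Q. ennreal (f z) \<partial>lborel)"
    by (intro nn_integral_mono) (auto simp: indicator_def intro: ennreal_leI f)
  finally show "ennreal (s ^ CARD('n) * unit_ball_vol (real CARD('n)) / \<eta>) \<le> emeasure \<nu> {y \<in> fst c. \<kappa> y \<in> ball (\<kappa> x) s}"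
    unfolding E_def[symmetric] \<nu>E .
  have "(\<integral>\<^sup>+z\<in>Q. ennreal (f z) \<partial>lborel) \<le> (\<integral>\<^sup>+z. ennreal (\<eta> / \<bar>det B\<bar>) * indicator Q z \<partial>lborel)"
    by (intro nn_integral_mono) (auto simp: indicator_def intro: ennreal_leI f)
  also have "\<dots> = ennreal (\<eta> / \<bar>det B\<bar>) * emeasure lborel Q"
    using Qm by (simp only: nn_integral_cmult_indicator)
  also have "\<dots> = ennreal (\<eta> * (s ^ CARD('n) * unit_ball_vol (real CARD('n))))"
    unfolding em using detB \<eta> s by (subst ennreal_mult[symmetric]) (auto simp: field_simps)
  finally show "emeasure \<nu> {y \<in> fst c. \<kappa> y \<in> ball (\<kappa> x) s} \<le> ennreal (\<eta> * (s ^ CARD('n) * unit_ball_vol (real CARD('n))))"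
    unfolding E_def[symmetric] \<nu>E .
qed

text \<open>The geodesic ball lies between the frame balls of radii \<open>r / \<eta>\<close> and
  \<open>\<eta> * r\<close>. The radius contributes \<open>\<eta>\<close> to the power of the
  dimension and the density one factor more.\<close>

lemma dist_ball_volume_local:
  assumes vol: "is_riemannian_volume \<A> g \<nu>"
    and x: "x \<in> fst c" "\<kappa> x \<in> ball (\<kappa> x0) (\<rho> / 2)" and r: "0 < r" "\<eta> * r \<le> \<rho> / 2"
  shows "ball_measure_in \<nu> d r (r ^ CARD('n) * unit_ball_vol (real CARD('n)) / \<eta> ^ Suc CARD('n))
    (\<eta> ^ Suc CARD('n) * (r ^ CARD('n) * unit_ball_vol (real CARD('n)))) x"
  unfolding ball_measure_in_def
proof -
  have sets: "sets \<nu> = sets borel" using vol by (simp add: is_riemannian_volume_def)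
  have "r / \<eta> \<le> r" "r \<le> \<eta> * r" using \<eta> r by (simp_all add: field_simps)
  then have "r / \<eta> \<le> \<rho> / 2" using r(2) by linarith
  then have s: "0 \<le> r / \<eta>" "r / \<eta> \<le> \<rho> / 2" "0 \<le> \<eta> * r" using r \<eta> by auto
  have ball: "{y. d x y < r} \<in> sets \<nu>"
    using open_dist_ball[of x r] sets by simp
  have fb: "{y \<in> fst c. \<kappa> y \<in> ball (\<kappa> x) t} \<in> sets \<nu>" for t
    using open_frame_vimage[of "ball (\<kappa> x) t"] sets by simp
  have "{y \<in> fst c. \<kappa> y \<in> ball (\<kappa> x) (r / \<eta>)} \<subseteq> {y. d x y < r}"
  proof clarify
    fix y assume y: "y \<in> fst c" "\<kappa> y \<in> ball (\<kappa> x) (r / \<eta>)"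
    have "dist (\<kappa> x0) (\<kappa> y) < \<rho> / 2 + r / \<eta>"
      using x(2) y(2) dist_triangle[of "\<kappa> x0" "\<kappa> y" "\<kappa> x"] by simp
    then have "dist (\<kappa> x0) (\<kappa> y) \<le> \<rho>" using s(2) by linarith
    then have "d x y \<le> \<eta> * norm (\<kappa> y - \<kappa> x)"
      using x y \<rho> by (intro dist_le_frame) auto
    also have "\<dots> < \<eta> * (r / \<eta>)"
      using y(2) \<eta> by (intro mult_strict_left_mono) (auto simp: dist_norm norm_minus_commute)
    finally show "d x y < r" using \<eta> by simp
  qed
  from emeasure_mono[OF this ball] frame_ball_volume(1)[OF vol x s(1,2)]
  have "ennreal ((r / \<eta>) ^ CARD('n) * unit_ball_vol (real CARD('n)) / \<eta>) \<le> emeasure \<nu> {y. d x y < r}" by (rule order_trans[rotated])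
  then have low: "ennreal (r ^ CARD('n) * unit_ball_vol (real CARD('n)) / \<eta> ^ Suc CARD('n)) \<le> emeasure \<nu> {y. d x y < r}"
    by (simp add: power_divide mult.commute)
  have "{y. d x y < r} \<subseteq> {y \<in> fst c. \<kappa> y \<in> ball (\<kappa> x) (\<eta> * r)}"
    using dist_less_frame(1,2)[OF x _ r(2)] by (auto simp: dist_norm norm_minus_commute)
  from emeasure_mono[OF this fb] frame_ball_volume(2)[OF vol x s(3) r(2)]
  have "emeasure \<nu> {y. d x y < r} \<le> ennreal (\<eta> * ((\<eta> * r) ^ CARD('n) * unit_ball_vol (real CARD('n))))" by (rule order_trans)
  then have "emeasure \<nu> {y. d x y < r} \<le> ennreal (\<eta> ^ Suc CARD('n) * (r ^ CARD('n) * unit_ball_vol (real CARD('n))))"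
    by (simp add: power_mult_distrib mult_ac)
  with low show "ennreal (r ^ CARD('n) * unit_ball_vol (real CARD('n)) / \<eta> ^ Suc CARD('n)) \<le> emeasure \<nu> {y. d x y < r} \<and>
      emeasure \<nu> {y. d x y < r} \<le> ennreal (\<eta> ^ Suc CARD('n) * (r ^ CARD('n) * unit_ball_vol (real CARD('n))))" ..
qed

end

context riemannian_manifold
begin

text \<open>Small geodesic balls have asymptotically the same volume, uniformly in the centre; this is
  what forces isometries, which are only assumed to preserve the distance, to preserve the volume.\<close>

lemma dist_ball_volume:
  assumes \<eta>: "\<eta> > 1" and vol: "is_riemannian_volume \<A> g \<nu>"
  obtains r0 where "r0 > 0" "\<And>r x. 0 < r \<Longrightarrow> r < r0 \<Longrightarrow>
      ball_measure_in \<nu> d r (r ^ CARD('n) * unit_ball_vol (real CARD('n)) / \<eta> ^ Suc CARD('n)) (\<eta> ^ Suc CARD('n) * (r ^ CARD('n) * unit_ball_vol (real CARD('n)))) x"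
proof -
  define P where "P r x \<longleftrightarrow>
      ball_measure_in \<nu> d r (r ^ CARD('n) * unit_ball_vol (real CARD('n)) / \<eta> ^ Suc CARD('n)) (\<eta> ^ Suc CARD('n) * (r ^ CARD('n) * unit_ball_vol (real CARD('n)))) x" for r x
  have "\<exists>N r0. open N \<and> x0 \<in> N \<and> r0 > 0 \<and> (\<forall>x\<in>N. \<forall>r. 0 < r \<and> r < r0 \<longrightarrow> P r x)" for x0
  proof -
    obtain c B L \<rho> where "normal_frame \<A> g c B L x0 \<eta> \<rho>" by (rule normal_frame_at[OF \<eta>])
    then interpret normal_frame \<A> g c B L x0 \<eta> \<rho> .
    define N where "N = {x \<in> fst c. \<kappa> x \<in> ball (\<kappa> x0) (\<rho> / 2)}"
    have "open N" unfolding N_def by (rule open_frame_vimage) simp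
    moreover have "x0 \<in> N" using c \<rho> by (simp add: N_def)
    moreover have "\<rho> / (2 * \<eta>) > 0" using \<rho> \<eta> by simp
    moreover have "P r x" if "x \<in> N" "0 < r" "r < \<rho> / (2 * \<eta>)" for x r
    proof -
      have "\<eta> * r \<le> \<rho> / 2" using that(3) \<eta> by (simp add: field_simps)
      then show ?thesis
        using dist_ball_volume_local[OF vol, of x r] that unfolding P_def N_def by blast
    qed
    ultimately show ?thesis by blast
  qed
  then obtain N R where N: "\<And>x. open (N x)" "\<And>x. x \<in> N x" "\<And>x. R x > (0::real)"
    "\<And>x0 x r. x \<in> N x0 \<Longrightarrow> 0 < r \<Longrightarrow> r < R x0 \<Longrightarrow> P r x" by metis
  have cpt: "compact (UNIV :: 'a set)" using manifold by (simp add: compact_riemannian_manifold_def)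
  obtain D where D: "D \<subseteq> UNIV" "finite D" "UNIV \<subseteq> (\<Union>x\<in>D. N x)"
    by (rule compactE_image[OF cpt, of UNIV N]) (use N(1,2) in auto)
  \<comment> \<open>Finitely many frames cover the compact manifold, and the least of their radii
    serves every centre.\<close>
  define r0 where "r0 = Min (R ` D)"
  have "D \<noteq> {}" using D(3) by auto
  then have r0: "r0 > 0" "\<And>x. x \<in> D \<Longrightarrow> r0 \<le> R x" using D(2) N(3) by (auto simp: r0_def)
  have "P r x" if "0 < r" "r < r0" for r x
  proof -
    obtain x0 where "x0 \<in> D" "x \<in> N x0" using D(3) by blast
    then show ?thesis using N(4)[of x x0 r] that r0(2)[of x0] by simp
  qed
  then show ?thesis using that[OF r0(1)] unfolding P_def by blast
qed

text \<open>The preimage of a ball under \<open>T\<close> is the ball of the same radius about the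
  preimage of its centre. As the ball estimates are uniform in the centre, \<open>\<mu>\<close> and
  its image satisfy the same ones.\<close>

lemma isometry_preserves_volume:
  assumes vol: "is_normalized_volume \<A> g \<mu>" and T: "isometry_of d T"
  shows "distr \<mu> borel T = \<mu>"
proof -
  obtain \<nu> q where \<mu>: "prob_space \<mu>" and \<nu>: "is_riemannian_volume \<A> g \<nu>" and q: "\<mu> = scale_measure q \<nu>"
    using vol by (auto simp: is_normalized_volume_def)
  interpret prob_space \<mu> by fact
  have sets: "sets \<mu> = sets borel" using \<nu> q by (simp add: is_riemannian_volume_def)
  have one: "q * emeasure \<nu> (space \<nu>) = 1" using emeasure_space_1 unfolding q by (simp add: space_scale_measure)
  \<comment> \<open>The normalising factor is positive and finite, for otherwise the total mass
    would be 0 or infinite.\<close>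
  then have "q \<noteq> 0" by auto
  moreover have "q \<noteq> \<top>"
  proof
    assume "q = \<top>"
    then show False using one by (cases "emeasure \<nu> (space \<nu>) = 0") (auto simp: ennreal_top_mult)
  qed
  ultimately obtain q' where q': "q = ennreal q'" "q' > 0"
    by (cases q rule: ennreal_cases) (auto simp: less_le)
  define V where "V = unit_ball_vol (real CARD('n))"
  have V: "V > 0" by (simp add: V_def)
  have Tm: "T \<in> measurable \<mu> borel"
    using borel_measurable_continuous_onI[OF isometry_continuous[OF T]] measurable_cong_sets[OF sets refl] by blast
  have iso: "d (T x) (T y) = d x y" for x y using T by (simp add: isometry_of_def)
  have ball: "{y. d x y < r} \<in> sets borel" for x r
    using open_dist_ball[of x r] by simp
  have "\<mu> = distr \<mu> borel T"
  proof (rule finite_measure_eq_of_uniform_balls[where d = d])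
    show "finite_measure (distr \<mu> borel T)" by (rule finite_measure_distr[OF Tm])
    fix e :: real assume e: "0 < e"
    define m where "m = 2 * Suc CARD('n)"
    \<comment> \<open>Upper and lower ball estimates differ by the factor \<open>\<eta>\<close> to
      the power \<open>2 * Suc CARD('n)\<close>, which is made equal to
      \<open>1 + e\<close>.\<close>
    define \<eta> where "\<eta> = root m (1 + e)"
    have m: "m > 0" by (simp add: m_def)
    have \<eta>: "\<eta> > 1" "\<eta> ^ m = 1 + e" using e m by (simp_all add: \<eta>_def real_root_gt_1_iff)
    obtain r0 where r0: "r0 > 0" "\<And>r x. 0 < r \<Longrightarrow> r < r0 \<Longrightarrow>
      ball_measure_in \<nu> d r (r ^ CARD('n) * V / \<eta> ^ Suc CARD('n)) (\<eta> ^ Suc CARD('n) * (r ^ CARD('n) * V)) x"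
      by (rule dist_ball_volume[OF \<eta>(1) \<nu>]) (simp add: V_def)
    show "\<exists>r0>0. \<forall>r. 0 < r \<and> r < r0 \<longrightarrow> (\<exists>h>0. \<forall>x. ball_measure_in \<mu> d r h ((1 + e) * h) x \<and>
        ball_measure_in (distr \<mu> borel T) d r h ((1 + e) * h) x)"
    proof (rule exI[of _ r0], intro conjI allI impI r0(1))
      fix r assume r: "0 < r \<and> r < r0"
      define h where "h = q' * (r ^ CARD('n) * V / \<eta> ^ Suc CARD('n))"
      have "h > 0" using q' V \<eta> r by (simp add: h_def)
      have h2: "(1 + e) * h = q' * (\<eta> ^ Suc CARD('n) * (r ^ CARD('n) * V))"
      proof -
        have "1 + e = \<eta> ^ Suc CARD('n) * \<eta> ^ Suc CARD('n)"
          unfolding \<eta>(2)[symmetric] m_def by (metis mult_2 power_add)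
        then show ?thesis using \<eta>(1) by (simp add: h_def)
      qed
      have \<mu>b: "ball_measure_in \<mu> d r h ((1 + e) * h) x" for x
      proof -
        have "ennreal h = ennreal q' * ennreal (r ^ CARD('n) * V / \<eta> ^ Suc CARD('n))"
          unfolding h_def using q'(2) by (intro ennreal_mult') simp
        moreover have "ennreal ((1 + e) * h) = ennreal q' * ennreal (\<eta> ^ Suc CARD('n) * (r ^ CARD('n) * V))"
          unfolding h2 using q'(2) by (intro ennreal_mult') simp
        ultimately show ?thesis
          using r0(2)[of r x] r unfolding ball_measure_in_def q emeasure_scale_measure q'(1)
          by (intro conjI) (auto intro: mult_left_mono simp del: power_Suc)
      qed
      have "emeasure (distr \<mu> borel T) {y. d x y < r} = emeasure \<mu> {y. d (inv T x) y < r}" for x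
      proof -
        have "x = T (inv T x)" using T by (simp add: isometry_of_def bij_is_surj surj_f_inv_f)
        then have "T -` {y. d x y < r} = {y. d (inv T x) y < r}" using iso[of "inv T x"] by auto
        then show ?thesis
          using emeasure_distr[OF Tm ball] sets_eq_imp_space_eq[OF sets] by simp
      qed
      then show "\<exists>h>0. \<forall>x. ball_measure_in \<mu> d r h ((1 + e) * h) x \<and>
          ball_measure_in (distr \<mu> borel T) d r h ((1 + e) * h) x"
        using \<mu>b \<open>h > 0\<close> by (intro exI[of _ h]) (simp add: ball_measure_in_def)
    qed
  qed (use sets finite_measure_axioms continuous_on_dist gdist_sym gdist_self dist_ball_in_open in auto)
  then show ?thesis by simp
qed

end

section \<open>The level of the test\<close>

theorem proposition7p1:
  fixes \<A> :: "('a::{t2_space,second_countable_topology}, 'n::finite) chart set"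
    and g :: "('a, 'n) chart \<Rightarrow> 'a \<Rightarrow> real ^ 'n ^ 'n"
    and \<mu> :: "'a measure"
    and \<phi> :: "(nat \<times> nat \<Rightarrow> real) \<Rightarrow> real"
    and p n :: nat
    and A \<alpha> :: real
    and P :: "'w measure"
    and X X' :: "nat \<Rightarrow> 'w \<Rightarrow> 'a"
  assumes "p \<ge> 1" and "cont_bdd p \<phi>" and "A > 0" and "sup_norm_le p \<phi> A"
    and "compact_riemannian_manifold \<A> g" and "is_normalized_volume \<A> g \<mu>"
    and "n \<ge> 1"
    and "prob_space P"
    and "prob_space.indep_vars P (\<lambda>_. borel) (case_sum X X') ({1..n} <+> {1..n})"
    and "\<And>i. i \<in> {1..n} \<Longrightarrow> distr P borel (X i) = \<mu>"
    and "\<And>i. i \<in> {1..n} \<Longrightarrow> distr P borel (X' i) = \<mu>"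
    and "0 < \<alpha>" and "\<alpha> < 1"
    and "homogeneous (geodesic_dist \<A> g)"
  shows "measure P {\<omega> \<in> space P.
           Z_stat n p \<phi> (geodesic_dist \<A> g) (\<lambda>i. X i \<omega>) (\<lambda>i. X' i \<omega>)
             \<ge> threshold A p \<alpha>} \<le> \<alpha>"
proof -
  interpret riemannian_manifold \<A> g by unfold_locales (fact assms(5))
  obtain \<nu> q where \<mu>: "prob_space \<mu>" and \<nu>: "is_riemannian_volume \<A> g \<nu>" "\<mu> = scale_measure q \<nu>"
    using assms(6) by (auto simp: is_normalized_volume_def)
  have sets: "sets \<mu> = sets borel" using \<nu> by (simp add: is_riemannian_volume_def)
  interpret \<mu>: prob_space \<mu> by fact
  interpret S: symmetric_sample \<mu> "geodesic_dist \<A> g" \<phi> p n A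
  proof
    show "space \<mu> = UNIV" using sets_eq_imp_space_eq[OF sets] by simp
    fix x y
    obtain T where T: "isometry_of d T" "T x = y" using assms(14) by (auto simp: homogeneous_def)
    have "T \<in> borel_measurable borel"
      by (rule borel_measurable_continuous_onI[OF isometry_continuous[OF T(1)]])
    then have m: "T \<in> measurable \<mu> \<mu>" using measurable_cong_sets[OF sets sets] by blast
    have "distr \<mu> \<mu> T = distr \<mu> borel T" by (rule distr_cong) (auto simp: sets)
    then have "distr \<mu> \<mu> T = \<mu>" by (simp add: isometry_preserves_volume[OF assms(6) T(1)])
    then show "\<exists>T. T \<in> measurable \<mu> \<mu> \<and> distr \<mu> \<mu> T = \<mu> \<and> (\<forall>u v. d (T u) (T v) = d u v) \<and> T x = y"
      using m T by (intro exI[of _ T]) (simp add: isometry_of_def)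
  qed (fact sets continuous_on_dist assms)+
  \<comment> \<open>With this exponent the moment condition becomes 1/e \<le> 1/2, and multiplying
    by the threshold gives x / e^2, where \<open>x\<close> is the preimage of
    \<open>\<alpha>\<close> under \<open>tail_F\<close>; this is the linear part of the exponent in
    \<open>tail_F\<close>.\<close>
  define \<theta> where "\<theta> = 1 / (exp 1 * (4 * A * (real p)\<^sup>2))"
  define x where "x = inv_into {0..} tail_F \<alpha>"
  have pos: "4 * A * (real p)\<^sup>2 > 0" using assms(1,3) by simp
  have "2 \<le> exp (1 :: real)" using exp_ge_add_one_self[of 1] by simp
  then have \<theta>: "0 \<le> \<theta>" "4 * A * (real p)\<^sup>2 * \<theta> \<le> 1 / 2"
    using pos assms(3) by (simp_all add: \<theta>_def)
  have "\<alpha> \<in> tail_F ` {0..}" using bij_betw_tail_F assms(12,13) by (auto simp: bij_betw_def)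
  then have x: "x \<ge> 0" "tail_F x = \<alpha>"
    unfolding x_def using inv_into_into[of \<alpha> tail_F "{0..}"] by (auto simp: f_inv_into_f)
  have \<theta>t: "\<theta> * threshold A p \<alpha> = x / (exp 1)\<^sup>2"
    using assms(1,3) by (simp add: \<theta>_def threshold_def x_def power2_eq_square)
  have "measure P {\<omega> \<in> space P.
           Z_stat n p \<phi> (geodesic_dist \<A> g) (\<lambda>i. X i \<omega>) (\<lambda>i. X' i \<omega>) \<ge> threshold A p \<alpha>}
      \<le> 4 * exp (- (\<theta> * threshold A p \<alpha>))"
    by (rule S.tail_bound[OF assms(8,9,10,11) \<theta>])
  also have "\<dots> \<le> tail_F x"
    using x(1) divide_right_mono[of "- x" "ln (1 + x) - x" "(exp 1)\<^sup>2"]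
    unfolding \<theta>t tail_F_def by simp
  finally show ?thesis using x(2) by simp
qed

end
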